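(* For any $n\in\mathbb Z$, $$L_n(\phi_+)(z)=\phi_+'(z)\left(\frac{\phi_+(z)^{n+1}}{\phi_+'(z)}\right)_{++}-\frac12 z\phi_+'(z)\,\mathrm{Res}\left(\frac{\phi_+(s)^{n+1}}{\phi_+'(s)s^2},s=0\right)$$ and $$L_n(u)(z)=\rho_0^n\left(u'(z)\left(\frac{u(z)^{n+1}}{u'(z)}\right)_{++}-\frac12\left(zu'(z)+u(z)\right)\mathrm{Res}\left(\frac{u(s)^{n+1}}{u'(s)s^2},s=0\right)\right).$$
   Context: $\mathrm{Loop}^1(\mathbb C\setminus\{0\})$ is the set of compact subsets $\gamma\subset\mathbb C\setminus\{0\}$ homeomorphic to $S^1$ which surround $0$. For such $\gamma$ let $U_+\ni0$ be the bounded component of $\mathbb C\setminus\gamma$ and let $\phi_+:(\Delta,0)\to(U_+,0)$, $\Delta=\{|z|<1\}$, be the conformal isomorphism normalized by $\phi_+(z)=\rho_0u(z)$, $u(z)=z(1+\sum_{k\ge1}u_kz^k)$, $\rho_0>0$. Thus $\rho_0,u_k$ and (for fixed $z$) $\phi_+(z),u(z)$ are functions of $\gamma$. For a holomorphic function $v$ on $\mathbb C\setminus\{0\}$ with finite Laurent expansion let $\overset{\rightarrow}{v}=v_1\partial_x+v_2\partial_y$, $v=v_1+iv_2$, be the corresponding real vector field. It acts on functions $F$ of $\gamma$ by $(\pi_0(\overset{\rightarrow}{v})F)(\gamma)=\frac{d}{dt}\big|_{t=0}F(\exp(-t\overset{\rightarrow}{v})(\gamma))$, where $\exp(t\overset{\rightarrow}{v})$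 is the flow. Let $\overset{\rightarrow}{L}_n$, $\overset{\longrightarrow}{iL}_n$ correspond to $v(z)=-z^{n+1}$, $v(z)=-iz^{n+1}$. Here $L_n$ denotes the operator $\pi(L_n)=\frac12\left(\pi_0(\overset{\rightarrow}{L}_n)-i\pi_0(\overset{\longrightarrow}{iL}_n)\right)$, acting pointwise in $z$ on $\phi_+$ and $u$. For a Laurent expansion $f(z)=\sum_kf_kz^k$ at $z=0$, $f_{++}(z)=\sum_{k>0}f_kz^k$, and $\mathrm{Res}(f(s),s=0)=f_{-1}$. *)

theory Defs
  imports "HOL-Complex_Analysis.Complex_Analysis"
begin

definition Loop1 :: "complex set set" where
  "Loop1 = {\<gamma>. compact \<gamma> \<and> 0 \<notin> \<gamma> \<and> \<gamma> homeomorphic sphere (0::complex) 1 \<and> 0 \<in> inside \<gamma>}"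

text \<open>The component of the complement that contains 0; for \<open>\<gamma> \<in> Loop1\<close> it is the bounded one.\<close>

definition U_plus :: "complex set \<Rightarrow> complex set" where
  "U_plus \<gamma> = connected_component_set (- \<gamma>) 0"

definition conformal_iso :: "(complex \<Rightarrow> complex) \<Rightarrow> complex set \<Rightarrow> complex set \<Rightarrow> bool" where
  "conformal_iso f A B \<longleftrightarrow> f holomorphic_on A \<and> bij_betw f A B \<and> inv_into A f holomorphic_on B"

text \<open>A holomorphic \<open>f\<close> with \<open>f 0 = 0\<close> has the form \<open>\<rho> * z * (1 + (\<Sum>k\<ge>1. u_k * z ^ k))\<close> with
  \<open>\<rho> > 0\<close> iff its derivative at 0 is real and positive, and then \<open>\<rho>\<close> is that derivative. The value 0
  outside the unit disc is only there to make the total function unique.\<close>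

definition phi_plus :: "complex set \<Rightarrow> complex \<Rightarrow> complex" where
  "phi_plus \<gamma> = (THE f. conformal_iso f (ball 0 1) (U_plus \<gamma>) \<and> f 0 = 0 \<and>
      (\<exists>\<rho>::real. \<rho> > 0 \<and> deriv f 0 = complex_of_real \<rho>) \<and>
      (\<forall>z. z \<notin> ball 0 1 \<longrightarrow> f z = 0))"

definition rho0 :: "complex set \<Rightarrow> real" where
  "rho0 \<gamma> = Re (deriv (phi_plus \<gamma>) 0)"

definition u_plus :: "complex set \<Rightarrow> complex \<Rightarrow> complex" where
  "u_plus \<gamma> z = phi_plus \<gamma> z / complex_of_real (rho0 \<gamma>)"

text \<open>Identifying the plane with \<open>\<complex>\<close>, the real vector field \<open>v\<^sub>1 \<partial>\<^sub>x + v\<^sub>2 \<partial>\<^sub>y\<close> is the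
  complex-valued function \<open>v = v\<^sub>1 + \<i> v\<^sub>2\<close>; integral curves are parametrised by real time and stay in
  the punctured plane.\<close>

definition integral_curve :: "(complex \<Rightarrow> complex) \<Rightarrow> real set \<Rightarrow> (real \<Rightarrow> complex) \<Rightarrow> bool" where
  "integral_curve v T c \<longleftrightarrow>
     (\<forall>s\<in>T. c s \<noteq> 0 \<and> (c has_vector_derivative v (c s)) (at s within T))"

text \<open>The flow \<open>exp(t v)\<close>. It is a local flow: the value at \<open>w\<close> is meaningful only if the integral curve
  from \<open>w\<close> exists up to time \<open>t\<close>. On a compact set this is the case for all small \<open>t\<close>, and only these
  matter for the derivative at \<open>t = 0\<close> below.\<close>

definition flow :: "(complex \<Rightarrow> complex) \<Rightarrow> real \<Rightarrow> complex \<Rightarrow> complex" where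
  "flow v t w = (THE y. \<exists>c. integral_curve v (closed_segment 0 t) c \<and> c 0 = w \<and> c t = y)"

definition pi0 :: "(complex \<Rightarrow> complex) \<Rightarrow> (complex set \<Rightarrow> complex) \<Rightarrow> complex set \<Rightarrow> complex" where
  "pi0 v F \<gamma> = vector_derivative (\<lambda>t. F (flow v (- t) ` \<gamma>)) (at 0)"

text \<open>\<open>vector_derivative\<close> is total, so the existence of the derivative is recorded separately.\<close>

definition pi0_exists :: "(complex \<Rightarrow> complex) \<Rightarrow> (complex set \<Rightarrow> complex) \<Rightarrow> complex set \<Rightarrow> bool" where
  "pi0_exists v F \<gamma> \<longleftrightarrow> (\<lambda>t. F (flow v (- t) ` \<gamma>)) differentiable (at 0)"

definition vecL :: "int \<Rightarrow> complex \<Rightarrow> complex" where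
  "vecL n z = - (z powi (n + 1))"

definition veciL :: "int \<Rightarrow> complex \<Rightarrow> complex" where
  "veciL n z = - (\<i> * z powi (n + 1))"

definition pi_L :: "int \<Rightarrow> (complex set \<Rightarrow> complex) \<Rightarrow> complex set \<Rightarrow> complex" where
  "pi_L n F \<gamma> = 1 / 2 * (pi0 (vecL n) F \<gamma> - \<i> * pi0 (veciL n) F \<gamma>)"

definition pi_L_exists :: "int \<Rightarrow> (complex set \<Rightarrow> complex) \<Rightarrow> complex set \<Rightarrow> bool" where
  "pi_L_exists n F \<gamma> \<longleftrightarrow> pi0_exists (vecL n) F \<gamma> \<and> pi0_exists (veciL n) F \<gamma>"

definition pos_part :: "(complex \<Rightarrow> complex) \<Rightarrow> complex \<Rightarrow> complex" where
  "pos_part f z = (\<Sum>k. fls_nth (laurent_expansion f 0) (int (Suc k)) * z ^ Suc k)"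

end

theory Submission
  imports Defs
begin

text \<open>Write \<open>\<gamma>\<^sub>t = h\<^sub>t(\<gamma>)\<close>, where \<open>h\<^sub>t\<close> is the flow of \<open>a w\<^bsup>n+1\<^esup>\<close> with \<open>a = 1\<close> or \<open>a = \<i>\<close>, and let
  \<open>\<phi>, \<phi>\<^sub>t\<close> be the Riemann maps of \<open>\<gamma>, \<gamma>\<^sub>t\<close>. Since \<open>\<gamma>\<close> is only a Jordan curve, \<open>\<phi>\<close> has no boundary
  regularity, and the variation of \<open>\<phi>\<^sub>t\<close> is controlled by the maximum principle alone: \<open>e = ln |\<phi>\<^sub>t\<^sup>-\<^sup>1(\<phi> s) / s|\<close>
  is harmonic in the inner disc, \<open>d = ln |\<phi>\<^sub>t\<^sup>-\<^sup>1(h\<^sub>t(\<phi> s)) / s|\<close> is harmonic in an annulus up to the unit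
  circle, where it vanishes, and on interior circles \<open>d - e\<close> is explicit up to a small error. As in Schwarz's
  alternating method, a bound \<open>|d - e| \<le> \<delta>\<close> on two circles forces \<open>e = O(\<delta>)\<close>. This gives \<open>e = O(t)\<close>; applied
  again after subtracting a first-order candidate with the correct boundary values, it gives an error \<open>O(t\<^sup>2)\<close>,
  that is, differentiability. If \<open>\<phi>\<^bsup>n+1\<^esup> / \<phi>' = \<Sum>c\<^sub>k s\<^sup>k\<close>, the derivative is \<open>\<phi>'\<close> times the function with
  coefficients \<open>Re (a c\<^sub>1)\<close> at \<open>s\<close> and \<open>a c\<^sub>k + cnj (a c\<^bsub>2-k\<^esub>)\<close> at \<open>s\<^sup>k\<close>, \<open>k \<ge> 2\<close>. In the combination defining
  \<open>L\<^sub>n\<close> the conjugate-linear terms cancel.\<close>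

section \<open>Harmonic functions and the alternating estimate\<close>

text \<open>Neither comparison function covers the whole disc. \<phi> need not map the disc into the
  deformed interior, so \<phi>_t^{-1} o \<phi> is used on a disc of radius \<open>q < 1\<close> with
  unknown values on its rim; inserting the flow gives known boundary values, because h_t carries
  \<gamma> to \<gamma>_t, but costs the origin, where the field may have a pole. The two overlap in
  an annulus, which is what the alternation exploits. All constants must be uniform in t, since
  nothing is known beforehand on how \<phi>_t depends on t; they come from Schwarz's lemma and from
  fixed compact sets. A candidate with the correct boundary values exists in closed form because
  \<phi>^{n+1} / \<phi>' has only finitely many powers with exponent at most 0: reflecting them in
  the unit circle gives a polynomial, while the irregular holomorphic rest cancels. The estimates
  concern \<phi>_t^{-1} o \<phi>; \<phi>_t itself is recovered by solving an equation near the
  identity, and the variation of \<open>rho0\<close>, needed for u, is read off the same expansion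
  at s = 0.\<close>

definition harmonic_re :: "(complex \<Rightarrow> real) \<Rightarrow> complex set \<Rightarrow> bool" where
  "harmonic_re u S \<longleftrightarrow> (\<forall>z\<in>S. \<exists>e>0. \<exists>f. ball z e \<subseteq> S \<and> f holomorphic_on ball z e \<and> (\<forall>w\<in>ball z e. u w = Re (f w)))"

lemma harmonic_reE:
  assumes "harmonic_re u S" "z \<in> S"
  obtains e f where "e > 0" "ball z e \<subseteq> S" "f holomorphic_on ball z e" "\<And>w. w \<in> ball z e \<Longrightarrow> u w = Re (f w)"
  using assms unfolding harmonic_re_def by meson

lemma harmonic_re_continuous_on:
  assumes "harmonic_re u S" "open S"
  shows "continuous_on S u"
proof -
  have "isCont u z" if z: "z \<in> S" for z
  proof -
    obtain e f where e: "e > 0" "f holomorphic_on ball z e" "\<And>w. w \<in> ball z e \<Longrightarrow> u w = Re (f w)"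
      using harmonic_reE[OF assms(1) z] by metis
    have "continuous_on (ball z e) (\<lambda>w. Re (f w))"
      using e(2) by (intro continuous_intros holomorphic_on_imp_continuous_on)
    then have "continuous_on (ball z e) u"
      by (subst continuous_on_cong[OF refl e(3)])
    then show ?thesis
      using e(1) by (simp add: continuous_on_eq_continuous_at)
  qed
  then show ?thesis
    by (simp add: continuous_at_imp_continuous_on)
qed

lemma harmonic_re_add:
  assumes "harmonic_re u S" "harmonic_re v S"
  shows "harmonic_re (\<lambda>z. u z + v z) S"
  unfolding harmonic_re_def
proof
  fix z assume z: "z \<in> S"
  obtain e f where e: "e > 0" "ball z e \<subseteq> S" "f holomorphic_on ball z e" "\<And>w. w \<in> ball z e \<Longrightarrow> u w = Re (f w)"
    using harmonic_reE[OF assms(1) z] by metis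
  obtain e' f' where e': "e' > 0" "ball z e' \<subseteq> S" "f' holomorphic_on ball z e'" "\<And>w. w \<in> ball z e' \<Longrightarrow> v w = Re (f' w)"
    using harmonic_reE[OF assms(2) z] by metis
  have "(\<lambda>w. f w + f' w) holomorphic_on ball z (min e e')"
    by (intro holomorphic_intros holomorphic_on_subset[OF e(3)] holomorphic_on_subset[OF e'(3)]) auto
  then show "\<exists>e>0. \<exists>f. ball z e \<subseteq> S \<and> f holomorphic_on ball z e \<and> (\<forall>w\<in>ball z e. u w + v w = Re (f w))"
    using e e' by (intro exI[of _ "min e e'"] conjI exI[of _ "\<lambda>w. f w + f' w"]) (auto simp: subset_eq)
qed

lemma harmonic_re_cmult:
  assumes "harmonic_re u S"
  shows "harmonic_re (\<lambda>z. c * u z) S"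
  unfolding harmonic_re_def
proof
  fix z assume z: "z \<in> S"
  obtain e f where e: "e > 0" "ball z e \<subseteq> S" "f holomorphic_on ball z e" "\<And>w. w \<in> ball z e \<Longrightarrow> u w = Re (f w)"
    using harmonic_reE[OF assms(1) z] by metis
  have "(\<lambda>w. of_real c * f w) holomorphic_on ball z e"
    by (intro holomorphic_intros e)
  then show "\<exists>e>0. \<exists>f. ball z e \<subseteq> S \<and> f holomorphic_on ball z e \<and> (\<forall>w\<in>ball z e. c * u w = Re (f w))"
    using e by (intro exI[of _ e] conjI exI[of _ "\<lambda>w. of_real c * f w"]) auto
qed

lemma harmonic_re_Re:
  assumes "f holomorphic_on S" "open S"
  shows "harmonic_re (\<lambda>z. Re (f z)) S"
  unfolding harmonic_re_def
proof
  fix z assume z: "z \<in> S"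
  then obtain e where "e > 0" "ball z e \<subseteq> S"
    using assms(2) openE by blast
  then show "\<exists>e>0. \<exists>g. ball z e \<subseteq> S \<and> g holomorphic_on ball z e \<and> (\<forall>w\<in>ball z e. Re (f w) = Re (g w))"
    using assms(1) holomorphic_on_subset by blast
qed

text \<open>The reason for the local form of \<open>harmonic_re\<close>: on an annulus
  \<open>f\<close> need not have a holomorphic logarithm, but on each small ball it has one.\<close>

lemma harmonic_re_ln_norm:
  assumes "f holomorphic_on S" "open S" "\<And>z. z \<in> S \<Longrightarrow> f z \<noteq> 0"
  shows "harmonic_re (\<lambda>z. ln (norm (f z))) S"
  unfolding harmonic_re_def
proof
  fix z assume z: "z \<in> S"
  then obtain e where e: "e > 0" "ball z e \<subseteq> S"
    using assms(2) openE by blast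
  have nz: "w \<in> ball z e \<Longrightarrow> f w \<noteq> 0" for w
    using e assms(3) by auto
  obtain g where g: "g holomorphic_on ball z e" "\<And>w. w \<in> ball z e \<Longrightarrow> f w = exp (g w)"
    using contractible_imp_holomorphic_log[OF holomorphic_on_subset[OF assms(1) e(2)] _ nz]
    by (auto simp: convex_imp_contractible)
  then show "\<exists>e>0. \<exists>g. ball z e \<subseteq> S \<and> g holomorphic_on ball z e \<and> (\<forall>w\<in>ball z e. ln (norm (f w)) = Re (g w))"
    using e by (intro exI[of _ e] conjI exI[of _ g]) auto
qed

lemma harmonic_re_subset:
  assumes "harmonic_re u S" "T \<subseteq> S" "open T"
  shows "harmonic_re u T"
  unfolding harmonic_re_def
proof
  fix z assume z: "z \<in> T"
  obtain e f where e: "e > 0" "ball z e \<subseteq> S" "f holomorphic_on ball z e" "\<And>w. w \<in> ball z e \<Longrightarrow> u w = Re (f w)"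
    using harmonic_reE[OF assms(1), of z] z assms(2) by (metis subsetD)
  obtain e' where e': "e' > 0" "ball z e' \<subseteq> T"
    using z assms(3) openE by blast
  show "\<exists>e>0. \<exists>f. ball z e \<subseteq> T \<and> f holomorphic_on ball z e \<and> (\<forall>w\<in>ball z e. u w = Re (f w))"
    using e e' holomorphic_on_subset[OF e(3), of "ball z (min e e')"]
    by (intro exI[of _ "min e e'"] conjI exI[of _ f]) (auto simp: subset_eq)
qed

text \<open>Boundary values enter only as an upper limit at each frontier point, since the functions
  in question need not extend continuously to the unit circle. This already makes the superlevel set
  \<open>K\<close> compact, so a maximum is attained inside \<open>S\<close>; the set
  \<open>A\<close> where it is attained would be closed, open and bounded in the plane.\<close>

lemma harmonic_re_maximum_principle:
  assumes S: "open S" "bounded S" and u: "harmonic_re u S"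
    and bd: "\<And>x e. x \<in> frontier S \<Longrightarrow> e > 0 \<Longrightarrow> eventually (\<lambda>y. u y < c + e) (at x within S)"
    and z: "z \<in> S"
  shows "u z \<le> c"
proof (rule ccontr)
  assume "\<not> u z \<le> c"
  define e where "e = (u z - c) / 2"
  have e: "e > 0" "u z > c + e"
    using \<open>\<not> u z \<le> c\<close> by (auto simp: e_def field_simps)
  have cont: "continuous_on S u"
    by (rule harmonic_re_continuous_on[OF u S(1)])
  define K where "K = {w\<in>S. u w \<ge> c + e}"
  have "closed K"
    unfolding closed_limpt
  proof (intro allI impI)
    fix x assume x: "x islimpt K"
    then have xl: "x islimpt S"
      by (rule islimpt_subset) (auto simp: K_def)
    show "x \<in> K"
    proof (cases "x \<in> S")
      case True
      then have "(u \<longlongrightarrow> u x) (at x within S)"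
        using cont by (simp add: continuous_on_def)
      then have "(u \<longlongrightarrow> u x) (at x within K)"
        by (rule tendsto_within_subset) (auto simp: K_def)
      moreover have "eventually (\<lambda>w. c + e \<le> u w) (at x within K)"
        by (auto simp: eventually_at_filter K_def)
      ultimately have "c + e \<le> u x"
        using x by (intro tendsto_lowerbound) (auto simp: trivial_limit_within)
      then show ?thesis
        using True by (simp add: K_def)
    next
      case False
      then have "x \<in> frontier S"
        using xl S(1) by (auto simp: frontier_def closure_def interior_open)
      from bd[OF this e(1)] have "eventually (\<lambda>y. u y < c + e) (at x within K)"
        by (rule filter_leD[OF at_le, rotated]) (auto simp: K_def)
      moreover have "eventually (\<lambda>w. c + e \<le> u w) (at x within K)"
        by (auto simp: eventually_at_filter K_def)
      ultimately have "eventually (\<lambda>y. False) (at x within K)"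
        by eventually_elim auto
      then show ?thesis
        using x by (metis eventually_False trivial_limit_within)
    qed
  qed
  moreover have "bounded K"
    using S(2) by (rule bounded_subset) (auto simp: K_def)
  ultimately have K: "compact K"
    by (simp add: compact_eq_bounded_closed)
  have zK: "z \<in> K"
    using z e by (simp add: K_def)
  have KS: "K \<subseteq> S"
    by (auto simp: K_def)
  obtain x where x: "x \<in> K" "\<And>w. w \<in> K \<Longrightarrow> u w \<le> u x"
    using continuous_attains_sup[OF K _ continuous_on_subset[OF cont KS]] zK by blast
  have mx: "u w \<le> u x" if "w \<in> S" for w
    using x(2)[of w] x(2)[OF zK] e that by (cases "w \<in> K") (auto simp: K_def)
  define A where "A = {w\<in>K. u w = u x}"
  have A_eq: "A = {w\<in>S. u w = u x}"
    using x by (auto simp: A_def K_def)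
  have "closed A"
    using continuous_closed_preimage_constant[OF continuous_on_subset[OF cont KS] compact_imp_closed[OF K], of "u x"]
    by (simp add: A_def)
  moreover have "open A"
    unfolding open_contains_ball
  proof
    fix w assume w: "w \<in> A"
    then have wS: "w \<in> S" and uw: "u w = u x"
      by (auto simp: A_eq)
    obtain r f where r: "r > 0" "ball w r \<subseteq> S" "f holomorphic_on ball w r" "\<And>y. y \<in> ball w r \<Longrightarrow> u y = Re (f y)"
      using harmonic_reE[OF u wS] by metis
    \<comment> \<open>As \<open>norm (exp (f y)) = exp (u y)\<close>, a local maximum of
      \<open>u\<close> is one of the modulus.\<close>
    have "(\<lambda>y. exp (f y)) constant_on ball w r"
    proof (rule maximum_modulus_principle[of _ _ "ball w r" w])
      show "(\<lambda>y. exp (f y)) holomorphic_on ball w r"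
        by (intro holomorphic_intros r)
      show "norm (exp (f y)) \<le> norm (exp (f w))" if "y \<in> ball w r" for y
        using mx[of y] that r uw by (auto simp: subset_eq)
    qed (use r in auto)
    then obtain b where b: "\<And>y. y \<in> ball w r \<Longrightarrow> exp (f y) = b"
      by (auto simp: constant_on_def)
    have "u y = u x" if "y \<in> ball w r" for y
    proof -
      have "norm (exp (f y)) = norm (exp (f w))"
        using b[OF that] b[of w] r(1) by simp
      then show ?thesis
        using r(1) r(4)[OF that] r(4)[of w] uw by simp
    qed
    then show "\<exists>e>0. ball w e \<subseteq> A"
      using r by (auto simp: A_eq intro!: exI[of _ r])
  qed
  moreover have "A \<noteq> {}"
    using x(1) by (auto simp: A_def)
  ultimately have "A = UNIV"
    using clopen by blast
  moreover have "bounded A"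
    using \<open>bounded K\<close> by (rule bounded_subset) (auto simp: A_def)
  ultimately show False
    using not_bounded_UNIV[where 'a=complex] by simp
qed

text \<open>The majorant \<open>ln (norm z) / ln r1\<close> is harmonic, equals 1 on the circle of
  radius \<open>r1\<close> and 0 on the unit circle. The margin between \<open>r0\<close> and
  \<open>r1\<close> makes \<open>d\<close> continuous across the inner circle, so only the outer
  boundary needs a limit condition.\<close>

lemma harmonic_re_annulus_upper_bound:
  assumes r: "0 < r0" "r0 < r1" "r1 < 1"
    and d: "harmonic_re d {s. r0 < norm s \<and> norm s < 1}"
    and lim: "\<And>e. e > 0 \<Longrightarrow> \<exists>\<rho><1. \<forall>s. \<rho> < norm s \<longrightarrow> norm s < 1 \<longrightarrow> d s < e"
    and m: "m \<ge> 0" "\<And>s. norm s = r1 \<Longrightarrow> d s \<le> m"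
    and z: "r1 < norm z" "norm z < 1"
  shows "d z \<le> m * (ln (norm z) / ln r1)"
proof -
  define S where "S = {s::complex. r1 < norm s \<and> norm s < 1}"
  define u where "u s = d s + (- m / ln r1) * ln (norm s)" for s
  have ln1: "ln r1 < 0"
    using r by simp
  have opS: "open S"
    unfolding S_def by (intro open_Collect_conj open_Collect_less continuous_intros)
  have opS0: "open {s::complex. r0 < norm s \<and> norm s < 1}"
    by (intro open_Collect_conj open_Collect_less continuous_intros)
  have h0: "harmonic_re u {s. r0 < norm s \<and> norm s < 1}"
    unfolding u_def
    by (intro harmonic_re_add d harmonic_re_cmult harmonic_re_ln_norm opS0 holomorphic_intros) (use r in auto)
  have "u z \<le> 0"
  proof (rule harmonic_re_maximum_principle[OF opS])
    show "bounded S"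
      by (rule bounded_subset[of "ball 0 1"]) (auto simp: S_def)
    show "harmonic_re u S"
      by (rule harmonic_re_subset[OF h0 _ opS]) (use r in \<open>auto simp: S_def\<close>)
    show "z \<in> S"
      using z by (simp add: S_def)
    fix x :: complex and e :: real assume x: "x \<in> frontier S" and e: "e > 0"
    have "closure S \<subseteq> {s. r1 \<le> norm s \<and> norm s \<le> 1}"
      by (rule closure_minimal) (auto simp: S_def intro!: closed_Collect_conj closed_Collect_le continuous_intros)
    with x opS have "norm x = r1 \<or> norm x = 1"
      by (auto simp: frontier_def interior_open S_def)
    then show "eventually (\<lambda>y. u y < 0 + e) (at x within S)"
    proof
      assume x1: "norm x = r1"
      have "isCont u x"
        using harmonic_re_continuous_on[OF h0 opS0] x1 r by (auto simp: continuous_on_eq_continuous_at[OF opS0])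
      moreover have "u x < e"
        using m(2)[OF x1] x1 ln1 e by (simp add: u_def)
      ultimately have "eventually (\<lambda>y. u y < e) (at x)"
        by (metis isCont_def order_tendstoD(2))
      then show ?thesis
        by (simp add: eventually_at_filter) (auto elim: eventually_mono)
    next
      assume x1: "norm x = 1"
      obtain \<rho> where \<rho>: "\<rho> < 1" "\<And>s. \<rho> < norm s \<Longrightarrow> norm s < 1 \<Longrightarrow> d s < e"
        using lim[OF e] by blast
      have "eventually (\<lambda>y. \<rho> < norm y) (at x)"
        by (rule order_tendstoD(1)[OF tendsto_norm[OF tendsto_ident_at]]) (use \<rho> x1 in auto)
      then have "eventually (\<lambda>y. \<rho> < norm y) (at x within S)"
        by (simp add: eventually_at_filter) (auto elim: eventually_mono)
      moreover have "eventually (\<lambda>y. y \<in> S) (at x within S)"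
        by (simp add: eventually_at_filter)
      ultimately show ?thesis
      proof eventually_elim
        case (elim y)
        then have "0 < norm y" "norm y < 1" "d y < e"
          using \<rho>(2)[of y] r by (auto simp: S_def simp del: zero_less_norm_iff)
        then have "ln (norm y) \<le> 0"
          by (simp add: ln_le_zero_iff)
        \<comment> \<open>The coefficient is nonnegative because \<open>ln r1 < 0\<close>, so inside
          the unit disc the comparison term only lowers \<open>u\<close> below
          \<open>d\<close>.\<close>
        moreover have "(- m / ln r1) * ln (norm y) \<le> 0"
          using m(1) ln1 \<open>ln (norm y) \<le> 0\<close> by (simp add: mult_le_0_iff zero_le_divide_iff)
        ultimately show ?case
          using \<open>d y < e\<close> by (simp add: u_def)
      qed
    qed
  qed
  then show ?thesis
    by (simp add: u_def)
qed

lemma Re_abs_le_on_cball: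
  assumes "r < q" "0 < r" and l: "l holomorphic_on ball 0 q"
    and b: "\<And>s. norm s = r \<Longrightarrow> \<bar>Re (l s)\<bar> \<le> b"
    and z: "z \<in> cball 0 r"
  shows "\<bar>Re (l z)\<bar> \<le> b"
proof (cases "norm z = r")
  case False
  then have z': "z \<in> ball 0 r"
    using z by auto
  have *: "Re (f z) \<le> b" if f: "f holomorphic_on ball 0 q" "\<And>s. norm s = r \<Longrightarrow> Re (f s) \<le> b" for f
  proof (rule harmonic_re_maximum_principle[of "ball 0 r" "\<lambda>z. Re (f z)"])
    show "harmonic_re (\<lambda>z. Re (f z)) (ball 0 r)"
      by (intro harmonic_re_Re holomorphic_on_subset[OF f(1)]) (use assms in auto)
    fix x :: complex and e :: real assume x: "x \<in> frontier (ball 0 r)" and e: "e > 0"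
    then have nx: "norm x = r"
      using assms by (simp add: frontier_ball)
    have "continuous_on (ball 0 q) (\<lambda>y. Re (f y))"
      by (intro continuous_intros holomorphic_on_imp_continuous_on f)
    then have "isCont (\<lambda>y. Re (f y)) x"
      using nx assms by (auto simp: continuous_on_eq_continuous_at)
    moreover have "Re (f x) < b + e"
      using f(2)[OF nx] e by simp
    ultimately have "eventually (\<lambda>y. Re (f y) < b + e) (at x)"
      by (metis isCont_def order_tendstoD(2))
    then show "eventually (\<lambda>y. Re (f y) < b + e) (at x within ball 0 r)"
      by (simp add: eventually_at_filter) (auto elim: eventually_mono)
  qed (use z' in auto)
  have "Re (l z) \<le> b"
    by (rule *[OF l]) (metis b abs_le_D1)
  moreover have "Re (- l z) \<le> b"
  proof (rule *)
    show "(\<lambda>z. - l z) holomorphic_on ball 0 q"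
      by (intro holomorphic_intros l)
    show "Re (- l s) \<le> b" if "norm s = r" for s
      using b[OF that] by simp
  qed
  ultimately show ?thesis
    by simp
qed (use b in auto)

text \<open>The harmonic measure of the circle of radius \<open>r1\<close>, seen from radius \<open>r2\<close> in the annulus up to the unit circle, is
  \<open>\<theta> = ln r2 / ln r1 < 1\<close>; so the oscillation between disc and annulus contracts by the factor \<open>\<theta>\<close>.\<close>

lemma alternating_estimate:
  assumes r: "0 < r0" "r0 < r1" "r1 < r2" "r2 < 1" "r2 < q"
    and l: "l holomorphic_on ball 0 q"
    and d: "harmonic_re d {s. r0 < norm s \<and> norm s < 1}"
    and lim: "\<And>e. e > 0 \<Longrightarrow> \<exists>\<rho><1. \<forall>s. \<rho> < norm s \<longrightarrow> norm s < 1 \<longrightarrow> \<bar>d s\<bar> < e"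
    and \<delta>: "\<And>s. norm s = r1 \<or> norm s = r2 \<Longrightarrow> \<bar>d s - Re (l s)\<bar> \<le> \<delta>"
    and z: "z \<in> cball 0 r2"
  shows "\<bar>Re (l z)\<bar> \<le> 2 * \<delta> / (1 - ln r2 / ln r1)"
proof -
  define \<theta> where "\<theta> = ln r2 / ln r1"
  have \<theta>: "0 < \<theta>" "\<theta> < 1"
    using r by (auto simp: \<theta>_def divide_neg_neg field_simps)
  have \<delta>0: "\<delta> \<ge> 0"
    using \<delta>[of "of_real r1"] r by (smt (verit) norm_of_real)
  have "continuous_on (cball 0 r2) (\<lambda>s. \<bar>Re (l s)\<bar>)"
    using holomorphic_on_imp_continuous_on[OF l] r
    by (intro continuous_intros) (auto elim!: continuous_on_subset)
  then obtain x where x: "x \<in> cball 0 r2" "\<And>s. s \<in> cball 0 r2 \<Longrightarrow> \<bar>Re (l s)\<bar> \<le> \<bar>Re (l x)\<bar>"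
    using continuous_attains_sup[of "cball 0 r2" "\<lambda>s. \<bar>Re (l s)\<bar>"] z r by fastforce
  \<comment> \<open>One round trip bounds \<open>m\<close> by itself: change from \<open>l\<close>
    to \<open>d\<close> on radius \<open>r1\<close> at cost \<delta>, contract by \<theta> on the
    way to radius \<open>r2\<close>, change back at cost \<delta>, and fill in the disc. The result
    m \<le> (m + \<delta>) \<theta> + \<delta> can be solved for \<open>m\<close> because \<theta> <
    1.\<close>
  define m where "m = \<bar>Re (l x)\<bar>"
  have d1: "\<bar>d s\<bar> \<le> m + \<delta>" if "norm s = r1" for s
    using \<delta>[of s] x(2)[of s] that r by (auto simp: m_def)
  have d2: "\<bar>d s\<bar> \<le> (m + \<delta>) * \<theta>" if s: "norm s = r2" for s
  proof -
    have "d s \<le> (m + \<delta>) * (ln (norm s) / ln r1)"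
    proof (rule harmonic_re_annulus_upper_bound[OF r(1,2) _ d])
      fix e :: real assume "e > 0"
      then show "\<exists>\<rho><1. \<forall>s. \<rho> < norm s \<longrightarrow> norm s < 1 \<longrightarrow> d s < e"
        using lim[of e] by (meson abs_less_iff)
    next
      show "d s \<le> m + \<delta>" if "norm s = r1" for s
        using d1[OF that] by simp
    qed (use r s \<delta>0 in \<open>auto simp: m_def\<close>)
    moreover have "(-1) * d s \<le> (m + \<delta>) * (ln (norm s) / ln r1)"
    proof (rule harmonic_re_annulus_upper_bound[OF r(1,2) _ harmonic_re_cmult[OF d]])
      fix e :: real assume "e > 0"
      then show "\<exists>\<rho><1. \<forall>s. \<rho> < norm s \<longrightarrow> norm s < 1 \<longrightarrow> (-1) * d s < e"
        using lim[of e] by (simp add: abs_less_iff) meson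
    next
      show "(-1) * d s \<le> m + \<delta>" if "norm s = r1" for s
        using d1[OF that] by simp
    qed (use r s \<delta>0 in \<open>auto simp: m_def\<close>)
    ultimately show ?thesis
      using s by (simp add: \<theta>_def)
  qed
  have "\<bar>Re (l s)\<bar> \<le> (m + \<delta>) * \<theta> + \<delta>" if "norm s = r2" for s
    using d2[OF that] \<delta>[of s] that by auto
  then have "\<bar>Re (l y)\<bar> \<le> (m + \<delta>) * \<theta> + \<delta>" if "y \<in> cball 0 r2" for y
    using Re_abs_le_on_cball[OF r(5) _ l _ that] r by auto
  from this[OF x(1)] have "m * (1 - \<theta>) \<le> \<delta> * (1 + \<theta>)"
    by (simp add: m_def algebra_simps)
  also have "\<dots> \<le> 2 * \<delta>"
    using \<theta> \<delta>0 by (simp add: algebra_simps mult_left_le)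
  finally have "m \<le> 2 * \<delta> / (1 - \<theta>)"
    using \<theta> by (simp add: field_simps)
  then show ?thesis
    using x(2)[OF z] by (simp add: m_def \<theta>_def)
qed

section \<open>From bounds on real parts to bounds on functions and Taylor remainders\<close>

text \<open>The Moebius map w / (2 B - w) fixes 0 and sends the half-plane Re w < B into the unit
  disc. Schwarz's lemma applies to its composition with \<open>f\<close>, and the resulting
  inequality is solved for \<open>norm (f z)\<close>.\<close>

lemma borel_caratheodory:
  assumes f: "f holomorphic_on ball 0 R" "f 0 = 0" and B: "\<And>z. z \<in> ball 0 R \<Longrightarrow> Re (f z) < B"
    and z: "norm z < R"
  shows "norm (f z) \<le> 2 * B * norm z / (R - norm z)"
proof -
  have R: "R > 0"
    using z norm_ge_zero[of z] by linarith
  have B0: "B > 0"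
    using B[of 0] R f(2) by simp
  define g where "g \<zeta> = f (of_real R * \<zeta>) / (2 * of_real B - f (of_real R * \<zeta>))" for \<zeta>
  have in_ball: "of_real R * \<zeta> \<in> ball 0 R" if "norm \<zeta> < 1" for \<zeta> :: complex
    using that R by (simp add: norm_mult)
  have less: "norm w < norm (2 * of_real B - w)" if "Re w < B" for w :: complex
  proof -
    have "(Re w)\<^sup>2 < (2 * B - Re w)\<^sup>2"
      using that B0 by (simp add: power2_eq_square algebra_simps)
    then have "(norm w)\<^sup>2 < (norm (2 * of_real B - w))\<^sup>2"
      by (simp add: cmod_power2)
    then show ?thesis
      by (rule power_less_imp_less_base) simp
  qed
  have nz: "2 * of_real B - f (of_real R * \<zeta>) \<noteq> 0" if "norm \<zeta> < 1" for \<zeta>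
    using less[OF B[OF in_ball[OF that]]] by (metis norm_ge_zero norm_zero not_le)
  have "norm (g (z / of_real R)) \<le> norm (z / of_real R)"
  proof (rule Schwarz_Lemma(1))
    have "(\<lambda>\<zeta>. f (of_real R * \<zeta>)) holomorphic_on ball 0 1"
      using in_ball by (intro holomorphic_on_compose_gen[OF _ f(1), unfolded o_def] holomorphic_intros) auto
    then show "g holomorphic_on ball 0 1"
      unfolding g_def using nz by (intro holomorphic_intros) auto
    show "norm (g \<zeta>) < 1" if "norm \<zeta> < 1" for \<zeta>
      using less[OF B[OF in_ball[OF that]]] nz[OF that] by (simp add: g_def norm_divide)
    show "norm (z / of_real R) < 1"
      using z R by (simp add: norm_divide)
  qed (simp add: g_def f)
  then have g: "norm (f z) / norm (2 * of_real B - f z) \<le> norm z / R"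
    using R by (simp add: g_def norm_divide)
  have pos: "norm (2 * of_real B - f z) > 0"
    using less[OF B, of z] z by (auto intro: le_less_trans[OF norm_ge_zero])
  have "norm (f z) * R \<le> norm z * norm (2 * of_real B - f z)"
    using g pos R by (simp add: field_simps)
  also have "\<dots> \<le> norm z * (2 * B + norm (f z))"
    using norm_triangle_ineq4[of "2 * of_real B" "f z"] B0 by (intro mult_left_mono) auto
  finally show ?thesis
    using z by (simp add: field_simps)
qed

lemma norm_deriv_le:
  assumes "f holomorphic_on ball x r" "r > 0" "\<And>w. w \<in> ball x r \<Longrightarrow> norm (f w) \<le> B"
  shows "norm (deriv f x) \<le> B / r"
proof -
  have *: "norm (deriv f x) \<le> b / s" if "0 < s" "s < r" "B < b" for b s
  proof -
    have "norm ((deriv ^^ 1) f x) \<le> fact 1 * b / s ^ 1"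
    proof (rule Cauchy_higher_deriv_bound[of f x s 0])
      show "f holomorphic_on ball x s" "continuous_on (cball x s) f"
        using that holomorphic_on_imp_continuous_on[OF assms(1)]
        by (auto intro!: holomorphic_on_subset[OF assms(1)] elim!: continuous_on_subset)
      show "f w \<in> ball 0 b" if "w \<in> ball x s" for w
        using assms(3)[of w] that \<open>s < r\<close> \<open>B < b\<close> by auto
    qed (use that in auto)
    then show ?thesis by simp
  qed
  \<comment> \<open>Two limits remove the slack: \<open>b\<close> decreases to \<open>B\<close>, and
    the radius \<open>t * r\<close> increases to \<open>r\<close>.\<close>
  have "norm (deriv f x) * r \<le> B"
  proof (rule field_le_mult_one_interval)
    fix t :: real assume t: "0 < t" "t < 1"
    have "norm (deriv f x) * (t * r) \<le> b" if "B < b" for b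
      using *[of "t * r" b] t that assms(2) by (simp add: pos_le_divide_eq)
    then have "norm (deriv f x) * (t * r) \<le> B"
      by (rule dense_ge)
    then show "t * (norm (deriv f x) * r) \<le> B"
      by (simp add: mult_ac)
  qed
  then show ?thesis
    using assms(2) by (simp add: pos_le_divide_eq)
qed

text \<open>Two Cauchy estimates, each giving up a ring of width R/4 at the price of a factor 4/R,
  bound the second derivative on the disc of radius R/2 by 16 B / R^2.\<close>

lemma norm_Taylor2_le:
  assumes f: "f holomorphic_on ball 0 R" "\<And>w. w \<in> ball 0 R \<Longrightarrow> norm (f w) \<le> B"
    and z: "norm z < R / 2"
  shows "norm (f z - f 0 - z * deriv f 0) \<le> 16 * B / R\<^sup>2 * (norm z)\<^sup>2"
proof -
  have R: "R > 0"
    using z norm_ge_zero[of z] by linarith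
  have f': "deriv f holomorphic_on ball 0 R"
    by (intro holomorphic_deriv f) auto
  have b1: "norm (deriv f x) \<le> B / (R / 4)" if "x \<in> ball 0 (3 * R / 4)" for x
  proof -
    have "ball x (R / 4) \<subseteq> ball 0 R"
      using that by (simp add: ball_subset_ball_iff)
    then show ?thesis
      using R by (intro norm_deriv_le holomorphic_on_subset[OF f(1)] f(2)) auto
  qed
  have b2: "norm (deriv (deriv f) x) \<le> (B / (R / 4)) / (R / 4)" if "x \<in> ball 0 (R / 2)" for x
  proof -
    have "ball x (R / 4) \<subseteq> ball 0 (3 * R / 4)"
      using that by (simp add: ball_subset_ball_iff)
    then show ?thesis
      using R by (intro norm_deriv_le holomorphic_on_subset[OF f'] b1) auto
  qed
  have "norm ((deriv ^^ 0) f z - (\<Sum>i\<le>1. (deriv ^^ i) f 0 * (z - 0) ^ i / fact i))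
      \<le> (B / (R / 4)) / (R / 4) * norm (z - 0) ^ Suc 1 / fact 1"
  proof (rule complex_Taylor[of "ball 0 (R / 2)" 1 "\<lambda>i. (deriv ^^ i) f"])
    fix i x assume "x \<in> ball (0::complex) (R / 2)" "i \<le> (1::nat)"
    then have "((deriv ^^ i) f has_field_derivative deriv ((deriv ^^ i) f) x) (at x)"
      using R by (intro holomorphic_derivI[of _ "ball 0 R"] holomorphic_higher_deriv f) auto
    then show "((deriv ^^ i) f has_field_derivative (deriv ^^ Suc i) f x) (at x within ball 0 (R / 2))"
      by (simp add: has_field_derivative_at_within)
  qed (use b2 z R in auto)
  then show ?thesis
    using R by (simp add: power2_eq_square algebra_simps)
qed

text \<open>Turns crude two-sided bounds on a modulus, which can be had uniformly in t, into first
  and second order bounds in time. The logarithm of \<open>g\<close> vanishing at 0 has real part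
  below \<open>B\<close>, hence by Borel-Caratheodory modulus at most 2 B on radius R/2; the
  second-order Taylor bound there gives 16 (2 B) / (R/2)^2 = 128 B / R^2.\<close>

lemma ln_norm_expansion:
  assumes g: "g holomorphic_on ball 0 R" "g 0 = 1"
    and B: "\<And>\<tau>. \<tau> \<in> ball 0 R \<Longrightarrow> exp (- B) < norm (g \<tau>) \<and> norm (g \<tau>) < exp B"
    and \<tau>: "norm \<tau> < R / 4"
  shows "\<bar>ln (norm (g \<tau>))\<bar> \<le> 4 * B / R * norm \<tau>"
    and "\<bar>ln (norm (g \<tau>)) - Re (\<tau> * deriv g 0)\<bar> \<le> 128 * B / R\<^sup>2 * (norm \<tau>)\<^sup>2"
proof -
  have R: "R > 0"
    using \<tau> norm_ge_zero[of \<tau>] by linarith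
  have nz: "g w \<noteq> 0" if "w \<in> ball 0 R" for w
    using B[OF that] by (metis exp_gt_zero less_trans norm_zero order_less_irrefl)
  have B0: "B > 0"
    using B[of 0] R g(2) by (simp)
  obtain f where f: "f holomorphic_on ball 0 R" "\<And>w. w \<in> ball 0 R \<Longrightarrow> g w = exp (f w)"
    using contractible_imp_holomorphic_log[OF g(1) _ nz] by (auto simp: convex_imp_contractible)
  define h where "h w = f w - f 0" for w
  have ef0: "exp (f 0) = 1"
    using f(2)[of 0] g(2) R by simp
  have h: "h holomorphic_on ball 0 R" "h 0 = 0" "\<And>w. w \<in> ball 0 R \<Longrightarrow> g w = exp (h w)"
    unfolding h_def using f ef0 by (auto intro!: holomorphic_intros simp: exp_diff)
  have lnh: "ln (norm (g w)) = Re (h w)" if "w \<in> ball 0 R" for w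
    using h(3)[OF that] by simp
  have Reh: "Re (h w) < B" if "w \<in> ball 0 R" for w
    using B[OF that] h(3)[OF that] by simp
  have bc: "norm (h w) \<le> 2 * B * norm w / (R - norm w)" if "norm w < R" for w
    by (rule borel_caratheodory[OF h(1,2) Reh that])
  have hb: "norm (h w) \<le> 4 * B / R * norm w" if "norm w < R / 2" for w
  proof -
    have "norm (h w) \<le> 2 * B * norm w / (R - norm w)"
      using that R by (intro bc) auto
    also have "\<dots> \<le> 2 * B * norm w / (R / 2)"
      using that R B0 by (intro divide_left_mono mult_nonneg_nonneg mult_pos_pos) auto
    finally show ?thesis by (simp add: field_simps)
  qed
  show "\<bar>ln (norm (g \<tau>))\<bar> \<le> 4 * B / R * norm \<tau>"
    using hb[of \<tau>] \<tau> R lnh[of \<tau>] abs_Re_le_cmod[of "h \<tau>"] by auto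
  have hb2: "norm (h w) \<le> 2 * B" if "w \<in> ball 0 (R / 2)" for w
  proof -
    have "norm (h w) \<le> 4 * B / R * norm w"
      using that by (intro hb) auto
    also have "\<dots> \<le> 4 * B / R * (R / 2)"
      using that B0 R by (intro mult_left_mono) auto
    finally show ?thesis using R by simp
  qed
  have "norm (h \<tau> - h 0 - \<tau> * deriv h 0) \<le> 16 * (2 * B) / (R / 2)\<^sup>2 * (norm \<tau>)\<^sup>2"
    using \<tau> R by (intro norm_Taylor2_le holomorphic_on_subset[OF h(1)] hb2) auto
  then have T: "norm (h \<tau> - \<tau> * deriv h 0) \<le> 128 * B / R\<^sup>2 * (norm \<tau>)\<^sup>2"
    by (simp add: h(2) power_divide)
  have "deriv g 0 = deriv h 0"
  proof -
    have "((\<lambda>w. exp (h w)) has_field_derivative exp (h 0) * deriv h 0) (at 0)"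
      using h R by (auto intro!: derivative_eq_intros holomorphic_derivI[of _ "ball 0 R"])
    then have "(g has_field_derivative exp (h 0) * deriv h 0) (at 0)"
      by (rule has_field_derivative_transform_within_open[of _ _ _ "ball 0 R"]) (use h R in auto)
    then show ?thesis
      using h(2) by (simp add: DERIV_imp_deriv)
  qed
  then show "\<bar>ln (norm (g \<tau>)) - Re (\<tau> * deriv g 0)\<bar> \<le> 128 * B / R\<^sup>2 * (norm \<tau>)\<^sup>2"
    using T lnh[of \<tau>] \<tau> R abs_Re_le_cmod[of "h \<tau> - \<tau> * deriv h 0"] by auto
qed

text \<open>Borel-Caratheodory for \<open>l s - l 0\<close>, whose real part is at most 2 b. A bound
  on the real part leaves an imaginary constant free; the condition on \<open>Im (l 0)\<close>
  removes it.\<close>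

lemma norm_le_of_abs_Re_le:
  assumes l: "l holomorphic_on ball 0 q" "Im (l 0) = 0" and R: "R < q" "R \<le> 1"
    and b: "\<And>s. s \<in> cball 0 R \<Longrightarrow> \<bar>Re (l s)\<bar> \<le> b"
    and s: "norm s \<le> R - \<delta>" "\<delta> > 0"
  shows "norm (l s) \<le> (4 / \<delta> + 1) * b"
proof -
  have s': "norm s < R" "0 \<le> norm s"
    using s by auto
  then have R0: "R > 0" by linarith
  have l0: "norm (l 0) \<le> b"
    using b[of 0] R0 l(2) by (simp add: cmod_eq_Re)
  have b0: "b \<ge> 0"
    using l0 norm_ge_zero[of "l 0"] by linarith
  have *: "norm (l s - l 0) \<le> 4 / \<delta> * b'" if b': "b < b'" for b'
  proof -
    have "norm (l s - l 0) \<le> 2 * (2 * b') * norm s / (R - norm s)"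
    proof (rule borel_caratheodory)
      show "(\<lambda>s. l s - l 0) holomorphic_on ball 0 R"
        using R by (intro holomorphic_intros holomorphic_on_subset[OF l(1)]) auto
      show "Re (l z - l 0) < 2 * b'" if "z \<in> ball 0 R" for z
        using b[of z] b[of 0] that R0 b' by (auto simp: abs_le_iff)
    qed (use s' in auto)
    also have "\<dots> \<le> 2 * (2 * b') * 1 / \<delta>"
      using s s' R b0 b' by (intro frac_le mult_left_mono) auto
    finally show ?thesis by simp
  qed
  have "norm (l s - l 0) * (\<delta> / 4) \<le> b"
  proof (rule dense_ge)
    fix b' assume "b < b'"
    from *[OF this] show "norm (l s - l 0) * (\<delta> / 4) \<le> b'"
      using s(2) by (simp add: field_simps)
  qed
  then have "norm (l s - l 0) \<le> 4 / \<delta> * b"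
    using s(2) by (simp add: field_simps)
  moreover have "norm (l s) \<le> norm (l s - l 0) + norm (l 0)"
    by (metis diff_add_cancel norm_triangle_ineq)
  ultimately show ?thesis
    using l0 by (simp add: algebra_simps)
qed

section \<open>The variation estimate in abstract form\<close>

text \<open>The quotient N s / s, completed by \<open>deriv N 0\<close>, has no zero and so has a
  logarithm on the disc. The positive derivative of the normalized maps is what allows the branch
  with \<open>l 0\<close> real.\<close>

lemma univalent_log_form:
  assumes N: "N holomorphic_on ball 0 q" "N 0 = 0" "\<And>s. s \<in> ball 0 q \<Longrightarrow> s \<noteq> 0 \<Longrightarrow> N s \<noteq> 0"
    and q: "q > 0" and \<rho>: "deriv N 0 = of_real \<rho>" "\<rho> > 0"
  obtains l where "l holomorphic_on ball 0 q" "Im (l 0) = 0"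
    "\<And>s. s \<in> ball 0 q \<Longrightarrow> N s = s * exp (l s)" "deriv N 0 = exp (l 0)"
proof -
  obtain h where h: "h holomorphic_on ball 0 q" "\<And>z. norm z < q \<Longrightarrow> N z = z * h z" "deriv N 0 = h 0"
    using Schwarz3[OF N(1,2)] by metis
  have nz: "h z \<noteq> 0" if "z \<in> ball 0 q" for z
    using that N(3)[of z] h(2)[of z] h(3) \<rho> by (cases "z = 0") auto
  obtain g where g: "g holomorphic_on ball 0 q" "\<And>z. z \<in> ball 0 q \<Longrightarrow> h z = exp (g z)"
    using contractible_imp_holomorphic_log[OF h(1) _ nz] by (auto simp: convex_imp_contractible)
  have eg0: "exp (g 0) = of_real \<rho>"
    using g(2)[of 0] h(3) \<rho> q by simp
  \<comment> \<open>Subtracting \<open>g 0\<close> discards the unknown branch, and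
    \<open>ln \<rho>\<close> restores the value at 0 with zero imaginary part.\<close>
  define l where "l z = g z - g 0 + of_real (ln \<rho>)" for z
  have el: "exp (l z) = h z" if "z \<in> ball 0 q" for z
    using g(2)[OF that] eg0 \<rho>(2) by (simp add: l_def exp_add exp_diff exp_of_real)
  show thesis
  proof
    show "l holomorphic_on ball 0 q"
      unfolding l_def by (intro holomorphic_intros g)
    show "deriv N 0 = exp (l 0)"
      using el[of 0] q h(3) by simp
  qed (use el h(2) in \<open>auto simp: l_def\<close>)
qed

lemma norm_exp_minus_one_le:
  assumes "norm (w::complex) \<le> 1"
  shows "norm (exp w - 1 - w) \<le> 3 * (norm w)\<^sup>2"
proof -
  have "norm (exp w - (\<Sum>k\<le>1. w ^ k / fact k)) \<le> exp \<bar>Re w\<bar> * norm w ^ Suc 1 / fact 1"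
    by (rule Taylor_exp)
  also have "\<dots> \<le> 3 * norm w ^ Suc 1 / fact 1"
  proof -
    have "exp \<bar>Re w\<bar> \<le> exp (1::real)"
      using assms abs_Re_le_cmod[of w] by simp
    also have "\<dots> \<le> 3"
      by (rule exp_le)
    finally show ?thesis
      by (intro divide_right_mono mult_right_mono) auto
  qed
  finally show ?thesis
    by (simp add: power2_eq_square diff_diff_eq)
qed

text \<open>In the application \<open>N t = \<phi>\<^sub>t\<^sup>-\<^sup>1 \<circ> \<phi>\<close>, \<open>M t = \<phi>\<^sub>t\<^sup>-\<^sup>1 \<circ> h\<^sub>t \<circ> \<phi>\<close> and \<open>k \<tau> = \<phi>\<^sup>-\<^sup>1 \<circ> h\<^sub>\<tau> \<circ> \<phi>\<close>, the latter
  for complex time \<open>\<tau>\<close>, so that second-order bounds in \<open>\<tau>\<close> come from Cauchy's estimates. The candidate \<open>Rs\<close>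
  for the derivative of \<open>ln (N t s / s)\<close> enters through the boundary condition \<open>Z_lim\<close>.\<close>

lemma variation_core:
  fixes N M :: "real \<Rightarrow> complex \<Rightarrow> complex" and k :: "complex \<Rightarrow> complex \<Rightarrow> complex"
  assumes radii: "0 < p" "p < r" "r < q1" "q1 \<le> q" "q < 1" and \<tau>0: "\<tau>0 > 0" and c: "c > 0" and a: "norm a = 1"
    and N_holo: "\<And>t. \<bar>t\<bar> < \<tau>0 \<Longrightarrow> N t holomorphic_on ball 0 q"
    and N_0: "\<And>t. \<bar>t\<bar> < \<tau>0 \<Longrightarrow> N t 0 = 0"
    and N_nz: "\<And>t s. \<bar>t\<bar> < \<tau>0 \<Longrightarrow> s \<in> ball 0 q \<Longrightarrow> s \<noteq> 0 \<Longrightarrow> N t s \<noteq> 0"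
    and N_deriv: "\<And>t. \<bar>t\<bar> < \<tau>0 \<Longrightarrow> \<exists>\<rho>::real. \<rho> > 0 \<and> deriv (N t) 0 = of_real \<rho>"
    and N_bounds: "\<And>t \<tau> s. \<bar>t\<bar> < \<tau>0 \<Longrightarrow> norm \<tau> < \<tau>0 \<Longrightarrow> p < norm s \<Longrightarrow> norm s < q1 \<Longrightarrow>
      c \<le> norm (N t (k \<tau> s)) \<and> norm (N t (k \<tau> s)) \<le> 1"
    and k_ball: "\<And>\<tau> s. norm \<tau> < \<tau>0 \<Longrightarrow> p < norm s \<Longrightarrow> norm s < q1 \<Longrightarrow> k \<tau> s \<in> ball 0 q"
    and k_holo: "\<And>s. p < norm s \<Longrightarrow> norm s < q1 \<Longrightarrow> (\<lambda>\<tau>. k \<tau> s) holomorphic_on ball 0 \<tau>0"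
    and k_0: "\<And>s. p < norm s \<Longrightarrow> norm s < q1 \<Longrightarrow> k 0 s = s"
    and k_deriv: "\<And>s. p < norm s \<Longrightarrow> norm s < q1 \<Longrightarrow> deriv (\<lambda>\<tau>. k \<tau> s) 0 = s * Y s"
    and M_holo: "\<And>t. \<bar>t\<bar> < \<tau>0 \<Longrightarrow> M t holomorphic_on {s. p < norm s \<and> norm s < 1}"
    and M_nz: "\<And>t s. \<bar>t\<bar> < \<tau>0 \<Longrightarrow> p < norm s \<Longrightarrow> norm s < 1 \<Longrightarrow> M t s \<noteq> 0"
    and M_lim: "\<And>t e. \<bar>t\<bar> < \<tau>0 \<Longrightarrow> e > 0 \<Longrightarrow> \<exists>\<rho><1. \<forall>s. \<rho> < norm s \<longrightarrow> norm s < 1 \<longrightarrow> \<bar>ln (norm (M t s))\<bar> < e"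
    and M_eq: "\<And>t s. \<bar>t\<bar> < \<tau>0 \<Longrightarrow> p < norm s \<Longrightarrow> norm s < q1 \<Longrightarrow> M t s = N t (k (a * of_real t) s)"
    and Rs: "Rs holomorphic_on ball 0 1" "Im (Rs 0) = 0"
    and Z: "Z holomorphic_on {s. p < norm s \<and> norm s < 1}"
    and Z_eq: "\<And>s. p < norm s \<Longrightarrow> norm s < q1 \<Longrightarrow> Z s = a * Y s + Rs s"
    and Z_lim: "\<And>e. e > 0 \<Longrightarrow> \<exists>\<rho><1. \<forall>s. \<rho> < norm s \<longrightarrow> norm s < 1 \<longrightarrow> \<bar>Re (Z s)\<bar> < e"
  obtains C \<tau>1 where "\<tau>1 > 0" "\<tau>1 \<le> \<tau>0"
    "\<And>t s. \<bar>t\<bar> < \<tau>1 \<Longrightarrow> s \<in> cball 0 r \<Longrightarrow> norm (N t s - s * (1 + of_real t * Rs s)) \<le> C * t\<^sup>2"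
    "\<And>t. \<bar>t\<bar> < \<tau>1 \<Longrightarrow> norm (deriv (N t) 0 - (1 + of_real t * Rs 0)) \<le> C * t\<^sup>2"
proof -
  \<comment> \<open>Every estimate costs some radius: the first alternation uses the circles
    \<open>r3\<close> and \<open>r4\<close>, the bound on \<open>l\<close> holds up to
    \<open>r3\<close>, that on \<open>deriv l\<close> up to \<open>r2\<close>, the second
    alternation uses \<open>r\<close> and \<open>r2\<close>, and the conclusion is left on radius
    \<open>r\<close>.\<close>
  define \<delta> where "\<delta> = (q1 - r) / 5"
  define r2 where "r2 = r + \<delta>"
  define r3 where "r3 = r + 2 * \<delta>"
  define r4 where "r4 = r + 3 * \<delta>"
  have \<delta>: "\<delta> > 0" using radii by (simp add: \<delta>_def)
  have q1: "q1 = r + 5 * \<delta>" by (simp add: \<delta>_def field_simps)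
  have rr: "r < r2" "r2 < r3" "r3 < r4" "r4 < q1" "r2 = r3 - \<delta>" "r3 = r4 - \<delta>" "r = r2 - \<delta>" "0 < r" "r4 < 1"
    using \<delta> radii by (auto simp: r2_def r3_def r4_def q1)
  \<comment> \<open>The quotients below lie between c and 1 / c; the added 1 makes the bounds by
    \<open>exp (- B)\<close> and \<open>exp B\<close> strict. \<open>A\<close> and \<open>A2\<close>
    then come from \<open>ln_norm_expansion\<close>, \<open>K1\<close> and \<open>K3\<close> from
    the two alternations, \<open>K2\<close> and \<open>K4\<close> from Borel-Caratheodory, and
    \<open>A3\<close> adds to \<open>A2\<close> the cross term between the flow and
    \<open>deriv l\<close>.\<close>
  define B where "B = 1 - ln c"
  define A where "A = 4 * B / \<tau>0"
  define A2 where "A2 = 128 * B / \<tau>0\<^sup>2"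
  define K1 where "K1 = 2 * A / (1 - ln r4 / ln r3)"
  define K2 where "K2 = (4 / \<delta> + 1) * K1"
  define A3 where "A3 = A2 + K2 / (\<delta> * \<tau>0)"
  define K3 where "K3 = 2 * A3 / (1 - ln r2 / ln r)"
  define K4 where "K4 = (4 / \<delta> + 1) * K3"
  \<comment> \<open>The first bound admits \<open>ln_norm_expansion\<close>; the second forces
    \<open>norm (l s) \<le> 1\<close>, as the quadratic bound for exp requires.\<close>
  define \<tau>1 where "\<tau>1 = min (\<tau>0 / 4) (1 / (1 + \<bar>K2\<bar>))"
  define C where "C = 3 * K2\<^sup>2 + K4"
  have \<tau>1: "\<tau>1 > 0" "\<tau>1 \<le> \<tau>0"
    using \<tau>0 by (auto simp: \<tau>1_def)
  have expB: "exp (- B) < c" "1 / c < exp B"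
    using c by (auto simp: B_def exp_diff exp_minus field_simps)
  \<comment> \<open>Formulated for \<open>exp (l s)\<close>, that is N t s / s, so that s = 0 covers
    the derivative at the origin as well.\<close>
  have key: "norm (exp (l s) - (1 + of_real t * Rs s)) \<le> C * t\<^sup>2"
    if t: "\<bar>t\<bar> < \<tau>1" and s: "s \<in> cball 0 r"
      and l: "l holomorphic_on ball 0 q" "Im (l 0) = 0" "\<And>s. s \<in> ball 0 q \<Longrightarrow> N t s = s * exp (l s)" for t s l
  proof -
    have t0: "\<bar>t\<bar> < \<tau>0" "\<bar>t\<bar> < \<tau>0 / 4" "K2 * \<bar>t\<bar> \<le> 1"
    proof -
      show "\<bar>t\<bar> < \<tau>0" "\<bar>t\<bar> < \<tau>0 / 4"
        using t \<tau>1 by (auto simp: \<tau>1_def)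
      have "\<bar>t\<bar> \<le> 1 / (1 + \<bar>K2\<bar>)"
        using t by (auto simp: \<tau>1_def)
      then have "\<bar>t\<bar> * (1 + \<bar>K2\<bar>) \<le> 1"
        by (simp add: field_simps)
      moreover have "K2 * \<bar>t\<bar> \<le> \<bar>K2\<bar> * \<bar>t\<bar>"
        by (intro mult_right_mono) auto
      ultimately show "K2 * \<bar>t\<bar> \<le> 1"
        by (simp add: algebra_simps)
    qed
    have nat: "norm (a * of_real t) = \<bar>t\<bar>"
      using a by (simp add: norm_mult)
    have N_s: "c \<le> norm (N t s) \<and> norm (N t s) \<le> 1" if "p < norm s" "norm s < q1" for s
      using N_bounds[OF t0(1), of 0 s] that \<tau>0 k_0[of s] by simp
    have g_holo: "(\<lambda>\<tau>. N t (k \<tau> s) / N t s) holomorphic_on ball 0 \<tau>0"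
      and g_B: "\<And>\<tau>. \<tau> \<in> ball 0 \<tau>0 \<Longrightarrow> exp (- B) < norm (N t (k \<tau> s) / N t s) \<and> norm (N t (k \<tau> s) / N t s) < exp B"
      and g_0: "N t (k 0 s) / N t s = 1" and nzs: "N t s \<noteq> 0"
      if s: "p < norm s" "norm s < q1" for s
    proof -
      show nz: "N t s \<noteq> 0"
        using N_s[OF s] c by auto
      then show "N t (k 0 s) / N t s = 1"
        by (simp add: k_0[OF s])
      have "(\<lambda>\<tau>. N t (k \<tau> s)) holomorphic_on ball 0 \<tau>0"
        by (rule holomorphic_on_compose_gen[OF k_holo[OF s] N_holo[OF t0(1)], unfolded o_def])
           (use k_ball s in auto)
      then show "(\<lambda>\<tau>. N t (k \<tau> s) / N t s) holomorphic_on ball 0 \<tau>0"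
        using nz by (intro holomorphic_intros)
      fix \<tau> :: complex assume "\<tau> \<in> ball 0 \<tau>0"
      then have b: "c \<le> norm (N t (k \<tau> s))" "norm (N t (k \<tau> s)) \<le> 1"
        using N_bounds[OF t0(1) _ s] by auto
      have "c * norm (N t s) \<le> norm (N t (k \<tau> s))"
        using b N_s[OF s] c by (smt (verit) mult_left_le)
      then have 1: "c \<le> norm (N t (k \<tau> s) / N t s)"
        using nz by (simp add: norm_divide field_simps)
      have 2: "norm (N t (k \<tau> s) / N t s) \<le> 1 / c"
        using b N_s[OF s] c by (auto simp: norm_divide intro!: frac_le)
      show "exp (- B) < norm (N t (k \<tau> s) / N t s) \<and> norm (N t (k \<tau> s) / N t s) < exp B"
        using 1 2 expB by linarith
    qed
    have B0: "B > 0"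
    proof -
      have "1 < exp B"
        using g_B[of "of_real ((p + r) / 2)" 0] g_0[of "of_real ((p + r) / 2)"] radii \<tau>0
        by (auto simp: simp del: of_real_add of_real_divide)
      then show ?thesis by simp
    qed
    define d where "d s = ln (norm (M t s / s))" for s
    have opA: "open {s::complex. p < norm s \<and> norm s < 1}"
      by (intro open_Collect_conj open_Collect_less continuous_intros)
    have d_harm: "harmonic_re d {s. p < norm s \<and> norm s < 1}"
      unfolding d_def using M_nz[OF t0(1)] radii
      by (intro harmonic_re_ln_norm opA holomorphic_intros M_holo[OF t0(1)]) auto
    have d_lim: "\<exists>\<rho><1. \<forall>s. \<rho> < norm s \<longrightarrow> norm s < 1 \<longrightarrow> \<bar>d s\<bar> < e" if e: "e > 0" for e
    proof -
      obtain \<rho> where \<rho>: "\<rho> < 1" "\<And>s. \<rho> < norm s \<Longrightarrow> norm s < 1 \<Longrightarrow> \<bar>ln (norm (M t s))\<bar> < e / 2"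
        using M_lim[OF t0(1), of "e / 2"] e by auto
      define \<rho>' where "\<rho>' = max (max \<rho> p) (exp (- (e / 2)))"
      have "\<bar>d s\<bar> < e" if s: "\<rho>' < norm s" "norm s < 1" for s
      proof -
        have s0: "p < norm s" "norm s > 0"
          using s radii by (auto simp: \<rho>'_def simp del: zero_less_norm_iff)
        have "- (e / 2) < ln (norm s)"
          using s s0 by (subst exp_less_cancel_iff[symmetric]) (simp add: \<rho>'_def)
        moreover have "ln (norm s) < 0"
          using s s0 by simp
        moreover have "d s = ln (norm (M t s)) - ln (norm s)"
          using M_nz[OF t0(1) s0(1)] s s0 by (simp add: d_def norm_divide ln_div)
        ultimately show ?thesis
          using \<rho>(2)[of s] s by (auto simp: \<rho>'_def)
      qed
      moreover have "\<rho>' < 1"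
        using \<rho> radii e by (simp add: \<rho>'_def)
      ultimately show ?thesis by blast
    qed
    \<comment> \<open>Both sides of the alternation are logarithms of N t, at the moved and at the
      original point, and the common factor s cancels; the difference depends on the flow alone
      through \<open>k\<close>.\<close>
    have d_l: "d s - Re (l s) = ln (norm (N t (k (a * of_real t) s) / N t s))" if s: "p < norm s" "norm s < q1" for s
    proof -
      have "s \<noteq> 0" "s \<in> ball 0 q" using s radii by auto
      then have "norm (N t s) = norm s * exp (Re (l s))"
        using l(3)[of s] by (simp add: norm_mult)
      then have "ln (norm (N t s)) = ln (norm s) + Re (l s)"
        using \<open>s \<noteq> 0\<close> by (simp add: ln_mult)
      moreover have "N t (k (a * of_real t) s) \<noteq> 0"
        using M_nz[OF t0(1) s(1)] M_eq[OF t0(1) s] s radii by auto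
      ultimately show ?thesis
        using M_eq[OF t0(1) s] \<open>s \<noteq> 0\<close> nzs[OF s] by (simp add: d_def norm_divide ln_div)
    qed
    have est1: "\<bar>d s - Re (l s)\<bar> \<le> A * \<bar>t\<bar>" if s: "p < norm s" "norm s < q1" for s
      unfolding d_l[OF s] A_def
      using ln_norm_expansion(1)[OF g_holo[OF s] g_0[OF s] g_B[OF s], of "a * of_real t"] t0(2) nat
      by simp
    have "\<bar>Re (l s)\<bar> \<le> 2 * (A * \<bar>t\<bar>) / (1 - ln r4 / ln r3)" if "s \<in> cball 0 r4" for s
      by (rule alternating_estimate[OF radii(1) _ _ _ _ l(1) d_harm d_lim est1 that]) (use rr radii in auto)
    then have b1: "\<bar>Re (l s)\<bar> \<le> K1 * \<bar>t\<bar>" if "s \<in> cball 0 r4" for s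
      using that by (simp add: K1_def mult.assoc)
    have b2: "norm (l s) \<le> K2 * \<bar>t\<bar>" if "norm s \<le> r3" for s
    proof -
      have "norm (l s) \<le> (4 / \<delta> + 1) * (K1 * \<bar>t\<bar>)"
        by (rule norm_le_of_abs_Re_le[OF l(1,2) _ _ b1]) (use that rr radii \<delta> in auto)
      then show ?thesis by (simp add: K2_def mult.assoc)
    qed
    have b3: "norm (deriv l s) \<le> K2 * \<bar>t\<bar> / \<delta>" if "norm s \<le> r2" for s
    proof (rule norm_deriv_le)
      have sub: "ball s \<delta> \<subseteq> ball 0 r3"
        using that rr by (simp add: ball_subset_ball_iff)
      then have "ball s \<delta> \<subseteq> ball 0 q"
        using rr radii by auto
      then show "l holomorphic_on ball s \<delta>"
        by (rule holomorphic_on_subset[OF l(1)])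
      show "norm (l w) \<le> K2 * \<bar>t\<bar>" if "w \<in> ball s \<delta>" for w
        using b2[of w] that sub by auto
    qed (rule \<delta>)
    \<comment> \<open>The velocity s Y of the moved point is multiplied by N' / N = 1 / s + l'.
      Since l' is O(t) by \<open>b3\<close>, the second summand contributes only at second
      order.\<close>
    have g_deriv: "deriv (\<lambda>\<tau>. N t (k \<tau> s) / N t s) 0 = Y s * (1 + s * deriv l s)"
      if s: "p < norm s" "norm s < q1" for s
    proof -
      have sq: "s \<in> ball 0 q" "s \<noteq> 0" using s radii by auto
      have "((\<lambda>w. w * exp (l w)) has_field_derivative exp (l s) + s * (exp (l s) * deriv l s)) (at s)"
        using l(1) sq by (auto intro!: derivative_eq_intros holomorphic_derivI[of _ "ball 0 q"])
      then have "(N t has_field_derivative exp (l s) + s * (exp (l s) * deriv l s)) (at (k 0 s))"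
        unfolding k_0[OF s]
        by (rule has_field_derivative_transform_within_open[of _ _ _ "ball 0 q"]) (use l(3) sq in auto)
      moreover have "((\<lambda>\<tau>. k \<tau> s) has_field_derivative s * Y s) (at 0)"
        using holomorphic_derivI[OF k_holo[OF s], of 0] k_deriv[OF s] \<tau>0 by simp
      ultimately have "((\<lambda>\<tau>. N t (k \<tau> s)) has_field_derivative (exp (l s) + s * (exp (l s) * deriv l s)) * (s * Y s)) (at 0)"
        by (rule DERIV_chain2)
      then have "((\<lambda>\<tau>. N t (k \<tau> s) / N t s) has_field_derivative (exp (l s) + s * (exp (l s) * deriv l s)) * (s * Y s) / N t s) (at 0)"
        by (rule DERIV_cdivide)
      then have "deriv (\<lambda>\<tau>. N t (k \<tau> s) / N t s) 0 = (exp (l s) + s * (exp (l s) * deriv l s)) * (s * Y s) / N t s"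
        by (rule DERIV_imp_deriv)
      also have "\<dots> = Y s * (1 + s * deriv l s)"
        using sq by (simp add: l(3) field_simps)
      finally show ?thesis .
    qed
    \<comment> \<open>For all complex times below \<tau>0 the moved point stays in the unit disc, so
      Cauchy's estimate bounds its initial velocity.\<close>
    have sY: "norm (s * Y s) \<le> 1 / \<tau>0" if s: "p < norm s" "norm s < q1" for s
      unfolding k_deriv[OF s, symmetric]
      using k_ball[OF _ s] radii \<tau>0 by (intro norm_deriv_le k_holo[OF s]) (auto intro!: less_imp_le intro: less_trans)
    \<comment> \<open>Second round, with the candidate removed on both sides. Since Z - Rs = a Y is
      exactly the first-order effect of the flow, \<open>d2\<close> and \<open>Re (l2 s)\<close>
      differ only by O(t^2), while the boundary condition on \<open>Z\<close> keeps
      \<open>d2\<close> vanishing at the unit circle.\<close>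
    define d2 where "d2 s = d s + (- t) * Re (Z s)" for s
    define l2 where "l2 s = l s - of_real t * Rs s" for s
    have l2: "l2 holomorphic_on ball 0 q" "Im (l2 0) = 0"
      unfolding l2_def using Rs l radii by (auto intro!: holomorphic_intros intro: holomorphic_on_subset)
    have d2_harm: "harmonic_re d2 {s. p < norm s \<and> norm s < 1}"
      unfolding d2_def by (intro harmonic_re_add d_harm harmonic_re_cmult harmonic_re_Re Z opA)
    have d2_lim: "\<exists>\<rho><1. \<forall>s. \<rho> < norm s \<longrightarrow> norm s < 1 \<longrightarrow> \<bar>d2 s\<bar> < e" if e: "e > 0" for e
    proof -
      obtain \<rho> where \<rho>: "\<rho> < 1" "\<And>s. \<rho> < norm s \<Longrightarrow> norm s < 1 \<Longrightarrow> \<bar>d s\<bar> < e / 2"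
        using d_lim[of "e / 2"] e by auto
      obtain \<rho>' where \<rho>': "\<rho>' < 1" "\<And>s. \<rho>' < norm s \<Longrightarrow> norm s < 1 \<Longrightarrow> \<bar>Re (Z s)\<bar> < e / (2 * (1 + \<bar>t\<bar>))"
        using Z_lim[of "e / (2 * (1 + \<bar>t\<bar>))"] e by (auto simp: add_pos_nonneg)
      have "\<bar>d2 s\<bar> < e" if "max \<rho> \<rho>' < norm s" "norm s < 1" for s
      proof -
        have "\<bar>t\<bar> * \<bar>Re (Z s)\<bar> \<le> (1 + \<bar>t\<bar>) * \<bar>Re (Z s)\<bar>"
          by (intro mult_right_mono) auto
        also have "\<dots> \<le> e / 2"
          using \<rho>'(2)[of s] that by (simp add: field_simps)
        finally have "\<bar>t * Re (Z s)\<bar> \<le> e / 2"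
          by (simp add: abs_mult)
        moreover have "\<bar>d s\<bar> < e / 2"
          using \<rho>(2) that by auto
        ultimately show ?thesis
          by (simp add: d2_def)
      qed
      then show ?thesis
        using \<rho> \<rho>' by (intro exI[of _ "max \<rho> \<rho>'"]) auto
    qed
    have est2: "\<bar>d2 s - Re (l2 s)\<bar> \<le> A3 * t\<^sup>2" if s: "p < norm s" "norm s \<le> r2" for s
    proof -
      have s': "norm s < q1" using s rr by auto
      have "d2 s - Re (l2 s) = (d s - Re (l s)) - Re (a * of_real t * Y s)"
        using Z_eq[OF s(1) s'] by (simp add: d2_def l2_def algebra_simps)
      also have "\<dots> = (ln (norm (N t (k (a * of_real t) s) / N t s)) - Re (a * of_real t * (Y s * (1 + s * deriv l s))))
           + Re (a * of_real t * (s * Y s) * deriv l s)"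
        using d_l[OF s(1) s'] by (simp add: algebra_simps)
      also have "\<bar>\<dots>\<bar> \<le> A2 * t\<^sup>2 + K2 / (\<delta> * \<tau>0) * t\<^sup>2"
      proof (rule order_trans[OF abs_triangle_ineq add_mono])
        show "\<bar>ln (norm (N t (k (a * of_real t) s) / N t s)) - Re (a * of_real t * (Y s * (1 + s * deriv l s)))\<bar> \<le> A2 * t\<^sup>2"
          using ln_norm_expansion(2)[OF g_holo[OF s(1) s'] g_0[OF s(1) s'] g_B[OF s(1) s'], of "a * of_real t"] t0(2) nat g_deriv[OF s(1) s']
          by (simp add: A2_def)
        have "norm (a * of_real t * (s * Y s) * deriv l s) = \<bar>t\<bar> * norm (s * Y s) * norm (deriv l s)"
          using nat by (simp add: norm_mult)
        also have "\<dots> \<le> \<bar>t\<bar> * (1 / \<tau>0) * (K2 * \<bar>t\<bar> / \<delta>)"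
          using sY[OF s(1) s'] b3[OF s(2)] \<tau>0 by (intro mult_mono) auto
        also have "\<dots> = K2 / (\<delta> * \<tau>0) * t\<^sup>2"
          by (simp add: power2_eq_square mult.commute mult.left_commute)
        finally show "\<bar>Re (a * of_real t * (s * Y s) * deriv l s)\<bar> \<le> K2 / (\<delta> * \<tau>0) * t\<^sup>2"
          using abs_Re_le_cmod order_trans by blast
      qed
      finally show ?thesis
        by (simp add: A3_def algebra_simps)
    qed
    have "\<bar>Re (l2 s)\<bar> \<le> 2 * (A3 * t\<^sup>2) / (1 - ln r2 / ln r)" if "s \<in> cball 0 r2" for s
      by (rule alternating_estimate[OF radii(1) _ _ _ _ l2(1) d2_harm d2_lim est2 that]) (use rr radii in auto)
    then have b4: "\<bar>Re (l2 s)\<bar> \<le> K3 * t\<^sup>2" if "s \<in> cball 0 r2" for s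
      using that by (simp add: K3_def mult.assoc)
    have "norm (l2 s) \<le> (4 / \<delta> + 1) * (K3 * t\<^sup>2)"
      by (rule norm_le_of_abs_Re_le[OF l2 _ _ b4]) (use s rr radii \<delta> in auto)
    then have b5: "norm (l s - of_real t * Rs s) \<le> K4 * t\<^sup>2"
      by (simp add: K4_def l2_def mult.assoc)
    have b6: "norm (l s) \<le> K2 * \<bar>t\<bar>"
      using b2[of s] s rr by auto
    have "norm (exp (l s) - 1 - l s) \<le> 3 * (norm (l s))\<^sup>2"
      using b6 t0(3) by (intro norm_exp_minus_one_le) auto
    also have "\<dots> \<le> 3 * (K2 * \<bar>t\<bar>)\<^sup>2"
      using b6 by (intro mult_left_mono power_mono) auto
    finally have b7: "norm (exp (l s) - 1 - l s) \<le> 3 * K2\<^sup>2 * t\<^sup>2"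
      by (simp add: power_mult_distrib)
    have "exp (l s) - (1 + of_real t * Rs s) = (exp (l s) - 1 - l s) + (l s - of_real t * Rs s)"
      by simp
    then show ?thesis
      using norm_triangle_ineq[of "exp (l s) - 1 - l s" "l s - of_real t * Rs s"] b5 b7
      by (simp add: C_def algebra_simps)
  qed
  have log: "\<exists>l. l holomorphic_on ball 0 q \<and> Im (l 0) = 0 \<and> (\<forall>s\<in>ball 0 q. N t s = s * exp (l s)) \<and> deriv (N t) 0 = exp (l 0)"
    if "\<bar>t\<bar> < \<tau>1" for t
  proof -
    have t: "\<bar>t\<bar> < \<tau>0" using that \<tau>1 by auto
    obtain \<rho> :: real where \<rho>: "\<rho> > 0" "deriv (N t) 0 = of_real \<rho>"
      using N_deriv[OF t] by blast
    obtain l where "l holomorphic_on ball 0 q" "Im (l 0) = 0"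
      "\<And>s. s \<in> ball 0 q \<Longrightarrow> N t s = s * exp (l s)" "deriv (N t) 0 = exp (l 0)"
      by (rule univalent_log_form[OF N_holo[OF t] N_0[OF t] N_nz[OF t] _ \<rho>(2,1)]) (use radii in auto)
    then show ?thesis by blast
  qed
  show thesis
  proof (rule that[OF \<tau>1])
    fix t :: real assume t: "\<bar>t\<bar> < \<tau>1"
    obtain l where l: "l holomorphic_on ball 0 q" "Im (l 0) = 0"
      "\<And>s. s \<in> ball 0 q \<Longrightarrow> N t s = s * exp (l s)" "deriv (N t) 0 = exp (l 0)"
      using log[OF t] by blast
    show "norm (deriv (N t) 0 - (1 + of_real t * Rs 0)) \<le> C * t\<^sup>2"
      unfolding l(4) by (rule key[OF t _ l(1-3)]) (use rr in auto)
    fix s :: complex assume s: "s \<in> cball 0 r"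
    have "norm (N t s - s * (1 + of_real t * Rs s)) = norm s * norm (exp (l s) - (1 + of_real t * Rs s))"
      using l(3)[of s] s rr radii by (simp add: norm_mult[symmetric] algebra_simps)
    also have "\<dots> \<le> 1 * (C * t\<^sup>2)"
      using key[OF t s l(1-3)] s rr by (intro mult_mono) auto
    finally show "norm (N t s - s * (1 + of_real t * Rs s)) \<le> C * t\<^sup>2"
      by simp
  qed
qed

section \<open>The normalized Riemann map of a loop\<close>

lemma simple_closed_path_of_homeomorphic_circle:
  assumes "\<gamma> homeomorphic sphere (0::complex) 1"
  obtains p :: "real \<Rightarrow> complex" where "simple_path p" "pathfinish p = pathstart p" "path_image p = \<gamma>"
proof -
  obtain f g where "homeomorphism \<gamma> (sphere (0::complex) 1) g f"
    using assms unfolding homeomorphic_def by blast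
  then have fg: "homeomorphism (sphere (0::complex) 1) \<gamma> f g"
    by (rule homeomorphism_symD)
  show thesis
  proof
    show "simple_path (f \<circ> circlepath 0 1)"
      using fg by (intro simple_path_continuous_image) (auto simp: simple_path_circlepath homeomorphism_def intro: inj_on_inverseI)
    show "pathfinish (f \<circ> circlepath 0 1) = pathstart (f \<circ> circlepath 0 1)"
      by (simp add: pathfinish_compose pathstart_compose)
    show "path_image (f \<circ> circlepath 0 1) = \<gamma>"
      using fg by (simp add: path_image_compose homeomorphism_def)
  qed
qed

text \<open>By the Jordan curve theorem the inside is connected, so the component of 0 is all of it,
  and the topology of the inside carries over.\<close>

lemma U_plus_properties:
  assumes "\<gamma> \<in> Loop1"
  shows "open (U_plus \<gamma>)" "connected (U_plus \<gamma>)" "bounded (U_plus \<gamma>)" "0 \<in> U_plus \<gamma>"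
    "U_plus \<gamma> \<inter> \<gamma> = {}" "closure (U_plus \<gamma>) \<subseteq> U_plus \<gamma> \<union> \<gamma>" "simply_connected (U_plus \<gamma>)"
proof -
  have hom: "\<gamma> homeomorphic sphere (0::complex) 1" and z: "0 \<in> inside \<gamma>" and comp: "compact \<gamma>"
    using assms by (auto simp: Loop1_def)
  obtain p :: "real \<Rightarrow> complex" where p: "simple_path p" "pathfinish p = pathstart p" "path_image p = \<gamma>"
    using simple_closed_path_of_homeomorphic_circle[OF hom] by metis
  note J = Jordan_inside_outside[OF p(1,2), unfolded p(3)]
  have eq: "U_plus \<gamma> = inside \<gamma>"
  proof
    show "U_plus \<gamma> \<subseteq> inside \<gamma>"
      using z inside_same_component by (auto simp: U_plus_def)
    show "inside \<gamma> \<subseteq> U_plus \<gamma>"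
      unfolding U_plus_def using J z inside_no_overlap
      by (intro connected_component_maximal) (auto simp: inside_def)
  qed
  show "open (U_plus \<gamma>)" "connected (U_plus \<gamma>)" "bounded (U_plus \<gamma>)" "0 \<in> U_plus \<gamma>"
    using J z by (auto simp: eq)
  show "U_plus \<gamma> \<inter> \<gamma> = {}"
    by (auto simp: eq inside_def)
  show "closure (U_plus \<gamma>) \<subseteq> U_plus \<gamma> \<union> \<gamma>"
    using J by (auto simp: eq closure_Un_frontier)
  show "simply_connected (U_plus \<gamma>)"
    using simply_connected_inside_simple_path[OF p(1)] by (simp add: eq p(3))
qed

lemma conformal_isoI:
  assumes "f holomorphic_on A" "g holomorphic_on B"
    and "\<And>z. z \<in> A \<Longrightarrow> f z \<in> B \<and> g (f z) = z" "\<And>w. w \<in> B \<Longrightarrow> g w \<in> A \<and> f (g w) = w"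
  shows "conformal_iso f A B"
proof -
  have bij: "bij_betw f A B"
    using assms(3,4) by (intro bij_betw_byWitness[of _ g]) auto
  have "inv_into A f w = g w" if "w \<in> B" for w
    using assms(4)[OF that] bij_betw_inv_into_left[OF bij, of "g w"] by simp
  then have "inv_into A f holomorphic_on B"
    using assms(2) by (metis holomorphic_cong)
  with bij assms(1) show ?thesis
    by (simp add: conformal_iso_def)
qed

lemma conformal_isoD:
  assumes "conformal_iso f A B"
  shows "f holomorphic_on A" "inv_into A f holomorphic_on B" "inj_on f A" "f ` A = B"
    "\<And>z. z \<in> A \<Longrightarrow> inv_into A f (f z) = z" "\<And>w. w \<in> B \<Longrightarrow> f (inv_into A f w) = w"
    "\<And>w. w \<in> B \<Longrightarrow> inv_into A f w \<in> A"
  using assms unfolding conformal_iso_def bij_betw_def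
  by (auto simp: inv_into_f_f f_inv_into_f inv_into_into)

text \<open>Schwarz's lemma for the map and for its left inverse gives
  \<open>norm (h z) = norm z\<close>; the equality case of the lemma yields a rotation.\<close>

lemma disc_automorphism_fixing_0:
  assumes h: "h holomorphic_on ball 0 1" "h 0 = 0" "\<And>z. norm z < 1 \<Longrightarrow> norm (h z) < 1"
    and k: "k holomorphic_on ball 0 1" "k 0 = 0" "\<And>z. norm z < 1 \<Longrightarrow> norm (k z) < 1"
    and hk: "\<And>z. norm z < 1 \<Longrightarrow> k (h z) = z"
  obtains \<alpha> where "norm \<alpha> = 1" "\<And>z. norm z < 1 \<Longrightarrow> h z = \<alpha> * z"
proof -
  have eq: "norm (h z) = norm z" if "norm z < 1" for z
    using Schwarz_Lemma(1)[OF h that] Schwarz_Lemma(1)[OF k h(3)[OF that]] hk[OF that] by simp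
  have "\<exists>z. norm z < 1 \<and> z \<noteq> 0 \<and> norm (h z) = norm z"
    using eq[of "1 / 2"] by (intro exI[of _ "1 / 2"]) auto
  then show thesis
    using Schwarz_Lemma(3)[OF h, of 0] that by auto
qed

text \<open>The two maps differ by a rotation \<alpha> of the disc. Comparing derivatives at 0 gives
  r = s \<alpha> with r, s > 0, hence \<alpha> = 1.\<close>

lemma conformal_iso_disc_unique:
  assumes f: "conformal_iso f (ball 0 1) U" "f 0 = 0" "deriv f 0 = of_real r" "r > 0"
    and g: "conformal_iso g (ball 0 1) U" "g 0 = 0" "deriv g 0 = of_real s" "s > 0"
    and z: "z \<in> ball 0 1"
  shows "f z = g z"
proof -
  define F where "F = inv_into (ball 0 1) f"
  define G where "G = inv_into (ball 0 1) g"
  note f' = conformal_isoD[OF f(1), folded F_def]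
  note g' = conformal_isoD[OF g(1), folded G_def]
  have [simp]: "F 0 = 0" "G 0 = 0"
    using f'(5)[of 0] g'(5)[of 0] f(2) g(2) by auto
  have fU: "f w \<in> U" and gU: "g w \<in> U" if "norm w < 1" for w
    using f'(4) g'(4) that by auto
  obtain \<alpha> where \<alpha>: "norm \<alpha> = 1" "\<And>w. norm w < 1 \<Longrightarrow> G (f w) = \<alpha> * w"
  proof (rule disc_automorphism_fixing_0[of "\<lambda>w. G (f w)" "\<lambda>w. F (g w)"])
    show "(\<lambda>w. G (f w)) holomorphic_on ball 0 1"
      by (rule holomorphic_on_compose_gen[OF f'(1) g'(2), unfolded o_def]) (use f'(4) in auto)
    show "(\<lambda>w. F (g w)) holomorphic_on ball 0 1"
      by (rule holomorphic_on_compose_gen[OF g'(1) f'(2), unfolded o_def]) (use g'(4) in auto)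
    show "norm (G (f w)) < 1" if "norm w < 1" for w
      using g'(7)[OF fU[OF that]] by simp
    show "norm (F (g w)) < 1" if "norm w < 1" for w
      using f'(7)[OF gU[OF that]] by simp
    show "F (g (G (f w))) = w" if "norm w < 1" for w
      using g'(6)[OF fU[OF that]] f'(5)[of w] that by simp
  qed (use f g in auto)
  have fg: "f w = g (\<alpha> * w)" if "norm w < 1" for w
    using \<alpha>(2)[OF that] g'(6)[OF fU[OF that]] by simp
  have "(g has_field_derivative of_real s) (at (\<alpha> * 0))"
    using holomorphic_derivI[OF g'(1), of 0] g(3) by simp
  then have "((\<lambda>w. g (\<alpha> * w)) has_field_derivative of_real s * \<alpha>) (at 0)"
    by (rule DERIV_chain2) (auto intro!: derivative_eq_intros)
  then have "(f has_field_derivative of_real s * \<alpha>) (at 0)"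
    by (rule has_field_derivative_transform_within_open[of _ _ _ "ball 0 1"]) (use fg in auto)
  then have e: "of_real r = of_real s * \<alpha>"
    using f(3) DERIV_imp_deriv by metis
  then have "norm (of_real r :: complex) = norm (of_real s * \<alpha>)"
    by (rule arg_cong)
  then have "r = s"
    using f(4) g(4) \<alpha>(1) by (simp add: norm_mult)
  with e g(4) have "\<alpha> = 1"
    by auto
  then show ?thesis
    using fg[of z] z by simp
qed

lemma normalized_Riemann_map_exists:
  assumes U: "open U" "simply_connected U" "bounded U" "0 \<in> U"
  obtains f r where "conformal_iso f (ball 0 1) U" "f 0 = 0" "r > 0" "deriv f 0 = complex_of_real r"
proof -
  have "U \<noteq> UNIV"
    using U(3) not_bounded_UNIV by auto
  then obtain F g where F: "F holomorphic_on U" "g holomorphic_on ball 0 1"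
      "\<And>z. z \<in> U \<Longrightarrow> F z \<in> ball 0 1 \<and> g (F z) = z" "\<And>z. z \<in> ball 0 1 \<Longrightarrow> g z \<in> U \<and> F (g z) = z"
    using Riemann_mapping_theorem[of U] U by blast
  have "F 0 \<in> ball 0 1"
    using F(3)[OF U(4)] by simp
  then obtain m m' where m: "m (F 0) = 0" "m holomorphic_on ball 0 1" "m ` ball 0 1 \<subseteq> ball 0 1"
      "m' holomorphic_on ball 0 1" "m' ` ball 0 1 \<subseteq> ball 0 1"
      "\<And>z. z \<in> ball 0 1 \<Longrightarrow> m (m' z) = z" "\<And>z. z \<in> ball 0 1 \<Longrightarrow> m' (m z) = z"
    using ball_biholomorphism_exists by blast
  define G where "G z = g (m' z)" for z
  have m'0: "m' 0 = F 0"
    using m(7)[OF \<open>F 0 \<in> ball 0 1\<close>] m(1) by simp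
  have G0: "G 0 = 0"
    using F(3)[OF U(4)] m'0 by (simp add: G_def)
  have Ghol: "G holomorphic_on ball 0 1"
    unfolding G_def by (rule holomorphic_on_compose_gen[OF m(4) F(2) m(5), unfolded o_def])
  have Ginv: "m (F (G z)) = z" if "z \<in> ball 0 1" for z
    using F(4)[of "m' z"] m(5) m(6)[OF that] that by (simp add: G_def image_subset_iff)
  have Ginj: "inj_on G (ball 0 1)"
    using Ginv by (rule inj_on_inverseI)
  have dG: "deriv G 0 \<noteq> 0"
    using holomorphic_injective_imp_regular[OF Ghol _ Ginj] by simp
  \<comment> \<open>The rotation for which G'(0) c equals \<open>norm (deriv G 0)\<close>.\<close>
  define c where "c = cnj (deriv G 0) / of_real (norm (deriv G 0))"
  have c1: "norm c = 1"
    using dG by (simp add: c_def norm_divide)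
  have c0: "c \<noteq> 0" using c1 by auto
  define f where "f z = G (c * z)" for z
  show thesis
  proof (rule that)
    show "conformal_iso f (ball 0 1) U"
    proof (rule conformal_isoI[where g = "\<lambda>w. m (F w) / c"])
      show "f holomorphic_on ball 0 1"
        unfolding f_def using c1
        by (intro holomorphic_on_compose_gen[OF _ Ghol, unfolded o_def] holomorphic_intros) (auto simp: norm_mult)
      have "(\<lambda>w. m (F w)) holomorphic_on U"
        by (rule holomorphic_on_compose_gen[OF F(1) m(2), unfolded o_def]) (use F(3) in auto)
      then show "(\<lambda>w. m (F w) / c) holomorphic_on U"
        using c0 by (intro holomorphic_intros)
      show "f z \<in> U \<and> m (F (f z)) / c = z" if "z \<in> ball 0 1" for z
      proof -
        have "c * z \<in> ball 0 1" using that c1 by (simp add: norm_mult)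
        then show ?thesis
          using Ginv[of "c * z"] F(4)[of "m' (c * z)"] m(5) c0 by (simp add: f_def G_def image_subset_iff)
      qed
      show "m (F w) / c \<in> ball 0 1 \<and> f (m (F w) / c) = w" if "w \<in> U" for w
      proof -
        have "m (F w) \<in> ball 0 1" "m' (m (F w)) = F w"
          using F(3)[OF that] m(3,7) by (simp_all add: image_subset_iff)
        then show ?thesis
          using F(3)[OF that] c1 c0 by (simp add: f_def G_def norm_divide)
      qed
    qed
    show "f 0 = 0" by (simp add: f_def G0)
    show "norm (deriv G 0) > 0" using dG by simp
    have "(G has_field_derivative deriv G 0) (at (c * 0))"
      using holomorphic_derivI[OF Ghol, of 0] by simp
    then have "(f has_field_derivative deriv G 0 * c) (at 0)"
      unfolding f_def by (rule DERIV_chain2) (auto intro!: derivative_eq_intros)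
    then have "deriv f 0 = deriv G 0 * c"
      by (rule DERIV_imp_deriv)
    also have "\<dots> = of_real (norm (deriv G 0))"
      using dG by (simp add: c_def complex_norm_square[symmetric] power2_eq_square field_simps flip: of_real_mult)
    finally show "deriv f 0 = of_real (norm (deriv G 0))" .
  qed
qed

lemma phi_plus_properties:
  assumes "\<gamma> \<in> Loop1"
  shows "conformal_iso (phi_plus \<gamma>) (ball 0 1) (U_plus \<gamma>)" "phi_plus \<gamma> 0 = 0"
    "deriv (phi_plus \<gamma>) 0 = complex_of_real (rho0 \<gamma>)" "rho0 \<gamma> > 0"
proof -
  define P where "P f \<longleftrightarrow> conformal_iso f (ball 0 1) (U_plus \<gamma>) \<and> f 0 = 0 \<and>
      (\<exists>\<rho>::real. \<rho> > 0 \<and> deriv f 0 = complex_of_real \<rho>) \<and> (\<forall>z. z \<notin> ball 0 1 \<longrightarrow> f z = 0)" for f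
  obtain f r where f: "conformal_iso f (ball 0 1) (U_plus \<gamma>)" "f 0 = 0" "r > 0" "deriv f 0 = complex_of_real r"
    using normalized_Riemann_map_exists U_plus_properties[OF assms] by metis
  \<comment> \<open>Cutting off outside the disc meets the last clause of \<open>phi_plus\<close>;
    nothing changes near 0, so the derivative survives.\<close>
  define f' where "f' z = (if z \<in> ball 0 1 then f z else 0)" for z
  have "conformal_iso f' (ball 0 1) (U_plus \<gamma>)"
  proof (rule conformal_isoI[where g = "inv_into (ball 0 1) f"])
    show "f' holomorphic_on ball 0 1"
      using conformal_isoD(1)[OF f(1)] by (subst holomorphic_cong[OF refl, of _ _ f]) (auto simp: f'_def)
  qed (use conformal_isoD[OF f(1)] in \<open>auto simp: f'_def\<close>)
  moreover have "(f has_field_derivative of_real r) (at 0)"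
    using holomorphic_derivI[OF conformal_isoD(1)[OF f(1)], of 0] f(4) by simp
  then have "(f' has_field_derivative of_real r) (at 0)"
    by (rule has_field_derivative_transform_within_open[of _ _ _ "ball 0 1"]) (auto simp: f'_def)
  then have "deriv f' 0 = of_real r"
    by (rule DERIV_imp_deriv)
  ultimately have "P f'"
    using f by (auto simp: P_def f'_def)
  moreover have "g = f'" if "P g" for g
  proof
    fix z show "g z = f' z"
      using that \<open>P f'\<close> conformal_iso_disc_unique[of g "U_plus \<gamma>" _ f' _ z] unfolding P_def
      by (cases "z \<in> ball 0 1") metis+
  qed
  ultimately have "P (phi_plus \<gamma>)"
    unfolding phi_plus_def P_def[symmetric] by (metis theI)
  then show "conformal_iso (phi_plus \<gamma>) (ball 0 1) (U_plus \<gamma>)" "phi_plus \<gamma> 0 = 0"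
    "deriv (phi_plus \<gamma>) 0 = complex_of_real (rho0 \<gamma>)" "rho0 \<gamma> > 0"
    by (auto simp: P_def rho0_def)
qed

section \<open>The flow of a power vector field\<close>

text \<open>The flow of \<open>w\<^bsup>n+1\<^esup>\<close> at complex time \<open>\<tau>\<close>: along it \<open>w\<^bsup>-n\<^esup>\<close> decreases linearly with slope \<open>n\<close>. With the
  principal branch this is correct as long as \<open>|n \<tau> w\<^sup>n| < 1\<close>.\<close>

definition power_flow :: "int \<Rightarrow> complex \<Rightarrow> complex \<Rightarrow> complex" where
  "power_flow n \<tau> w = w * exp (if n = 0 then \<tau> else - Ln (1 - of_int n * \<tau> * w powi n) / of_int n)"

text \<open>Keeps the argument of \<open>Ln\<close> in \<open>power_flow\<close> in the right
  half-plane, away from the branch cut.\<close>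

lemma one_minus_Re_pos:
  fixes x :: complex
  assumes "norm x < 1"
  shows "Re (1 - x) > 0" "1 - x \<noteq> 0" "1 - x \<notin> \<real>\<^sub>\<le>\<^sub>0"
proof -
  show *: "Re (1 - x) > 0"
    using assms complex_Re_le_cmod[of x] by simp
  show "1 - x \<noteq> 0" using * by (metis less_irrefl zero_complex.simps(1))
  show "1 - x \<notin> \<real>\<^sub>\<le>\<^sub>0"
    using * by (auto simp: complex_nonpos_Reals_iff)
qed

lemma power_flow_0 [simp]: "power_flow n 0 w = w"
  by (simp add: power_flow_def)

lemma power_flow_nonzero [simp]: "power_flow n \<tau> w = 0 \<longleftrightarrow> w = 0"
  by (simp add: power_flow_def)

text \<open>The linear law for w^{-n}, which becomes w^{-n} - n \<tau>, in reciprocal form. It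
  identifies the logarithmic time derivative of the flow with the n-th power of the moved
  point.\<close>

lemma power_flow_powi:
  assumes "norm (of_int n * \<tau> * w powi n) < 1"
  shows "power_flow n \<tau> w powi n = w powi n / (1 - of_int n * \<tau> * w powi n)"
proof (cases "n = 0")
  case False
  have "exp (- Ln (1 - of_int n * \<tau> * w powi n) / of_int n) powi n
      = exp (of_int n * (- Ln (1 - of_int n * \<tau> * w powi n) / of_int n))"
    by (simp add: exp_power_int)
  also have "\<dots> = inverse (1 - of_int n * \<tau> * w powi n)"
    using False one_minus_Re_pos(2)[OF assms] by (simp add: exp_minus)
  finally show ?thesis
    using False by (simp add: power_flow_def power_int_mult_distrib field_simps)
qed simp

lemma power_flow_has_field_derivative:
  assumes w: "w \<noteq> 0" and \<tau>: "norm (of_int n * \<tau> * w powi n) < 1"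
  shows "((\<lambda>\<tau>. power_flow n \<tau> w) has_field_derivative power_flow n \<tau> w powi (n + 1)) (at \<tau>)"
proof (cases "n = 0")
  case True
  then show ?thesis
    unfolding power_flow_def by (auto intro!: derivative_eq_intros)
next
  case False
  note x = one_minus_Re_pos[OF \<tau>]
  have "((\<lambda>\<tau>. power_flow n \<tau> w) has_field_derivative
      power_flow n \<tau> w * (w powi n / (1 - of_int n * \<tau> * w powi n))) (at \<tau>)"
    unfolding power_flow_def using False x
    by (auto intro!: derivative_eq_intros simp: field_simps)
  then show ?thesis
    using w power_flow_powi[OF \<tau>] by (simp add: power_int_add mult.commute)
qed

text \<open>The argument of the second logarithm is exactly the inverse of the first one, so
  smallness at the starting point controls the way back too.\<close>

lemma power_flow_inverse:
  assumes \<tau>: "norm (of_int n * \<tau> * w powi n) < 1"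
  shows "power_flow n (- \<tau>) (power_flow n \<tau> w) = w"
proof (cases "n = 0")
  case True
  then show ?thesis by (simp add: power_flow_def exp_minus)
next
  case False
  note x = one_minus_Re_pos[OF \<tau>]
  have e: "1 - of_int n * - \<tau> * power_flow n \<tau> w powi n = inverse (1 - of_int n * \<tau> * w powi n)"
  proof -
    define X where "X = of_int n * \<tau> * w powi n"
    have "of_int n * \<tau> * power_flow n \<tau> w powi n = X / (1 - X)"
      using power_flow_powi[OF \<tau>] by (simp add: X_def)
    moreover have "1 + X / (1 - X) = inverse (1 - X)"
      using x(2) by (simp add: X_def[symmetric] divide_simps)
    ultimately show ?thesis
      by (simp add: X_def)
  qed
  have "power_flow n (- \<tau>) (power_flow n \<tau> w)
     = power_flow n \<tau> w * exp (- Ln (inverse (1 - of_int n * \<tau> * w powi n)) / of_int n)"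
    using False e by (simp only: power_flow_def[of n "- \<tau>"] if_False)
  also have "Ln (inverse (1 - of_int n * \<tau> * w powi n)) = - Ln (1 - of_int n * \<tau> * w powi n)"
    by (rule Ln_inverse[OF x(3)])
  also have "power_flow n \<tau> w * exp (- (- Ln (1 - of_int n * \<tau> * w powi n)) / of_int n) = w"
    using False by (simp add: power_flow_def exp_minus)
  finally show ?thesis .
qed

lemma power_flow_holomorphic_on:
  assumes "0 \<notin> S" "\<And>w. w \<in> S \<Longrightarrow> norm (of_int n * \<tau> * w powi n) < 1"
  shows "power_flow n \<tau> holomorphic_on S"
proof (cases "n = 0")
  case True
  then show ?thesis
    unfolding power_flow_def by (auto intro!: holomorphic_intros)
next
  case False
  have "(\<lambda>w. w * exp (- Ln (1 - of_int n * \<tau> * w powi n) / of_int n)) holomorphic_on S"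
    using assms one_minus_Re_pos(3)[OF assms(2)] False by (intro holomorphic_intros) auto
  then show ?thesis
    using False by (simp add: power_flow_def[abs_def])
qed

text \<open>The flow is jointly continuous in complex time and position on a compact set; uniform
  continuity compares time \<tau> with time 0, where it is the identity.\<close>

lemma power_flow_near_identity:
  assumes "0 < \<epsilon>" "\<delta> > 0"
  obtains \<tau>0 where "\<tau>0 > 0"
    "\<And>\<tau> w::complex. norm \<tau> < \<tau>0 \<Longrightarrow> \<epsilon> \<le> norm w \<Longrightarrow> norm w \<le> R \<Longrightarrow> norm (of_int n * \<tau> * w powi n) < 1"
    "\<And>\<tau> w. norm \<tau> < \<tau>0 \<Longrightarrow> \<epsilon> \<le> norm w \<Longrightarrow> norm w \<le> R \<Longrightarrow> norm (power_flow n \<tau> w - w) < \<delta>"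
proof -
  define K where "K = {w::complex. \<epsilon> \<le> norm w \<and> norm w \<le> R}"
  have K0: "w \<noteq> 0" if "w \<in> K" for w
    using that assms by (auto simp: K_def)
  have "compact K"
    unfolding compact_eq_bounded_closed
  proof
    show "bounded K"
      by (rule bounded_subset[of "cball 0 R"]) (auto simp: K_def)
    show "closed K"
      unfolding K_def by (intro closed_Collect_conj closed_Collect_le continuous_intros)
  qed
  have "continuous_on K (\<lambda>w. w powi n)"
    using K0 by (intro continuous_intros) auto
  then have "bounded ((\<lambda>w. w powi n) ` K)"
    using \<open>compact K\<close> compact_continuous_image compact_imp_bounded by blast
  then obtain L where L: "L > 0" "\<And>w. w \<in> K \<Longrightarrow> norm (w powi n) \<le> L"
    by (auto simp: bounded_pos)
  \<comment> \<open>Chosen so that the product is at most 1/2;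
    \<open>\<bar>of_int n\<bar> + 1\<close> also serves n = 0.\<close>
  define \<tau>' where "\<tau>' = 1 / (2 * (\<bar>of_int n\<bar> + 1) * L)"
  have \<tau>': "\<tau>' > 0" using L by (simp add: \<tau>'_def)
  have small: "norm (of_int n * \<tau> * w powi n) < 1" if "norm \<tau> \<le> \<tau>'" "w \<in> K" for \<tau> w
  proof -
    have "norm (of_int n * \<tau> * w powi n) \<le> \<bar>of_int n\<bar> * \<tau>' * L"
      using that L \<tau>' unfolding norm_mult by (intro mult_mono) auto
    also have "\<dots> \<le> (\<bar>of_int n\<bar> + 1) * \<tau>' * L"
      using L \<tau>' by (intro mult_right_mono) auto
    also have "\<dots> = 1 / 2"
    proof -
      have "\<bar>real_of_int n\<bar> + 1 \<noteq> 0"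
        by linarith
      then show ?thesis
        using L by (simp add: \<tau>'_def)
    qed
    finally show ?thesis by simp
  qed
  have cont: "continuous_on (cball 0 \<tau>' \<times> K) (\<lambda>x. power_flow n (fst x) (snd x))"
  proof (cases "n = 0")
    case True
    then show ?thesis unfolding power_flow_def by (auto intro!: continuous_intros)
  next
    case False
    have "continuous_on (cball 0 \<tau>' \<times> K)
        (\<lambda>x. snd x * exp (- Ln (1 - of_int n * fst x * snd x powi n) / of_int n))"
      using small K0 False one_minus_Re_pos(3) by (intro continuous_intros) auto
    then show ?thesis
      using False by (simp add: power_flow_def)
  qed
  have "uniformly_continuous_on (cball 0 \<tau>' \<times> K) (\<lambda>x. power_flow n (fst x) (snd x))"
    using \<open>compact K\<close> by (intro compact_uniformly_continuous cont compact_Times compact_cball)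
  then obtain d where d: "d > 0"
    "\<And>x y. x \<in> cball 0 \<tau>' \<times> K \<Longrightarrow> y \<in> cball 0 \<tau>' \<times> K \<Longrightarrow> dist y x < d
      \<Longrightarrow> dist (power_flow n (fst y) (snd y)) (power_flow n (fst x) (snd x)) < \<delta>"
    using assms(2) unfolding uniformly_continuous_on_def by metis
  show thesis
  proof
    show "min d \<tau>' > 0" using d \<tau>' by simp
    fix \<tau> w :: complex assume \<tau>: "norm \<tau> < min d \<tau>'" and "\<epsilon> \<le> norm w" "norm w \<le> R"
    then have w: "w \<in> K" by (simp add: K_def)
    show "norm (of_int n * \<tau> * w powi n) < 1"
      using small[of \<tau> w] \<tau> w by simp
    show "norm (power_flow n \<tau> w - w) < \<delta>"
      using d(2)[of "(0, w)" "(\<tau>, w)"] \<tau> w \<tau>' by (simp add: dist_Pair_Pair dist_norm)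
  qed
qed

text \<open>Uniqueness of the integral curve is proved by conserved quantities: c^{-n} + n b s is
  constant, so any two solutions have equal n-th powers, and then their quotient is constant. For n
  = 0 the first half is vacuous and the second does all the work.\<close>

lemma flow_eq_power_flow:
  assumes w: "w \<noteq> 0" and small: "norm (of_int n * (b * of_real t) * w powi n) < 1"
  shows "flow (\<lambda>z. b * z powi (n + 1)) t w = power_flow n (b * of_real t) w"
proof -
  define T where "T = closed_segment 0 t"
  define y where "y s = power_flow n (b * of_real s) w" for s :: real
  have T: "convex T" "0 \<in> T" "t \<in> T"
    by (auto simp: T_def)
  have smallT: "norm (of_int n * (b * of_real s) * w powi n) < 1" if "s \<in> T" for s
  proof -
    have "\<bar>s\<bar> \<le> \<bar>t\<bar>"
      using that by (auto simp: T_def closed_segment_eq_real_ivl split: if_splits)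
    then have "norm (of_int n * (b * of_real s) * w powi n) \<le> norm (of_int n * (b * of_real t) * w powi n)"
      by (simp add: norm_mult mult_left_mono mult_right_mono)
    with small show ?thesis by simp
  qed
  have y_deriv: "(y has_vector_derivative b * y s powi (n + 1)) (at s within T)" if "s \<in> T" for s
  proof -
    have f1: "((\<lambda>s. power_flow n s w) has_field_derivative y s powi (n + 1)) (at (b * of_real s))"
      unfolding y_def by (rule power_flow_has_field_derivative[OF w smallT[OF that]])
    have f2: "((\<lambda>s. b * of_real s) has_vector_derivative b) (at s within T)"
      by (auto intro!: derivative_eq_intros)
    from field_vector_diff_chain_within[OF f2 has_field_derivative_at_within[OF f1]]
    show ?thesis by (simp add: y_def[abs_def] o_def)
  qed
  have y_curve: "integral_curve (\<lambda>z. b * z powi (n + 1)) T y"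
    using y_deriv w by (auto simp: integral_curve_def y_def)
  have unique: "c t = y t" if c: "integral_curve (\<lambda>z. b * z powi (n + 1)) T c" "c 0 = w" for c
  proof -
    have c0: "c s \<noteq> 0" and cd: "(c has_vector_derivative b * c s powi (n + 1)) (at s within T)" if "s \<in> T" for s
      using c that by (auto simp: integral_curve_def)
    \<comment> \<open>Stated for an arbitrary curve because it is applied to both \<open>c\<close>
      and \<open>y\<close>.\<close>
    have const: "c s powi (- n) + of_int n * b * of_real s = w powi (- n)" if s: "s \<in> T"
      and c0: "\<And>s. s \<in> T \<Longrightarrow> c s \<noteq> 0"
      and cd: "\<And>s. s \<in> T \<Longrightarrow> (c has_vector_derivative b * c s powi (n + 1)) (at s within T)" and cw: "c 0 = w" for c s
    proof -
      have "((\<lambda>s. c s powi (- n) + of_int n * b * of_real s) has_vector_derivative 0) (at s within T)" if s: "s \<in> T" for s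
      proof -
        have "((\<lambda>z. z powi (- n)) has_field_derivative of_int (- n) * c s powi (- n - 1) * 1) (at (c s))"
          using c0[OF s] by (intro DERIV_power_int DERIV_ident) auto
        from field_vector_diff_chain_within[OF cd[OF s] has_field_derivative_at_within[OF this]]
        have d: "((\<lambda>s. c s powi (- n)) has_vector_derivative b * c s powi (n + 1) * (of_int (- n) * c s powi (- n - 1) * 1)) (at s within T)"
          by (simp add: o_def)
        have "c s powi (n + 1) * c s powi (- n - 1) = 1"
          using c0[OF s] power_int_add[of "c s" "n + 1" "- n - 1"] by simp
        moreover have "b * c s powi (n + 1) * (of_int (- n) * c s powi (- n - 1) * 1)
            = - (of_int n * b) * (c s powi (n + 1) * c s powi (- n - 1))"
          by simp
        ultimately have "b * c s powi (n + 1) * (of_int (- n) * c s powi (- n - 1) * 1) = - (of_int n * b)"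
          by (simp only: mult_1_right)
        with d have "((\<lambda>s. c s powi (- n)) has_vector_derivative - (of_int n * b)) (at s within T)"
          by (simp only:)
        then show ?thesis
          by (auto intro!: derivative_eq_intros)
      qed
      from has_vector_derivative_zero_constant[OF T(1) this]
      obtain e where "\<And>s. s \<in> T \<Longrightarrow> c s powi (- n) + of_int n * b * of_real s = e" by metis
      from this[OF s] this[OF T(2)] cw show ?thesis by simp
    qed
    have cy: "c s powi n = y s powi n" if s: "s \<in> T" for s
    proof -
      have "c s powi (- n) + of_int n * b * of_real s = w powi (- n)"
        by (rule const[OF s c0 cd c(2)])
      moreover have "y s powi (- n) + of_int n * b * of_real s = w powi (- n)"
        by (rule const[OF s _ y_deriv]) (use w in \<open>auto simp: y_def\<close>)
      ultimately have "c s powi (- n) = y s powi (- n)"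
        by (metis add_right_cancel)
      then show ?thesis by (simp add: power_int_minus)
    qed
    \<comment> \<open>Equal n-th powers leave a root of unity open. The quotient has logarithmic
      derivative b (c^n - y^n) = 0, so it keeps its initial value 1.\<close>
    have "((\<lambda>s. c s * inverse (y s)) has_vector_derivative 0) (at s within T)" if s: "s \<in> T" for s
    proof -
      have y0: "y s \<noteq> 0" using w by (simp add: y_def)
      have "(inverse has_field_derivative - (inverse (y s) ^ Suc (Suc 0))) (at (y s))"
        using DERIV_inverse[OF y0] by simp
      from field_vector_diff_chain_within[OF y_deriv[OF s] has_field_derivative_at_within[OF this]]
      have "((\<lambda>s. inverse (y s)) has_vector_derivative b * y s powi (n + 1) * - (inverse (y s) ^ Suc (Suc 0))) (at s within T)"
        by (simp add: o_def)
      from has_vector_derivative_mult[OF cd[OF s] this]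
      have d: "((\<lambda>s. c s * inverse (y s)) has_vector_derivative
         c s * (b * y s powi (n + 1) * - (inverse (y s) ^ Suc (Suc 0))) + b * c s powi (n + 1) * inverse (y s)) (at s within T)" .
      have "c s * (b * y s powi (n + 1) * - (inverse (y s) ^ Suc (Suc 0))) + b * c s powi (n + 1) * inverse (y s) = 0"
        using y0 c0[OF s] cy[OF s] by (simp add: power_int_add field_simps)
      with d show ?thesis by (simp only:)
    qed
    from has_vector_derivative_zero_constant[OF T(1) this]
    obtain e where e: "\<And>s. s \<in> T \<Longrightarrow> c s * inverse (y s) = e" by metis
    from e[OF T(2)] w c(2) have "e = 1" by (simp add: y_def)
    with e[OF T(3)] w show ?thesis by (simp add: y_def field_simps)
  qed
  show ?thesis
    unfolding flow_def T_def[symmetric]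
  proof (rule the_equality)
    show "\<exists>c. integral_curve (\<lambda>z. b * z powi (n + 1)) T c \<and> c 0 = w \<and> c t = power_flow n (b * of_real t) w"
      using y_curve by (intro exI[of _ y]) (auto simp: y_def)
  qed (use unique in \<open>auto simp: y_def\<close>)
qed

section \<open>Deformation of loops\<close>

lemma compact_subset_open_imp_uniform_ball:
  fixes K :: "'a::{metric_space,heine_borel} set"
  assumes "compact K" "open S" "K \<subseteq> S"
  obtains d where "d > 0" "\<And>x y. x \<in> K \<Longrightarrow> dist x y < d \<Longrightarrow> y \<in> S"
  using compact_subset_open_imp_ball_epsilon_subset[OF assms] by (metis UN_I mem_ball subsetD)

lemma compact_subset_ball_imp_subset_cball:
  fixes K :: "'a::real_normed_vector set"
  assumes "compact K" "K \<subseteq> ball 0 1"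
  obtains \<rho> where "\<rho> < 1" "\<And>x. x \<in> K \<Longrightarrow> norm x \<le> \<rho>"
proof (cases "K = {}")
  case False
  obtain x where "x \<in> K" "\<And>y. y \<in> K \<Longrightarrow> norm y \<le> norm x"
    using continuous_attains_sup[OF assms(1) False continuous_on_norm_id] by blast
  with assms(2) that[of "norm x"] show ?thesis by auto
qed (use that[of 0] in auto)

text \<open>A connected set that leaves \<open>V\<close> must meet the frontier of \<open>V\<close>,
  and the closure condition puts that frontier inside \<open>S\<close>.\<close>

lemma connected_component_set_eqI:
  assumes "open V" "connected V" "x \<in> V" "V \<inter> S = {}" "closure V \<subseteq> V \<union> S"
  shows "connected_component_set (- S) x = V"
proof
  show "V \<subseteq> connected_component_set (- S) x"
    using assms by (intro connected_component_maximal) auto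
  show "connected_component_set (- S) x \<subseteq> V"
  proof (rule ccontr)
    assume "\<not> connected_component_set (- S) x \<subseteq> V"
    then have "connected_component_set (- S) x \<inter> frontier V \<noteq> {}"
      using assms \<open>V \<subseteq> connected_component_set (- S) x\<close>
      by (intro connected_Int_frontier connected_connected_component) auto
    then obtain y where y: "y \<in> connected_component_set (- S) x" "y \<in> frontier V" by blast
    then have "y \<notin> S"
      using connected_component_in by fastforce
    then show False
      using y(2) assms(1,5) by (auto simp: frontier_def interior_open)
  qed
qed

text \<open>No Jordan curve argument is needed to locate the interior of the deformed curve: it is the union of
  \<open>\<phi> ` ball 0 q\<close> and the image under the flow of the outer annulus \<open>\<phi> ` {s. p < |s| < 1}\<close>.\<close>

lemma loop_deformation:
  fixes n :: int
  defines "Z \<equiv> \<lambda>\<gamma> p. (U_plus \<gamma> \<union> \<gamma>) - phi_plus \<gamma> ` ball 0 p"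
  assumes \<gamma>: "\<gamma> \<in> Loop1" and r: "0 < p" "p < q1" "q1 < q" "q < 1"
  obtains \<tau>0 \<epsilon> R where "\<tau>0 > 0" "\<epsilon> > 0" "R > 0"
    "\<And>\<tau> w. norm \<tau> < \<tau>0 \<Longrightarrow> w \<in> Z \<gamma> p \<Longrightarrow> w \<noteq> 0 \<and> norm (of_int n * \<tau> * w powi n) < 1"
    "\<And>\<tau>. norm \<tau> < \<tau>0 \<Longrightarrow> power_flow n \<tau> ` \<gamma> \<in> Loop1"
    "\<And>\<tau>. norm \<tau> < \<tau>0 \<Longrightarrow> phi_plus \<gamma> ` ball 0 q \<subseteq> U_plus (power_flow n \<tau> ` \<gamma>)"
    "\<And>\<tau> s. norm \<tau> < \<tau>0 \<Longrightarrow> p < norm s \<Longrightarrow> norm s < 1 \<Longrightarrow>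
       power_flow n \<tau> (phi_plus \<gamma> s) \<in> U_plus (power_flow n \<tau> ` \<gamma>)"
    "\<And>\<tau> s. norm \<tau> < \<tau>0 \<Longrightarrow> p < norm s \<Longrightarrow> norm s < q1 \<Longrightarrow>
       power_flow n \<tau> (phi_plus \<gamma> s) \<in> phi_plus \<gamma> ` ball 0 q \<and> \<epsilon> \<le> norm (power_flow n \<tau> (phi_plus \<gamma> s))"
    "\<And>\<tau>. norm \<tau> < \<tau>0 \<Longrightarrow> U_plus (power_flow n \<tau> ` \<gamma>) \<subseteq> ball 0 R"
    "\<And>\<tau> K. norm \<tau> < \<tau>0 \<Longrightarrow> compact K \<Longrightarrow> K \<subseteq> U_plus (power_flow n \<tau> ` \<gamma>) \<Longrightarrow>
       \<exists>\<rho><1. \<forall>s. \<rho> < norm s \<longrightarrow> norm s < 1 \<longrightarrow> power_flow n \<tau> (phi_plus \<gamma> s) \<notin> K"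
proof -
  define U where "U = U_plus \<gamma>"
  define \<phi> where "\<phi> = phi_plus \<gamma>"
  define F where "F = inv_into (ball 0 1) \<phi>"
  define A where "A = {s::complex. p < norm s \<and> norm s < 1}"
  \<comment> \<open>The closed ring between the curve of radius \<open>p\<close> and the loop. It
    avoids 0, where the field may be singular, and its compactness yields one time bound for the
    flow on all of it.\<close>
  define ZZ where "ZZ = Z \<gamma> p"
  note U = U_plus_properties[OF \<gamma>, folded U_def]
  note \<phi> = phi_plus_properties[OF \<gamma>, folded U_def \<phi>_def]
  note ci = conformal_isoD[OF \<phi>(1), folded F_def]
  have comp_\<gamma>: "compact \<gamma>"
    using \<gamma> by (simp add: Loop1_def)
  have \<phi>_cont: "continuous_on S \<phi>" if "S \<subseteq> ball 0 1" for S
    using ci(1) that holomorphic_on_imp_continuous_on holomorphic_on_subset by blast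
  have \<phi>_open: "open (\<phi> ` S)" if "open S" "S \<subseteq> ball 0 1" for S
    using open_mapping_thm3[OF holomorphic_on_subset[OF ci(1) that(2)] that(1) inj_on_subset[OF ci(3) that(2)]] .
  have \<phi>U: "\<phi> s \<in> U" if "norm s < 1" for s
    using ci(4) that by auto
  have \<phi>_eq: "\<phi> s = \<phi> t \<longleftrightarrow> s = t" if "norm s < 1" "norm t < 1" for s t
    using ci(3) that by (auto simp: inj_on_def)
  have ZZ_def': "ZZ = (U \<union> \<gamma>) - \<phi> ` ball 0 p"
    by (simp add: ZZ_def Z_def U_def \<phi>_def)
  have opA: "open A"
    unfolding A_def by (intro open_Collect_conj open_Collect_less continuous_intros)
  have AD: "A \<subseteq> ball 0 1" by (auto simp: A_def)
  have \<phi>Z: "\<phi> s \<in> ZZ" if "p \<le> norm s" "norm s < 1" for s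
    using that \<phi>U \<phi>_eq r by (auto simp: ZZ_def')
  have \<phi>\<gamma>: "\<phi> s \<notin> \<gamma>" if "norm s < 1" for s
    using \<phi>U[OF that] U(5) by blast
  have \<gamma>Z: "\<gamma> \<subseteq> ZZ"
    using \<phi>\<gamma> r by (fastforce simp: ZZ_def')
  have ZZ_sub: "x \<in> \<phi> ` {s. p \<le> norm s \<and> norm s < 1} \<union> \<gamma>" if "x \<in> ZZ" for x
  proof (cases "x \<in> \<gamma>")
    case False
    with that have "x \<in> U" by (simp add: ZZ_def')
    then obtain s where s: "x = \<phi> s" "norm s < 1" using ci(4) by auto
    have "\<not> norm s < p"
      using that s(1) by (auto simp: ZZ_def')
    with s show ?thesis by auto
  qed simp
  have "compact ZZ"
    unfolding compact_eq_bounded_closed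
  proof
    show "bounded ZZ"
      by (rule bounded_subset[of "U \<union> \<gamma>"]) (use U(3) comp_\<gamma> in \<open>auto simp: compact_imp_bounded ZZ_def'\<close>)
    have "U \<union> \<gamma> = closure U \<union> \<gamma>"
      using U(6) closure_subset by blast
    then have "closed (U \<union> \<gamma>)"
      using comp_\<gamma> by (simp add: closed_Un compact_imp_closed)
    then show "closed ZZ"
      unfolding ZZ_def' using r by (intro closed_Diff \<phi>_open) auto
  qed
  obtain \<epsilon>0 where \<epsilon>0: "\<epsilon>0 > 0" "ball 0 \<epsilon>0 \<subseteq> \<phi> ` ball 0 p"
  proof -
    have "0 \<in> \<phi> ` ball 0 p" using \<phi>(2) r by (intro image_eqI[of _ _ 0]) auto
    moreover have "open (\<phi> ` ball 0 p)"
      using r by (intro \<phi>_open) auto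
    ultimately show ?thesis
      using that openE by blast
  qed
  have Z_lower: "\<epsilon>0 \<le> norm w" if "w \<in> ZZ" for w
    using that \<epsilon>0(2) by (force simp: ZZ_def')
  obtain R0 where R0: "R0 > 0" "\<And>w. w \<in> U \<union> \<gamma> \<Longrightarrow> norm w \<le> R0"
    using U(3) comp_\<gamma> compact_imp_bounded[of \<gamma>] bounded_pos[of "U \<union> \<gamma>"] by auto
  have opq: "open (\<phi> ` ball 0 q)"
    using r by (intro \<phi>_open) auto
  have "compact (\<phi> ` (cball 0 q1 - ball 0 p))"
    using r by (intro compact_continuous_image \<phi>_cont compact_diff) auto
  moreover have "\<phi> ` (cball 0 q1 - ball 0 p) \<subseteq> \<phi> ` ball 0 q"
    using r by (intro image_mono) auto
  ultimately obtain d1 where d1: "d1 > 0" "\<And>x y. x \<in> \<phi> ` (cball 0 q1 - ball 0 p) \<Longrightarrow> dist x y < d1 \<Longrightarrow> y \<in> \<phi> ` ball 0 q"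
    using compact_subset_open_imp_uniform_ball[OF _ opq] by metis
  have "compact (\<phi> ` sphere 0 q)"
    using r by (intro compact_continuous_image \<phi>_cont) auto
  moreover have "\<phi> ` sphere 0 q \<subseteq> \<phi> ` A"
    using r by (intro image_mono) (auto simp: A_def)
  ultimately obtain d2 where d2: "d2 > 0" "\<And>x y. x \<in> \<phi> ` sphere 0 q \<Longrightarrow> dist x y < d2 \<Longrightarrow> y \<in> \<phi> ` A"
    using compact_subset_open_imp_uniform_ball[OF _ \<phi>_open[OF opA AD]] by metis
  have cK3: "compact (\<phi> ` cball 0 q)"
    using r by (intro compact_continuous_image \<phi>_cont) auto
  moreover have "\<phi> ` cball 0 q \<subseteq> U"
    using \<phi>U r by auto
  ultimately obtain d3 where d3: "d3 > 0" "\<And>x y. x \<in> \<phi> ` cball 0 q \<Longrightarrow> dist x y < d3 \<Longrightarrow> y \<in> U"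
    using compact_subset_open_imp_uniform_ball[OF _ U(1)] by metis
  \<comment> \<open>\<open>d1\<close> keeps the moved ring p \<le> |s| \<le> q1 inside
    \<open>\<phi>\<close> ball 0
    q\<open>;\<close>d2\<open>makes the moved annulus cover the circle of radius\<close>q\<open>;\<close>d3\<open>keeps the moved loop off\<close>\<phi>
    \<open>cball 0 q\<close>; \<epsilon>0 / 2 preserves half of the distance to 0.\<close>
  define \<delta> where "\<delta> = min (min d1 d2) (min d3 (\<epsilon>0 / 2))"
  have \<delta>: "\<delta> > 0" "\<delta> \<le> d1" "\<delta> \<le> d2" "\<delta> \<le> d3" "\<delta> \<le> \<epsilon>0 / 2"
    using d1 d2 d3 \<epsilon>0 by (auto simp: \<delta>_def)
  obtain \<tau>0 where \<tau>0: "\<tau>0 > 0"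
    "\<And>\<tau> w::complex. norm \<tau> < \<tau>0 \<Longrightarrow> \<epsilon>0 \<le> norm w \<Longrightarrow> norm w \<le> R0 \<Longrightarrow> norm (of_int n * \<tau> * w powi n) < 1"
    "\<And>\<tau> w. norm \<tau> < \<tau>0 \<Longrightarrow> \<epsilon>0 \<le> norm w \<Longrightarrow> norm w \<le> R0 \<Longrightarrow> norm (power_flow n \<tau> w - w) < \<delta>"
    using power_flow_near_identity[OF \<epsilon>0(1) \<delta>(1)] by metis
  have ZU: "w \<in> U \<union> \<gamma>" if "w \<in> ZZ" for w
    using that by (auto simp: ZZ_def')
  have small: "norm (of_int n * \<tau> * w powi n) < 1" and near: "norm (power_flow n \<tau> w - w) < \<delta>"
    if "norm \<tau> < \<tau>0" "w \<in> ZZ" for \<tau> w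
    using \<tau>0(2,3)[OF that(1) Z_lower[OF that(2)] R0(2)[OF ZU[OF that(2)]]] by auto
  have Z0: "w \<noteq> 0" if "w \<in> ZZ" for w
    using Z_lower[OF that] \<epsilon>0 by auto
  have inv: "power_flow n (- \<tau>) (power_flow n \<tau> w) = w" if "norm \<tau> < \<tau>0" "w \<in> ZZ" for \<tau> w
    using power_flow_inverse small that by blast
  have inj: "inj_on (power_flow n \<tau>) ZZ" if "norm \<tau> < \<tau>0" for \<tau>
    using inv[OF that] by (rule inj_on_inverseI)
  have holo: "power_flow n \<tau> holomorphic_on ZZ" if "norm \<tau> < \<tau>0" for \<tau>
    using power_flow_holomorphic_on small[OF that] Z0 by blast
  have cont: "continuous_on ZZ (power_flow n \<tau>)" if "norm \<tau> < \<tau>0" for \<tau>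
    using holo[OF that] holomorphic_on_imp_continuous_on by blast
  have inner: "power_flow n \<tau> (\<phi> s) \<in> \<phi> ` ball 0 q" if "norm \<tau> < \<tau>0" "p \<le> norm s" "norm s \<le> q1" for \<tau> s
  proof (rule d1(2))
    show "\<phi> s \<in> \<phi> ` (cball 0 q1 - ball 0 p)" using that by auto
    show "dist (\<phi> s) (power_flow n \<tau> (\<phi> s)) < d1"
      using near[OF that(1) \<phi>Z[OF that(2)]] that r \<delta> by (simp add: dist_norm norm_minus_commute)
  qed
  have U'_eq: "U_plus (power_flow n \<tau> ` \<gamma>) = \<phi> ` ball 0 q \<union> power_flow n \<tau> ` \<phi> ` A"
    if \<tau>: "norm \<tau> < \<tau>0" for \<tau>
    unfolding U_plus_def
  proof (rule connected_component_set_eqI)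
    let ?h = "power_flow n \<tau>"
    have \<phi>AZ: "\<phi> ` A \<subseteq> ZZ"
      using \<phi>Z by (auto simp: A_def)
    have "open (?h ` \<phi> ` A)"
      using open_mapping_thm3[OF holomorphic_on_subset[OF holo[OF \<tau>] \<phi>AZ] \<phi>_open[OF opA AD] inj_on_subset[OF inj[OF \<tau>] \<phi>AZ]] .
    then show "open (\<phi> ` ball 0 q \<union> ?h ` \<phi> ` A)"
      using r by (intro open_Un \<phi>_open) auto
    show "connected (\<phi> ` ball 0 q \<union> ?h ` \<phi> ` A)"
    proof (rule connected_Un)
      show "connected (\<phi> ` ball 0 q)"
        using r by (intro connected_continuous_image \<phi>_cont) auto
      have "connected A"
        using connected_annulus(1)[of p "0::complex" 1] by (simp add: A_def)
      then show "connected (?h ` \<phi> ` A)"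
        by (intro connected_continuous_image continuous_on_subset[OF cont[OF \<tau>] \<phi>AZ] \<phi>_cont AD)
      have "of_real q1 \<in> A" using r by (simp add: A_def)
      moreover have "?h (\<phi> (of_real q1)) \<in> \<phi> ` ball 0 q"
        using r by (intro inner[OF \<tau>]) auto
      ultimately show "\<phi> ` ball 0 q \<inter> ?h ` \<phi> ` A \<noteq> {}" by blast
    qed
    show "0 \<in> \<phi> ` ball 0 q \<union> ?h ` \<phi> ` A"
      using \<phi>(2) r by (intro UnI1 image_eqI[of _ _ 0]) auto
    have "?h g \<notin> \<phi> ` cball 0 q" if g: "g \<in> \<gamma>" for g
    proof
      assume h: "?h g \<in> \<phi> ` cball 0 q"
      have "g \<in> ZZ" using g \<gamma>Z by blast
      then have "dist (?h g) g < d3"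
        using near[OF \<tau>, of g] \<delta> by (simp add: dist_norm)
      then have "g \<in> U" by (rule d3(2)[OF h])
      with g U(5) show False by blast
    qed
    then have "\<phi> ` cball 0 q \<inter> ?h ` \<gamma> = {}"
      by (metis disjoint_iff imageE)
    then have "\<phi> ` ball 0 q \<inter> ?h ` \<gamma> = {}"
      using image_mono[OF ball_subset_cball, of \<phi> 0 q] by blast
    moreover have "?h ` \<phi> ` A \<inter> ?h ` \<gamma> = {}"
    proof -
      have "\<phi> ` A \<inter> \<gamma> = {}" using \<phi>U U(5) by (auto simp: A_def)
      then show ?thesis
        using inj_on_image_Int[OF inj[OF \<tau>] \<phi>AZ \<gamma>Z] by auto
    qed
    ultimately show "(\<phi> ` ball 0 q \<union> ?h ` \<phi> ` A) \<inter> ?h ` \<gamma> = {}"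
      by (simp only: Int_Un_distrib2 Un_empty)
    have c1: "closure (\<phi> ` ball 0 q) \<subseteq> \<phi> ` cball 0 q"
      by (rule closure_minimal) (auto simp: compact_imp_closed cK3)
    \<comment> \<open>A point on the rim of the inner piece belongs to the outer piece: running the
      flow backwards from it ends in the open annulus.\<close>
    have c2: "\<phi> ` cball 0 q \<subseteq> \<phi> ` ball 0 q \<union> ?h ` \<phi> ` A"
    proof
      fix x assume "x \<in> \<phi> ` cball 0 q"
      then obtain s where s: "x = \<phi> s" "norm s \<le> q" by auto
      show "x \<in> \<phi> ` ball 0 q \<union> ?h ` \<phi> ` A"
      proof (cases "norm s = q")
        case True
        have x: "x \<in> ZZ" "norm (- \<tau>) < \<tau>0"
          using s True r \<tau> by (auto intro!: \<phi>Z)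
        have "dist x (power_flow n (- \<tau>) x) < d2"
          using near[OF x(2,1)] \<delta> by (simp add: dist_norm norm_minus_commute)
        then have "power_flow n (- \<tau>) x \<in> \<phi> ` A"
          by (intro d2(2)[of x]) (use s True in auto)
        moreover have "?h (power_flow n (- \<tau>) x) = x"
          using inv[OF x(2,1)] by simp
        ultimately show ?thesis by (metis UnI2 imageI)
      next
        case False
        then show ?thesis using s by auto
      qed
    qed
    have c3: "closure (?h ` \<phi> ` A) \<subseteq> ?h ` ZZ"
      using \<phi>AZ \<open>compact ZZ\<close>
      by (intro closure_minimal image_mono compact_imp_closed compact_continuous_image cont \<tau>)
    have c4: "?h ` ZZ \<subseteq> \<phi> ` ball 0 q \<union> ?h ` \<phi> ` A \<union> ?h ` \<gamma>"
    proof
      fix y assume "y \<in> ?h ` ZZ"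
      then obtain x where x: "y = ?h x" "x \<in> ZZ" by auto
      show "y \<in> \<phi> ` ball 0 q \<union> ?h ` \<phi> ` A \<union> ?h ` \<gamma>"
      proof (cases "x \<in> \<gamma>")
        case False
        then obtain s where s: "x = \<phi> s" "p \<le> norm s" "norm s < 1"
          using ZZ_sub[OF x(2)] by auto
        show ?thesis
        proof (cases "norm s = p")
          case True
          then have "y \<in> \<phi> ` ball 0 q"
            using inner[OF \<tau>, of s] r s x by auto
          then show ?thesis by blast
        next
          case False
          then have "s \<in> A" using s by (simp add: A_def)
          then show ?thesis using x s by blast
        qed
      qed (use x in auto)
    qed
    show "closure (\<phi> ` ball 0 q \<union> ?h ` \<phi> ` A) \<subseteq> \<phi> ` ball 0 q \<union> ?h ` \<phi> ` A \<union> ?h ` \<gamma>"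
      unfolding closure_Un
      by (rule Un_least[OF order_trans[OF order_trans[OF c1 c2] Un_upper1] order_trans[OF c3 c4]])
  qed
  have bound: "U_plus (power_flow n \<tau> ` \<gamma>) \<subseteq> ball 0 (R0 + \<delta> + 1)" if \<tau>: "norm \<tau> < \<tau>0" for \<tau>
  proof
    fix y assume "y \<in> U_plus (power_flow n \<tau> ` \<gamma>)"
    then consider s where "y = \<phi> s" "norm s < q" | s where "y = power_flow n \<tau> (\<phi> s)" "s \<in> A"
      unfolding U'_eq[OF \<tau>] by auto
    then show "y \<in> ball 0 (R0 + \<delta> + 1)"
    proof cases
      case 1
      then show ?thesis using R0(2)[of y] \<phi>U[of s] r \<delta> by auto
    next
      case 2
      then have "\<phi> s \<in> ZZ" "\<phi> s \<in> U" using \<phi>Z \<phi>U by (auto simp: A_def)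
      then have "norm (\<phi> s) \<le> R0" "norm (y - \<phi> s) < \<delta>"
        using near[OF \<tau>] R0 2 by auto
      then show ?thesis
        using norm_triangle_sub[of y "\<phi> s"] by simp
    qed
  qed
  show thesis
  proof (rule that[of \<tau>0 "\<epsilon>0 / 2" "R0 + \<delta> + 1"], unfold ZZ_def[symmetric] \<phi>_def[symmetric])
    fix \<tau> :: complex assume \<tau>: "norm \<tau> < \<tau>0"
    let ?h = "power_flow n \<tau>"
    show "w \<noteq> 0 \<and> norm (of_int n * \<tau> * w powi n) < 1" if "w \<in> ZZ" for w
      using Z0[OF that] small[OF \<tau> that] by blast
    show "\<phi> ` ball 0 q \<subseteq> U_plus (?h ` \<gamma>)"
      unfolding U'_eq[OF \<tau>] by blast
    show "U_plus (?h ` \<gamma>) \<subseteq> ball 0 (R0 + \<delta> + 1)"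
      by (rule bound[OF \<tau>])
    show "?h (\<phi> s) \<in> U_plus (?h ` \<gamma>)" if "p < norm s" "norm s < 1" for s
      unfolding U'_eq[OF \<tau>] using that by (auto simp: A_def)
    show "?h (\<phi> s) \<in> \<phi> ` ball 0 q \<and> \<epsilon>0 / 2 \<le> norm (?h (\<phi> s))" if s: "p < norm s" "norm s < q1" for s
    proof
      show "?h (\<phi> s) \<in> \<phi> ` ball 0 q"
        using inner[OF \<tau>] s by simp
      have "\<phi> s \<in> ZZ" using \<phi>Z s r by simp
      then show "\<epsilon>0 / 2 \<le> norm (?h (\<phi> s))"
        using near[OF \<tau>, of "\<phi> s"] Z_lower[of "\<phi> s"] \<delta> norm_triangle_sub[of "\<phi> s" "?h (\<phi> s)"]
        by (simp add: norm_minus_commute)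
    qed
    show "?h ` \<gamma> \<in> Loop1"
      unfolding Loop1_def
    proof (intro CollectI conjI)
      have c: "continuous_on \<gamma> ?h" by (rule continuous_on_subset[OF cont[OF \<tau>] \<gamma>Z])
      show "compact (?h ` \<gamma>)" using c comp_\<gamma> by (rule compact_continuous_image)
      show "0 \<notin> ?h ` \<gamma>" using Z0 \<gamma>Z by auto
      have "\<gamma> homeomorphic ?h ` \<gamma>"
        using homeomorphic_compact[OF comp_\<gamma> c refl inj_on_subset[OF inj[OF \<tau>] \<gamma>Z]] .
      moreover have "\<gamma> homeomorphic sphere (0::complex) 1"
        using \<gamma> by (simp add: Loop1_def)
      ultimately show "?h ` \<gamma> homeomorphic sphere (0::complex) 1"
        by (metis homeomorphic_sym homeomorphic_trans)
      \<comment> \<open>Boundedness of the component of 0 is what \<open>inside\<close> means, so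
        the deformed curve still surrounds 0.\<close>
      have "bounded (connected_component_set (- ?h ` \<gamma>) 0)"
        using bounded_subset[OF bounded_ball bound[OF \<tau>]] by (simp add: U_plus_def)
      then show "0 \<in> inside (?h ` \<gamma>)"
        using \<open>0 \<notin> ?h ` \<gamma>\<close> by (simp add: inside_def)
    qed
    fix K assume K: "compact K" "K \<subseteq> U_plus (?h ` \<gamma>)"
    \<comment> \<open>Properness at the boundary: the part of the ring that flows into
      \<open>K\<close> is compact and misses the loop, so its parameters stay in a closed disc of
      radius below 1.\<close>
    define Z' where "Z' = ZZ \<inter> ?h -` K"
    have "closed Z'"
      unfolding Z'_def using continuous_closed_preimage[OF cont[OF \<tau>]] \<open>compact ZZ\<close> K(1) compact_imp_closed by blast
    then have "compact (ZZ \<inter> Z')"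
      using \<open>compact ZZ\<close> by (intro compact_Int_closed)
    then have cZ': "compact Z'"
      by (simp add: Z'_def Int_assoc[symmetric])
    have "Z' \<inter> \<gamma> = {}"
    proof (rule ccontr)
      assume "Z' \<inter> \<gamma> \<noteq> {}"
      then obtain x where "x \<in> \<gamma>" "?h x \<in> K" by (auto simp: Z'_def)
      then show False
        using K(2) connected_component_in[of "- ?h ` \<gamma>" 0 "?h x"] by (auto simp: U_plus_def)
    qed
    then have Z'U: "Z' \<subseteq> U"
      by (auto simp: Z'_def ZZ_def')
    have "compact (F ` Z')"
      by (intro compact_continuous_image cZ' continuous_on_subset[OF holomorphic_on_imp_continuous_on[OF ci(2)] Z'U])
    moreover have "F ` Z' \<subseteq> ball 0 1"
      using ci(7) Z'U by auto
    ultimately obtain \<rho> where \<rho>: "\<rho> < 1" "\<And>x. x \<in> F ` Z' \<Longrightarrow> norm x \<le> \<rho>"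
      using compact_subset_ball_imp_subset_cball by metis
    have "?h (\<phi> s) \<notin> K" if s: "max \<rho> p < norm s" "norm s < 1" for s
    proof
      assume "?h (\<phi> s) \<in> K"
      then have "\<phi> s \<in> Z'" using \<phi>Z[of s] s by (simp add: Z'_def)
      then have "norm (F (\<phi> s)) \<le> \<rho>" using \<rho>(2) by blast
      then show False using ci(5)[of s] s by simp
    qed
    then show "\<exists>\<rho><1. \<forall>s. \<rho> < norm s \<longrightarrow> norm s < 1 \<longrightarrow> ?h (\<phi> s) \<notin> K"
      using \<rho>(1) r by (intro exI[of _ "max \<rho> p"]) auto
  qed (use \<tau>0 \<epsilon>0 R0 \<delta> in auto)
qed

section \<open>Laurent expansions\<close>

lemma holomorphic_Taylor_split:
  assumes "g holomorphic_on ball (0::complex) r"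
  shows "\<exists>c h. h holomorphic_on ball 0 r \<and> (\<forall>s\<in>ball 0 r. g s = (\<Sum>i<M. c i * s ^ i) + s ^ M * h s)"
proof (induction M)
  case 0
  then show ?case using assms by (intro exI[of _ "\<lambda>_. 0"] exI[of _ g]) auto
next
  case (Suc M)
  then obtain c h where h: "h holomorphic_on ball 0 r" "\<And>s. s \<in> ball 0 r \<Longrightarrow> g s = (\<Sum>i<M. c i * s ^ i) + s ^ M * h s"
    by blast
  have "(\<lambda>s. h s - h 0) holomorphic_on ball 0 r"
    by (intro holomorphic_intros h)
  then obtain k where k: "k holomorphic_on ball 0 r" "\<And>s. norm s < r \<Longrightarrow> h s - h 0 = s * k s"
    using Schwarz3[of "\<lambda>s. h s - h 0" r] by auto
  have "g s = (\<Sum>i<Suc M. (c(M := h 0)) i * s ^ i) + s ^ Suc M * k s" if "s \<in> ball 0 r" for s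
  proof -
    have "h s = h 0 + s * k s" using k(2)[of s] that by (simp add: algebra_simps)
    then show ?thesis using h(2)[OF that] by (simp add: algebra_simps)
  qed
  with k(1) show ?case by blast
qed

text \<open>The constant term is put into the finite sum, so that \<open>p\<close>, vanishing at 0,
  is exactly the part with positive exponents.\<close>

lemma power_int_times_holomorphic_decomposition:
  fixes k :: int
  assumes g: "g holomorphic_on ball (0::complex) r"
  obtains p b M where "p holomorphic_on ball 0 r" "p 0 = 0"
    "\<And>s. s \<in> ball 0 r \<Longrightarrow> s \<noteq> 0 \<Longrightarrow> s powi k * g s = p s + (\<Sum>j<M::nat. b j * s powi (- int j))"
proof (cases "k \<ge> 1")
  case True
  then have k: "k = int (nat k)" "nat k \<noteq> 0" by auto
  show thesis
  proof (rule that[of "\<lambda>s. s ^ nat k * g s" "\<lambda>_. 0" 0])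
    show "(\<lambda>s. s ^ nat k * g s) holomorphic_on ball 0 r"
      by (intro holomorphic_intros g)
    show "s powi k * g s = s ^ nat k * g s + (\<Sum>j<0::nat. 0 * s powi (- int j))" for s :: complex
      using True by (simp add: power_int_def)
  qed (use k in simp)
next
  case False
  define m where "m = nat (- k)"
  have k: "k = - int m" using False by (simp add: m_def)
  \<comment> \<open>One Taylor coefficient more than the pole order \<open>m\<close>: after division
    by s^m the remainder is s h(s), which vanishes at 0.\<close>
  obtain c h where h: "h holomorphic_on ball 0 r" "\<And>s. s \<in> ball 0 r \<Longrightarrow> g s = (\<Sum>i<Suc m. c i * s ^ i) + s ^ Suc m * h s"
    using holomorphic_Taylor_split[OF g, of "Suc m"] by blast
  show thesis
  proof (rule that[of "\<lambda>s. s * h s" "\<lambda>j. c (m - j)" "Suc m"])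
    show "(\<lambda>s. s * h s) holomorphic_on ball 0 r"
      by (intro holomorphic_intros h)
    fix s :: complex assume s: "s \<in> ball 0 r" "s \<noteq> 0"
    have "s powi k * g s = (\<Sum>i<Suc m. c i * s ^ i * s powi k) + s powi k * s ^ Suc m * h s"
      unfolding h(2)[OF s(1)] by (simp add: sum_distrib_left algebra_simps del: sum.lessThan_Suc)
    also have "s powi k * s ^ Suc m = s"
      using s(2) by (simp add: k power_int_minus)
    also have "(\<Sum>i<Suc m. c i * s ^ i * s powi k) = (\<Sum>j<Suc m. c (Suc m - Suc j) * s ^ (Suc m - Suc j) * s powi k)"
      by (rule sum.nat_diff_reindex[symmetric])
    also have "\<dots> = (\<Sum>j<Suc m. c (m - j) * s powi (- int j))"
    proof (rule sum.cong)
      fix j assume "j \<in> {..<Suc m}"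
      then have "int (m - j) + k = - int j" by (auto simp: k of_nat_diff)
      then have "s ^ (m - j) * s powi k = s powi (- int j)"
        using s(2) by (metis power_int_add power_int_of_nat)
      then show "c (Suc m - Suc j) * s ^ (Suc m - Suc j) * s powi k = c (m - j) * s powi (- int j)"
        by (simp add: mult.assoc)
    qed simp
    finally show "s powi k * g s = s * h s + (\<Sum>j<Suc m. c (m - j) * s powi (- int j))"
      by (simp add: add.commute)
  qed simp
qed

text \<open>The finite sum has no exponent above 0, so the coefficients from index 1 on are those of
  \<open>p\<close>; dividing by s^2 moves the coefficient of s to the residue.\<close>

lemma
  assumes p: "p holomorphic_on ball 0 1" "p 0 = 0"
    and f: "\<And>s. s \<in> ball 0 1 \<Longrightarrow> s \<noteq> 0 \<Longrightarrow> f s = p s + (\<Sum>j<M::nat. b j * s powi (- int j))"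
  shows pos_part_decomposition: "z \<in> ball 0 1 \<Longrightarrow> pos_part f z = p z"
    and residue_decomposition: "residue (\<lambda>s. f s / s\<^sup>2) 0 = deriv p 0"
proof -
  define P where "P = fps_expansion p 0"
  have "p analytic_on {0}"
    using p(1) by (auto simp: analytic_at intro!: exI[of _ "ball 0 1"])
  then have P: "p has_fps_expansion P"
    unfolding P_def by (rule analytic_at_imp_has_fps_expansion_0)
  define L where "L = fps_to_fls P + (\<Sum>j<M. fls_const (b j) * fls_X_intpow (- int j))"
  have e: "(\<lambda>s. p s + (\<Sum>j<M. b j * s powi (- int j))) has_laurent_expansion L"
    unfolding L_def
    by (intro laurent_expansion_intros) (use P in \<open>simp_all add: has_fps_expansion_to_laurent\<close>)
  have "eventually (\<lambda>s. s \<in> ball 0 1 - {0}) (at (0::complex))"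
    by (intro eventually_at_in_open) auto
  \<comment> \<open>Agreement off 0 suffices, since a Laurent expansion ignores the value of
    \<open>f\<close> at 0.\<close>
  then have "eventually (\<lambda>s. p s + (\<Sum>j<M. b j * s powi (- int j)) = f s) (at 0)"
    by eventually_elim (use f in auto)
  from has_laurent_expansion_cong[OF this refl] e have L: "f has_laurent_expansion L"
    by blast
  have nth: "fls_nth L (int (Suc k)) = fps_nth P (Suc k)" for k
  proof -
    have "fls_nth (\<Sum>j<M. fls_const (b j) * fls_X_intpow (- int j)) (int (Suc k)) = 0"
      unfolding fls_nth_sum by (intro sum.neutral) auto
    then show ?thesis by (simp add: L_def del: of_nat_Suc)
  qed
  have P01: "fps_nth P 0 = 0" "fps_nth P 1 = deriv p 0"
    using fps_nth_fps_expansion[OF P, of 0] fps_nth_fps_expansion[OF P, of 1] p(2) by simp_all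
  show "pos_part f z = p z" if z: "z \<in> ball 0 1"
  proof -
    have "(\<lambda>n. fps_nth P n * z ^ n) sums p z"
      using z p(1) by (intro has_fps_expansion_imp_sums_complex[OF P, of 1]) (auto simp: one_ereal_def)
    then have "(\<lambda>n. fps_nth P (Suc n) * z ^ Suc n) sums p z"
      using sums_Suc_iff[of "\<lambda>n. fps_nth P n * z ^ n" "p z"] P01(1) by simp
    then show ?thesis
      unfolding pos_part_def laurent_expansion_0_eqI[OF L] nth by (rule sums_unique[symmetric])
  qed
  have "(\<lambda>s. f s * s powi (- 2)) has_laurent_expansion fls_shift 2 L"
    by (rule has_laurent_expansion_shift'[OF L])
  then have "residue (\<lambda>s. f s * s powi (- 2)) 0 = fls_residue (fls_shift 2 L)"
    by (rule has_laurent_expansion_residue_0)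
  also have "\<dots> = deriv p 0"
    using nth[of 0] P01(2) by simp
  finally show "residue (\<lambda>s. f s / s\<^sup>2) 0 = deriv p 0"
    by (simp add: power_int_minus divide_inverse)
qed

section \<open>Variation of the Riemann map\<close>

text \<open>Compares s with its radial projection \<open>sgn s\<close> on the circle, at distance
  \<open>1 - norm s\<close>, by uniform continuity on the closed annulus.\<close>

lemma small_near_circle:
  fixes g :: "complex \<Rightarrow> real"
  assumes "0 < p" "p < 1" and g: "continuous_on {s. p \<le> norm s \<and> norm s \<le> 1} g" "\<And>s. norm s = 1 \<Longrightarrow> g s = 0"
    and e: "e > 0"
  shows "\<exists>\<rho><1. \<forall>s. \<rho> < norm s \<longrightarrow> norm s < 1 \<longrightarrow> \<bar>g s\<bar> < e"
proof -
  define K where "K = {s::complex. p \<le> norm s \<and> norm s \<le> 1}"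
  have "compact K"
    unfolding compact_eq_bounded_closed
  proof
    show "bounded K"
      by (rule bounded_subset[of "cball 0 1"]) (auto simp: K_def)
    show "closed K"
      unfolding K_def by (intro closed_Collect_conj closed_Collect_le continuous_intros)
  qed
  then have "uniformly_continuous_on K g"
    using g(1) by (intro compact_uniformly_continuous) (auto simp: K_def)
  then obtain d where d: "d > 0" "\<And>x y. x \<in> K \<Longrightarrow> y \<in> K \<Longrightarrow> dist y x < d \<Longrightarrow> dist (g y) (g x) < e"
    using e unfolding uniformly_continuous_on_def by metis
  have "\<bar>g s\<bar> < e" if s: "max p (1 - d) < norm s" "norm s < 1" for s
  proof -
    have s0: "norm s > 0" "s \<noteq> 0" using s assms(1) by auto
    have n1: "norm (sgn s) = 1" using s0 by (simp add: norm_sgn)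
    have "of_real (norm s) * sgn s = s"
      using s0 by (simp add: sgn_eq)
    then have "s - sgn s = of_real (norm s - 1) * sgn s"
      by (simp add: left_diff_distrib)
    then have "norm (s - sgn s) = \<bar>norm s - 1\<bar> * norm (sgn s)"
      by (metis norm_mult norm_of_real)
    then have "dist s (sgn s) = 1 - norm s"
      using n1 s by (simp add: dist_norm)
    then have "dist (g s) (g (sgn s)) < e"
      using s s0 n1 assms by (intro d(2)) (auto simp: K_def)
    then show ?thesis using g(2)[OF n1] by (simp add: dist_real_def)
  qed
  then show ?thesis
    using d(1) assms(2) by (intro exI[of _ "max p (1 - d)"]) auto
qed

lemma has_vector_derivative_at_0I:
  fixes f :: "real \<Rightarrow> 'a::real_normed_vector"
  assumes "r > 0" and "\<And>t. \<bar>t\<bar> < r \<Longrightarrow> norm (f t - f 0 - t *\<^sub>R D) \<le> e t * \<bar>t\<bar>" and "(e \<longlongrightarrow> 0) (at 0)"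
  shows "(f has_vector_derivative D) (at 0)"
  unfolding has_vector_derivative_def has_derivative_iff_norm
proof
  show "bounded_linear (\<lambda>t. t *\<^sub>R D)" by (rule bounded_linear_scaleR_left)
  have "eventually (\<lambda>t. \<bar>t\<bar> < r) (at (0::real))"
    using assms(1) by (auto simp: eventually_at dist_real_def)
  moreover have "eventually (\<lambda>t. t \<noteq> 0) (at (0::real))"
    by (simp add: eventually_at_filter)
  ultimately have "eventually (\<lambda>t. norm (norm (f t - f 0 - (t - 0) *\<^sub>R D) / norm (t - 0)) \<le> e t) (at 0)"
  proof eventually_elim
    case (elim t)
    then show ?case using assms(2)[of t] by (simp add: field_simps)
  qed
  then show "((\<lambda>t. norm (f t - f 0 - (t - 0) *\<^sub>R D) / norm (t - 0)) \<longlongrightarrow> 0) (at 0)"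
    using assms(3) by (rule Lim_null_comparison)
qed

text \<open>A fixed point of s - G s + z solves G s = z, and the displacement bound makes this map
  preserve the closed disc, so Brouwer's theorem applies.\<close>

lemma near_identity_preimage:
  fixes G :: "complex \<Rightarrow> complex"
  assumes G: "continuous_on (cball 0 r) G" "\<And>s. s \<in> cball 0 r \<Longrightarrow> norm (G s - s) \<le> d" and z: "norm z + d \<le> r" "0 \<le> r"
  obtains s where "s \<in> cball 0 r" "G s = z"
proof -
  obtain s where s: "s \<in> cball 0 r" "s - G s + z = s"
  proof (rule brouwer[of "cball (0::complex) r" "\<lambda>s. s - G s + z"])
    show "continuous_on (cball 0 r) (\<lambda>s. s - G s + z)" by (intro continuous_intros G)
    show "(\<lambda>s. s - G s + z) \<in> cball 0 r \<rightarrow> cball 0 r"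
    proof
      fix s :: complex assume "s \<in> cball 0 r"
      then have "norm (s - G s) \<le> d" using G(2) by (simp add: norm_minus_commute)
      then show "s - G s + z \<in> cball 0 r"
        using z(1) norm_triangle_ineq[of "s - G s" z] by simp
    qed
  qed (use z in auto)
  with that show thesis by auto
qed

text \<open>\<open>E\<close> is the velocity of \<phi>^{-1} o \<phi>_t at time 0. With
  \<open>b j\<close> the coefficient c_{-j}, the reflected term has exponent \<open>j + 2\<close>;
  removing the imaginary part from the coefficient of s keeps the derivative at 0 real. The last
  term in the formula for u comes from the changing \<open>rho0\<close>.\<close>

lemma phi_plus_variation:
  fixes n :: int and b :: "nat \<Rightarrow> complex"
  assumes \<gamma>: "\<gamma> \<in> Loop1" and a: "norm a = 1" and z: "z \<in> ball 0 1"
    and p: "p holomorphic_on ball 0 1" "p 0 = 0"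
    and f: "\<And>s. s \<in> ball 0 1 \<Longrightarrow> s \<noteq> 0 \<Longrightarrow>
      phi_plus \<gamma> s powi (n + 1) / deriv (phi_plus \<gamma>) s = p s + (\<Sum>j<M. b j * s powi (- int j))"
  defines "E \<equiv> \<lambda>s. a * p s - \<i> * of_real (Im (a * deriv p 0)) * s + (\<Sum>j<M. cnj (a * b j) * s ^ (j + 2))"
  shows "((\<lambda>t. phi_plus (power_flow n (a * of_real t) ` \<gamma>) z) has_vector_derivative deriv (phi_plus \<gamma>) z * E z) (at 0)"
    (is ?phi)
    and "((\<lambda>t. u_plus (power_flow n (a * of_real t) ` \<gamma>) z) has_vector_derivative
      (deriv (phi_plus \<gamma>) z * E z - phi_plus \<gamma> z * of_real (Re (a * deriv p 0))) / of_real (rho0 \<gamma>)) (at 0)"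
    (is ?u)
proof -
  define \<phi> where "\<phi> = phi_plus \<gamma>"
  define F where "F = inv_into (ball 0 1) \<phi>"
  define U where "U = U_plus \<gamma>"
  define \<rho> where "\<rho> = rho0 \<gamma>"
  note \<phi> = phi_plus_properties[OF \<gamma>, folded \<phi>_def U_def \<rho>_def]
  note ci = conformal_isoD[OF \<phi>(1), folded F_def]
  have opU: "open U"
    using U_plus_properties(1)[OF \<gamma>] by (simp add: U_def)
  have d\<phi>: "deriv \<phi> s \<noteq> 0" if "s \<in> ball 0 1" for s
    using holomorphic_injective_imp_regular[OF ci(1) _ ci(3) that] by simp
  have \<phi>U: "\<phi> s \<in> U" if "norm s < 1" for s
    using ci(4) that by auto
  have \<phi>0: "\<phi> s = 0 \<longleftrightarrow> s = 0" if "norm s < 1" for s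
    using \<phi>(2) inj_onD[OF ci(3), of s 0] that by auto
  obtain p1 where p1: "p1 holomorphic_on ball 0 1" "\<And>s. norm s < 1 \<Longrightarrow> p s = s * p1 s" "deriv p 0 = p1 0"
    using Schwarz3[OF p] by metis
  \<comment> \<open>The coefficients of the principal part are reflected in the unit circle; this makes
    \<open>Re (a * Y s + Rs s)\<close> vanish there.\<close>
  define Rs where "Rs s = - (a * p1 s - \<i> * of_real (Im (a * p1 0)) + (\<Sum>j<M. cnj (a * b j) * s ^ (j + 1)))" for s
  have Rs_holo: "Rs holomorphic_on ball 0 1"
    unfolding Rs_def by (intro holomorphic_intros p1)
  have Rs0: "Rs 0 = - of_real (Re (a * p1 0))"
    by (simp add: Rs_def complex_eq_iff)
  have sRs: "s * Rs s = - E s" if "norm s < 1" for s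
    using p1(2)[OF that] by (simp add: Rs_def E_def p1(3) sum_distrib_left algebra_simps)
  \<comment> \<open>s Y s is the field w^{n+1} pulled back by \<phi>; the extra division by s turns
    it into a logarithmic velocity.\<close>
  define Y where "Y s = \<phi> s powi (n + 1) / deriv \<phi> s / s" for s
  define Z where "Z s = a * Y s + Rs s" for s
  \<comment> \<open>The disc of radius \<open>r\<close> leaves room around z for the motion of the
    preimage; \<open>p0\<close>, \<open>q1\<close> and \<open>q\<close> are any radii in the order
    required below.\<close>
  define r where "r = (1 + norm z) / 2"
  have r: "norm z < r" "0 < r" "r < 1"
    using z by (auto simp: r_def add_pos_nonneg)
  define p0 where "p0 = r / 2"
  define q1 where "q1 = (2 * r + 1) / 3"
  define q where "q = (r + 2) / 3"
  have radii: "0 < p0" "p0 < r" "r < q1" "q1 < q" "q < 1" "p0 < q1" "p0 < 1"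
    using r by (auto simp: p0_def q1_def q_def)
  obtain \<tau>0 \<epsilon> R where def: "\<tau>0 > 0" "\<epsilon> > 0" "R > 0"
    "\<And>\<tau> w. norm \<tau> < \<tau>0 \<Longrightarrow> w \<in> (U \<union> \<gamma>) - \<phi> ` ball 0 p0 \<Longrightarrow> w \<noteq> 0 \<and> norm (of_int n * \<tau> * w powi n) < 1"
    "\<And>\<tau>. norm \<tau> < \<tau>0 \<Longrightarrow> power_flow n \<tau> ` \<gamma> \<in> Loop1"
    "\<And>\<tau>. norm \<tau> < \<tau>0 \<Longrightarrow> \<phi> ` ball 0 q \<subseteq> U_plus (power_flow n \<tau> ` \<gamma>)"
    "\<And>\<tau> s. norm \<tau> < \<tau>0 \<Longrightarrow> p0 < norm s \<Longrightarrow> norm s < 1 \<Longrightarrow>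
       power_flow n \<tau> (\<phi> s) \<in> U_plus (power_flow n \<tau> ` \<gamma>)"
    "\<And>\<tau> s. norm \<tau> < \<tau>0 \<Longrightarrow> p0 < norm s \<Longrightarrow> norm s < q1 \<Longrightarrow>
       power_flow n \<tau> (\<phi> s) \<in> \<phi> ` ball 0 q \<and> \<epsilon> \<le> norm (power_flow n \<tau> (\<phi> s))"
    "\<And>\<tau>. norm \<tau> < \<tau>0 \<Longrightarrow> U_plus (power_flow n \<tau> ` \<gamma>) \<subseteq> ball 0 R"
    "\<And>\<tau> K. norm \<tau> < \<tau>0 \<Longrightarrow> compact K \<Longrightarrow> K \<subseteq> U_plus (power_flow n \<tau> ` \<gamma>) \<Longrightarrow>
       \<exists>\<rho><1. \<forall>s. \<rho> < norm s \<longrightarrow> norm s < 1 \<longrightarrow> power_flow n \<tau> (\<phi> s) \<notin> K"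
    by (fact loop_deformation[where n = n, OF \<gamma> radii(1,6,4,5), folded \<phi>_def U_def])
  define g where "g t = power_flow n (a * of_real t) ` \<gamma>" for t :: real
  define Ft where "Ft t = inv_into (ball 0 1) (phi_plus (g t))" for t
  define N where "N t s = Ft t (\<phi> s)" for t s
  define M' where "M' t s = Ft t (power_flow n (a * of_real t) (\<phi> s))" for t s
  define k where "k \<tau> s = F (power_flow n \<tau> (\<phi> s))" for \<tau> s
  have nat: "norm (a * of_real t) = \<bar>t\<bar>" for t :: real
    using a by (simp add: norm_mult)
  have g_Loop: "g t \<in> Loop1" and g_sub: "\<phi> ` ball 0 q \<subseteq> U_plus (g t)" and g_R: "U_plus (g t) \<subseteq> ball 0 R"
    if "\<bar>t\<bar> < \<tau>0" for t
    using def(5,6,9)[of "a * of_real t"] that nat by (auto simp: g_def)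
  note \<phi>t = phi_plus_properties[OF g_Loop]
  note cit = conformal_isoD[OF \<phi>t(1), folded Ft_def]
  have Ft0: "Ft t 0 = 0" if "\<bar>t\<bar> < \<tau>0" for t
    using cit(5)[OF that, of 0] \<phi>t(2)[OF that] by simp
  have Ft_nz: "Ft t w \<noteq> 0" if "\<bar>t\<bar> < \<tau>0" "w \<in> U_plus (g t)" "w \<noteq> 0" for t w
    using cit(6)[OF that(1,2)] \<phi>t(2)[OF that(1)] that(3) by auto
  have \<phi>q: "\<phi> s \<in> U_plus (g t)" if "\<bar>t\<bar> < \<tau>0" "s \<in> ball 0 q" for t s
    using g_sub[OF that(1)] that(2) by blast
  have N_holo: "N t holomorphic_on ball 0 q" if t: "\<bar>t\<bar> < \<tau>0" for t
    unfolding N_def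
    by (rule holomorphic_on_compose_gen[OF holomorphic_on_subset[OF ci(1)] cit(2)[OF t], unfolded o_def])
       (use radii \<phi>q[OF t] in auto)
  have N_inv: "phi_plus (g t) (N t s) = \<phi> s" "N t s \<in> ball 0 1" if "\<bar>t\<bar> < \<tau>0" "s \<in> ball 0 q" for t s
    using cit(6,7)[OF that(1) \<phi>q[OF that]] by (simp_all add: N_def)
  have N0: "N t 0 = 0" if "\<bar>t\<bar> < \<tau>0" for t
    using Ft0[OF that] \<phi>(2) by (simp add: N_def)
  \<comment> \<open>Obtained by differentiating \<phi>_t (N t s) = \<phi> s at 0. Besides
    positivity, this gives access to the variation of \<open>rho0\<close>.\<close>
  have N_deriv: "deriv (N t) 0 = of_real (\<rho> / rho0 (g t))" if t: "\<bar>t\<bar> < \<tau>0" for t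
  proof -
    have "(phi_plus (g t) has_field_derivative of_real (rho0 (g t))) (at (N t 0))"
      using holomorphic_derivI[OF cit(1)[OF t], of 0] \<phi>t(3)[OF t] N0[OF t] by simp
    moreover have "(N t has_field_derivative deriv (N t) 0) (at 0)"
      using radii by (intro holomorphic_derivI[OF N_holo[OF t]]) auto
    ultimately have "((\<lambda>s. phi_plus (g t) (N t s)) has_field_derivative of_real (rho0 (g t)) * deriv (N t) 0) (at 0)"
      by (rule DERIV_chain2)
    then have "(\<phi> has_field_derivative of_real (rho0 (g t)) * deriv (N t) 0) (at 0)"
      by (rule has_field_derivative_transform_within_open[of _ _ _ "ball 0 q"]) (use N_inv[OF t] radii in auto)
    moreover have "(\<phi> has_field_derivative of_real \<rho>) (at 0)"
      using holomorphic_derivI[OF ci(1), of 0] \<phi>(3) by simp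
    ultimately have "of_real (rho0 (g t)) * deriv (N t) 0 = of_real \<rho>"
      by (rule DERIV_unique)
    then show ?thesis
      using \<phi>t(4)[OF t] by (simp add: field_simps)
  qed
  have \<phi>k: "\<phi> (k \<tau> s) = power_flow n \<tau> (\<phi> s)" "k \<tau> s \<in> ball 0 q" and flowU: "power_flow n \<tau> (\<phi> s) \<in> U"
    if s: "p0 < norm s" "norm s < q1" and \<tau>: "norm \<tau> < \<tau>0" for \<tau> s
  proof -
    obtain w where w: "w \<in> ball 0 q" "power_flow n \<tau> (\<phi> s) = \<phi> w"
      using def(8)[OF \<tau> s] by blast
    then have "k \<tau> s = w" using ci(5)[of w] radii by (simp add: k_def)
    with w show "\<phi> (k \<tau> s) = power_flow n \<tau> (\<phi> s)" "k \<tau> s \<in> ball 0 q" by auto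
    show "power_flow n \<tau> (\<phi> s) \<in> U" using w \<phi>U[of w] radii by auto
  qed
  have in_annulus: "\<phi> s \<in> (U \<union> \<gamma>) - \<phi> ` ball 0 p0" if "p0 < norm s" "norm s < 1" for s
    using \<phi>U[OF that(2)] inj_onD[OF ci(3), of s] that radii by force
  have opA: "open {s::complex. p0 < norm s \<and> norm s < 1}"
    by (intro open_Collect_conj open_Collect_less continuous_intros)
  have N_bounds: "\<epsilon> / R \<le> norm (N t (k \<tau> s)) \<and> norm (N t (k \<tau> s)) \<le> 1"
    if t: "\<bar>t\<bar> < \<tau>0" and \<tau>: "norm \<tau> < \<tau>0" and s: "p0 < norm s" "norm s < q1" for t \<tau> s
  proof
    let ?w = "N t (k \<tau> s)"
    have w: "norm ?w < 1" "phi_plus (g t) ?w = power_flow n \<tau> (\<phi> s)"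
      using N_inv[OF t \<phi>k(2)[OF s \<tau>]] \<phi>k(1)[OF s \<tau>] by auto
    then show "norm ?w \<le> 1" by simp
    \<comment> \<open>Schwarz's lemma for \<phi>_t / R turns the lower bound \<epsilon> for a point
      into the lower bound \<epsilon> / R for its preimage, uniformly in t.\<close>
    have "norm (phi_plus (g t) ?w / of_real R) \<le> norm ?w"
    proof (rule Schwarz_Lemma(1)[of "\<lambda>w. phi_plus (g t) w / of_real R"])
      show "(\<lambda>w. phi_plus (g t) w / of_real R) holomorphic_on ball 0 1"
        using def(3) by (intro holomorphic_intros cit(1)[OF t]) auto
      show "norm (phi_plus (g t) w / of_real R) < 1" if "norm w < 1" for w
      proof -
        have "phi_plus (g t) w \<in> U_plus (g t)" using cit(4)[OF t] that by auto
        then have "norm (phi_plus (g t) w) < R" using g_R[OF t] by auto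
        then show ?thesis using def(3) by (simp add: norm_divide)
      qed
    qed (use w \<phi>t(2)[OF t] in auto)
    then have "norm (power_flow n \<tau> (\<phi> s)) \<le> norm ?w * R"
      using w(2) def(3) by (simp add: norm_divide field_simps)
    moreover have "\<epsilon> \<le> norm (power_flow n \<tau> (\<phi> s))"
      using def(8)[OF \<tau> s] by blast
    ultimately show "\<epsilon> / R \<le> norm ?w"
      using def(3) by (simp add: field_simps)
  qed
  have F_deriv: "(F has_field_derivative inverse (deriv \<phi> s)) (at (\<phi> s))" if s: "s \<in> ball 0 1" for s
  proof -
    have "(F has_field_derivative deriv F (\<phi> s)) (at (\<phi> s))"
      using \<phi>U s by (intro holomorphic_derivI[OF ci(2) opU]) auto
    moreover have "(\<phi> has_field_derivative deriv \<phi> s) (at s)"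
      by (rule holomorphic_derivI[OF ci(1) open_ball s])
    ultimately have "((\<lambda>s. F (\<phi> s)) has_field_derivative deriv F (\<phi> s) * deriv \<phi> s) (at s)"
      by (rule DERIV_chain2)
    then have "((\<lambda>s. s) has_field_derivative deriv F (\<phi> s) * deriv \<phi> s) (at s)"
      by (rule has_field_derivative_transform_within_open[of _ _ _ "ball 0 1"]) (use ci(5) s in auto)
    then have "deriv F (\<phi> s) * deriv \<phi> s = 1"
      using DERIV_ident DERIV_unique by blast
    then have "deriv F (\<phi> s) = inverse (deriv \<phi> s)"
      using d\<phi>[OF s] by (simp add: field_simps)
    then show ?thesis
      using \<open>(F has_field_derivative deriv F (\<phi> s)) (at (\<phi> s))\<close> by simp
  qed
  have flow_deriv: "((\<lambda>\<tau>. power_flow n \<tau> (\<phi> s)) has_field_derivative power_flow n \<tau> (\<phi> s) powi (n + 1)) (at \<tau>)"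
    if "p0 < norm s" "norm s < 1" "norm \<tau> < \<tau>0" for s \<tau>
    using def(4)[OF that(3) in_annulus[OF that(1,2)]] by (intro power_flow_has_field_derivative) auto
  have k_holo: "(\<lambda>\<tau>. k \<tau> s) holomorphic_on ball 0 \<tau>0" if s: "p0 < norm s" "norm s < q1" for s
  proof -
    have "(\<lambda>\<tau>. power_flow n \<tau> (\<phi> s)) holomorphic_on ball 0 \<tau>0"
      unfolding holomorphic_on_open[OF open_ball]
    proof
      fix \<tau> :: complex assume "\<tau> \<in> ball 0 \<tau>0"
      then show "\<exists>f'. ((\<lambda>\<tau>. power_flow n \<tau> (\<phi> s)) has_field_derivative f') (at \<tau>)"
        using s radii by (intro exI[of _ "power_flow n \<tau> (\<phi> s) powi (n + 1)"] flow_deriv) auto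
    qed
    then show ?thesis
      unfolding k_def
      by (rule holomorphic_on_compose_gen[OF _ ci(2), unfolded o_def]) (use flowU[OF s] in auto)
  qed
  have k0: "k 0 s = s" if "norm s < 1" for s
    using ci(5)[of s] that by (simp add: k_def)
  have k_deriv: "deriv (\<lambda>\<tau>. k \<tau> s) 0 = s * Y s" if s: "p0 < norm s" "norm s < q1" for s
  proof -
    have s': "s \<in> ball 0 1" "norm s < 1" "s \<noteq> 0" using s radii by auto
    have "(F has_field_derivative inverse (deriv \<phi> s)) (at (power_flow n 0 (\<phi> s)))"
      using F_deriv[OF s'(1)] by simp
    from DERIV_chain2[OF this flow_deriv[OF s(1) s'(2), of 0]] def(1)
    have "((\<lambda>\<tau>. k \<tau> s) has_field_derivative inverse (deriv \<phi> s) * \<phi> s powi (n + 1)) (at 0)"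
      by (simp add: k_def)
    then show ?thesis
      using s'(3) by (simp add: DERIV_imp_deriv Y_def field_simps)
  qed
  have M_U: "power_flow n (a * of_real t) (\<phi> s) \<in> U_plus (g t)" if "\<bar>t\<bar> < \<tau>0" "p0 < norm s" "norm s < 1" for t s
    using def(7)[of "a * of_real t" s] that nat by (simp add: g_def)
  have M_holo: "M' t holomorphic_on {s. p0 < norm s \<and> norm s < 1}" if t: "\<bar>t\<bar> < \<tau>0" for t
  proof -
    have t': "norm (a * of_real t) < \<tau>0" using nat t by simp
    have "power_flow n (a * of_real t) holomorphic_on \<phi> ` {s. p0 < norm s \<and> norm s < 1}"
      using def(4)[OF t' in_annulus] by (intro power_flow_holomorphic_on) fastforce+
    moreover have "\<phi> holomorphic_on {s. p0 < norm s \<and> norm s < 1}"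
      by (rule holomorphic_on_subset[OF ci(1)]) auto
    ultimately have "(power_flow n (a * of_real t) \<circ> \<phi>) holomorphic_on {s. p0 < norm s \<and> norm s < 1}"
      by (intro holomorphic_on_compose)
    then have "(\<lambda>s. power_flow n (a * of_real t) (\<phi> s)) holomorphic_on {s. p0 < norm s \<and> norm s < 1}"
      by (simp add: o_def)
    then show ?thesis
      unfolding M'_def
      by (rule holomorphic_on_compose_gen[OF _ cit(2)[OF t], unfolded o_def]) (use M_U[OF t] in auto)
  qed
  have M_nz: "M' t s \<noteq> 0" if t: "\<bar>t\<bar> < \<tau>0" and s: "p0 < norm s" "norm s < 1" for t s
    unfolding M'_def
    by (rule Ft_nz[OF t M_U[OF t s]]) (use \<phi>0[OF s(2)] s radii in auto)
  have M_lim: "\<exists>\<rho><1. \<forall>s. \<rho> < norm s \<longrightarrow> norm s < 1 \<longrightarrow> \<bar>ln (norm (M' t s))\<bar> < e"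
    if t: "\<bar>t\<bar> < \<tau>0" and e: "e > 0" for t e
  proof -
    \<comment> \<open>If \<open>norm (M' t s) \<le> exp (- e)\<close>, the moved point lies in this
      compact set, which it has left once s is near the circle.\<close>
    define K where "K = phi_plus (g t) ` cball 0 (exp (- e))"
    have sub: "cball 0 (exp (- e)) \<subseteq> ball (0::complex) 1"
    proof
      fix x :: complex assume "x \<in> cball 0 (exp (- e))"
      then have "norm x \<le> exp (- e)" by simp
      also have "\<dots> < 1" using e by simp
      finally show "x \<in> ball 0 1" by simp
    qed
    have "compact K"
      unfolding K_def using sub holomorphic_on_imp_continuous_on[OF cit(1)[OF t]]
      by (intro compact_continuous_image) (auto elim: continuous_on_subset)
    moreover have "K \<subseteq> U_plus (g t)"
      unfolding K_def using cit(4)[OF t] sub by blast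
    ultimately obtain \<rho>' where \<rho>': "\<rho>' < 1" "\<And>s. \<rho>' < norm s \<Longrightarrow> norm s < 1 \<Longrightarrow> power_flow n (a * of_real t) (\<phi> s) \<notin> K"
      using def(10)[of "a * of_real t" K] t nat by (auto simp: g_def)
    have "\<bar>ln (norm (M' t s))\<bar> < e" if s: "max \<rho>' p0 < norm s" "norm s < 1" for s
    proof -
      have s': "p0 < norm s" "\<rho>' < norm s" using s by auto
      have m: "norm (M' t s) < 1" "phi_plus (g t) (M' t s) = power_flow n (a * of_real t) (\<phi> s)"
        using cit(6,7)[OF t M_U[OF t s'(1) s(2)]] by (auto simp: M'_def)
      have "\<not> norm (M' t s) \<le> exp (- e)"
      proof
        assume "norm (M' t s) \<le> exp (- e)"
        then have "phi_plus (g t) (M' t s) \<in> K" by (auto simp: K_def)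
        with m(2) \<rho>'(2)[OF s'(2) s(2)] show False by simp
      qed
      moreover have "norm (M' t s) > 0" using M_nz[OF t s'(1) s(2)] by simp
      ultimately have "- e < ln (norm (M' t s))" "ln (norm (M' t s)) < 0"
        using m(1) by (subst exp_less_cancel_iff[symmetric], simp_all add: not_le)
      then show ?thesis by simp
    qed
    then show ?thesis
      using \<rho>'(1) radii by (intro exI[of _ "max \<rho>' p0"]) auto
  qed
  have M_eq: "M' t s = N t (k (a * of_real t) s)" if "\<bar>t\<bar> < \<tau>0" "p0 < norm s" "norm s < q1" for t s
    using \<phi>k(1)[OF that(2,3), of "a * of_real t"] that nat by (simp add: M'_def N_def)
  have Z_holo: "Z holomorphic_on {s. p0 < norm s \<and> norm s < 1}"
  proof -
    have sub: "{s. p0 < norm s \<and> norm s < 1} \<subseteq> ball (0::complex) 1" by auto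
    have nz: "s \<noteq> 0" if "p0 < norm s" for s :: complex using that radii by auto
    show ?thesis
      unfolding Z_def Y_def
      using holomorphic_on_subset[OF ci(1) sub] holomorphic_on_subset[OF holomorphic_deriv[OF ci(1)] sub]
        holomorphic_on_subset[OF Rs_holo sub] d\<phi> \<phi>0 nz opA
      by (intro holomorphic_intros) auto
  qed
  have Z_lim: "\<exists>\<rho><1. \<forall>s. \<rho> < norm s \<longrightarrow> norm s < 1 \<longrightarrow> \<bar>Re (Z s)\<bar> < e" if e: "e > 0" for e
  proof -
    \<comment> \<open>\<open>W\<close> is \<open>Z\<close> up to an imaginary constant. The terms
      with \<open>p1\<close>, which have no boundary regularity, cancel in \<open>Z\<close>, and
      only finitely many powers remain. On |s| = 1 the inverse of s is its conjugate, so each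
      summand is a conjugate minus the number itself and has real part 0.\<close>
    define W where "W s = (\<Sum>j<M. a * b j * s powi (- int j - 1) - cnj (a * b j) * s ^ (j + 1))" for s
    have W1: "Re (W s) = 0" if s: "norm s = 1" for s
    proof -
      have "Re (a * b j * s powi (- int j - 1) - cnj (a * b j) * s ^ (j + 1)) = 0" for j
      proof -
        have "s * cnj s = 1" using s by (simp flip: complex_norm_square)
        then have "inverse s = cnj s" by (rule inverse_unique)
        moreover have "s powi (- int j - 1) = inverse s ^ (j + 1)"
          by (simp add: power_int_def nat_add_distrib)
        ultimately have "s powi (- int j - 1) = cnj (s ^ (j + 1))" by simp
        then have "a * b j * s powi (- int j - 1) = cnj (cnj (a * b j) * s ^ (j + 1))" by simp
        then show ?thesis by (metis complex_cnj_cnj complex_cnj cnj.simps(1) diff_self minus_complex.simps(1))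
      qed
      then show ?thesis by (simp add: W_def Re_sum del: minus_complex.simps)
    qed
    have "continuous_on {s. p0 \<le> norm s \<and> norm s \<le> 1} (\<lambda>s. Re (W s))"
      unfolding W_def using radii by (intro continuous_intros) auto
    from small_near_circle[OF radii(1,7) this W1 e]
    obtain \<rho>' where \<rho>': "\<rho>' < 1" "\<And>s. \<rho>' < norm s \<Longrightarrow> norm s < 1 \<Longrightarrow> \<bar>Re (W s)\<bar> < e" by blast
    have "Re (Z s) = Re (W s)" if s: "norm s < 1" "s \<noteq> 0" for s
    proof -
      have "Y s = p1 s + (\<Sum>j<M. b j * s powi (- int j - 1))"
        using f[of s] s p1(2)[of s]
        by (simp add: Y_def \<phi>_def add_divide_distrib sum_divide_distrib power_int_diff)
      then have "Z s = W s + \<i> * of_real (Im (a * p1 0))"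
        by (simp add: Z_def W_def Rs_def sum_subtractf sum_distrib_left algebra_simps)
      then show ?thesis by simp
    qed
    then have "\<bar>Re (Z s)\<bar> < e" if "max \<rho>' 0 < norm s" "norm s < 1" for s
      using \<rho>'(2)[of s] that by auto
    then show ?thesis
      using \<rho>'(1) by (intro exI[of _ "max \<rho>' 0"]) auto
  qed
  have "\<exists>C \<tau>1. \<tau>1 > 0 \<and> \<tau>1 \<le> \<tau>0 \<and>
    (\<forall>t s. \<bar>t\<bar> < \<tau>1 \<longrightarrow> s \<in> cball 0 r \<longrightarrow> norm (N t s - s * (1 + of_real t * Rs s)) \<le> C * t\<^sup>2) \<and>
    (\<forall>t. \<bar>t\<bar> < \<tau>1 \<longrightarrow> norm (deriv (N t) 0 - (1 + of_real t * Rs 0)) \<le> C * t\<^sup>2)"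
  proof (rule variation_core[where N = N and M = M' and k = k and Y = Y and Z = Z and Rs = Rs and a = a
        and p = p0 and r = r and ?q1.0 = q1 and q = q and ?\<tau>0.0 = \<tau>0 and c = "\<epsilon> / R"])
    show "\<exists>\<rho>::real. \<rho> > 0 \<and> deriv (N t) 0 = of_real \<rho>" if "\<bar>t\<bar> < \<tau>0" for t
      using N_deriv[OF that] \<phi>(4) \<phi>t(4)[OF that] by (intro exI[of _ "\<rho> / rho0 (g t)"]) auto
    show "N t s \<noteq> 0" if "\<bar>t\<bar> < \<tau>0" "s \<in> ball 0 q" "s \<noteq> 0" for t s
      unfolding N_def using Ft_nz[OF that(1) \<phi>q[OF that(1,2)]] \<phi>0[of s] that radii by auto
    show "k 0 s = s" if "p0 < norm s" "norm s < q1" for s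
      using that radii by (intro k0) auto
  qed (use radii def(1-3) a N_holo N0 N_bounds \<phi>k(2) k_holo k_deriv M_holo M_nz M_lim M_eq Rs_holo Rs0 Z_holo Z_lim
       in \<open>auto simp: Z_def\<close>)
  then obtain C \<tau>1 where core: "\<tau>1 > 0" "\<tau>1 \<le> \<tau>0"
    "\<And>t s. \<bar>t\<bar> < \<tau>1 \<Longrightarrow> s \<in> cball 0 r \<Longrightarrow> norm (N t s - s * (1 + of_real t * Rs s)) \<le> C * t\<^sup>2"
    "\<And>t. \<bar>t\<bar> < \<tau>1 \<Longrightarrow> norm (deriv (N t) 0 - (1 + of_real t * Rs 0)) \<le> C * t\<^sup>2"
    by blast
  define S where "S s = s * Rs s" for s
  have S_cont: "continuous_on (ball 0 1) S"
    unfolding S_def using holomorphic_on_imp_continuous_on[OF Rs_holo] by (intro continuous_intros)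
  have "compact (S ` cball 0 r)"
    using r by (intro compact_continuous_image continuous_on_subset[OF S_cont]) auto
  then obtain L where L: "L > 0" "\<forall>x\<in>S ` cball 0 r. norm x \<le> L"
    using compact_imp_bounded bounded_pos[of "S ` cball 0 r"] by blast
  then have SL: "norm (S s) \<le> L" if "s \<in> cball 0 r" for s
    using that by blast
  have core': "norm (N t s - s - of_real t * S s) \<le> \<bar>C\<bar> * t\<^sup>2" if "\<bar>t\<bar> < \<tau>1" "s \<in> cball 0 r" for t s
  proof -
    have "norm (N t s - s - of_real t * S s) \<le> C * t\<^sup>2"
      using core(3)[OF that] by (simp add: S_def algebra_simps)
    also have "\<dots> \<le> \<bar>C\<bar> * t\<^sup>2" by (intro mult_right_mono) auto
    finally show ?thesis .
  qed
  define B where "B = L + \<bar>C\<bar>"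
  have B: "B > 0" using L by (simp add: B_def add_pos_nonneg)
  \<comment> \<open>The bound 1 gives t^2 \<le> |t|; the quotient keeps a displacement of size B |t|
    from carrying the preimage of z beyond radius \<open>r\<close>.\<close>
  define \<tau>2 where "\<tau>2 = min (min \<tau>1 1) ((r - norm z) / B)"
  have \<tau>2: "\<tau>2 > 0" "\<tau>2 \<le> \<tau>1" "\<tau>2 \<le> 1"
    using core(1) r B by (auto simp: \<tau>2_def)
  have disp: "norm (N t s - s) \<le> B * \<bar>t\<bar>" if "\<bar>t\<bar> < \<tau>2" "s \<in> cball 0 r" for t s
  proof -
    have "norm (N t s - s) \<le> norm (N t s - s - of_real t * S s) + norm (of_real t * S s)"
      using norm_triangle_ineq[of "N t s - s - of_real t * S s" "of_real t * S s"] by simp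
    also have "\<dots> \<le> \<bar>C\<bar> * t\<^sup>2 + \<bar>t\<bar> * L"
      using core'[of t s] SL[OF that(2)] that \<tau>2 by (intro add_mono) (auto simp: norm_mult intro: mult_left_mono)
    also have "\<bar>C\<bar> * t\<^sup>2 \<le> \<bar>C\<bar> * \<bar>t\<bar>"
    proof (rule mult_left_mono)
      have "\<bar>t\<bar> * \<bar>t\<bar> \<le> \<bar>t\<bar>"
        using that \<tau>2 by (intro mult_left_le) auto
      then show "t\<^sup>2 \<le> \<bar>t\<bar>"
        by (simp add: power2_eq_square)
    qed simp
    finally show ?thesis by (simp add: B_def algebra_simps)
  qed
  \<comment> \<open>The passage from N t to \<phi>_t: a solution s of N t s = z satisfies \<phi>_t z
    = \<phi> s, so \<sigma> t is that solution and inherits the expansion of N t with the opposite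
    sign.\<close>
  define \<sigma> where "\<sigma> t = F (phi_plus (g t) z)" for t
  have \<sigma>: "\<sigma> t \<in> cball 0 r" "N t (\<sigma> t) = z" "phi_plus (g t) z = \<phi> (\<sigma> t)" if t: "\<bar>t\<bar> < \<tau>2" for t
  proof -
    have t0: "\<bar>t\<bar> < \<tau>0" using t \<tau>2 core(2) by simp
    have c1: "continuous_on (cball 0 r) (N t)"
      using holomorphic_on_imp_continuous_on[OF N_holo[OF t0]] radii by (auto elim: continuous_on_subset)
    have c2: "norm z + B * \<bar>t\<bar> \<le> r"
      using t B by (auto simp: \<tau>2_def field_simps)
    obtain s where s: "s \<in> cball 0 r" "N t s = z"
      using near_identity_preimage[OF c1 disp[OF t] c2] r by auto
    have "s \<in> ball 0 q" "norm s < 1" using s radii by auto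
    then have "phi_plus (g t) z = \<phi> s"
      using N_inv(1)[OF t0, of s] s(2) by simp
    moreover from this have "\<sigma> t = s"
      using ci(5)[of s] \<open>norm s < 1\<close> by (simp add: \<sigma>_def)
    ultimately show "\<sigma> t \<in> cball 0 r" "N t (\<sigma> t) = z" "phi_plus (g t) z = \<phi> (\<sigma> t)"
      using s by auto
  qed
  have \<sigma>_near: "norm (\<sigma> t - z) \<le> B * \<bar>t\<bar>" if "\<bar>t\<bar> < \<tau>2" for t
    using disp[OF that \<sigma>(1)[OF that]] \<sigma>(2)[OF that] by (simp add: norm_minus_commute)
  have \<sigma>0: "\<sigma> 0 = z"
    using \<sigma>_near[of 0] \<tau>2(1) by simp
  have "eventually (\<lambda>t. norm (\<sigma> t - z) \<le> B * \<bar>t\<bar>) (at 0)"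
    using \<sigma>_near \<tau>2(1) by (auto simp: eventually_at dist_real_def intro!: exI[of _ \<tau>2])
  moreover have "((\<lambda>t. B * \<bar>t\<bar>) \<longlongrightarrow> 0) (at (0::real))"
    by (auto intro!: tendsto_eq_intros)
  ultimately have "((\<lambda>t. \<sigma> t - z) \<longlongrightarrow> 0) (at 0)"
    by (rule Lim_null_comparison)
  then have \<sigma>_lim: "(\<sigma> \<longlongrightarrow> z) (at 0)"
    using LIM_zero_cancel by blast
  have "isCont S z"
    using S_cont z by (simp add: continuous_on_eq_continuous_at)
  then have S_lim: "((\<lambda>t. S (\<sigma> t)) \<longlongrightarrow> S z) (at 0)"
    using \<sigma>_lim by (rule isCont_tendsto_compose)
  \<comment> \<open>From z = \<sigma> + t S(\<sigma>) + O(t^2) and S(\<sigma>) \<rightarrow> S z;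
    continuity of \<open>S\<close> at z is enough to replace the moving argument.\<close>
  have \<sigma>_deriv: "(\<sigma> has_vector_derivative E z) (at 0)"
  proof (rule has_vector_derivative_at_0I[OF \<tau>2(1)])
    fix t :: real assume t: "\<bar>t\<bar> < \<tau>2"
    have Ez: "E z = - S z"
      using sRs[of z] z by (simp add: S_def)
    have "\<sigma> t - \<sigma> 0 - t *\<^sub>R E z = - (N t (\<sigma> t) - \<sigma> t - of_real t * S (\<sigma> t)) - of_real t * (S (\<sigma> t) - S z)"
      using \<sigma>(2)[OF t] by (simp add: \<sigma>0 Ez scaleR_conv_of_real algebra_simps)
    then have "norm (\<sigma> t - \<sigma> 0 - t *\<^sub>R E z)
        \<le> norm (N t (\<sigma> t) - \<sigma> t - of_real t * S (\<sigma> t)) + norm (of_real t * (S (\<sigma> t) - S z))"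
      by (metis norm_minus_cancel norm_triangle_ineq4)
    also have "\<dots> \<le> \<bar>C\<bar> * t\<^sup>2 + \<bar>t\<bar> * norm (S (\<sigma> t) - S z)"
      using core'[OF _ \<sigma>(1)[OF t]] t \<tau>2 by (simp add: norm_mult)
    also have "\<dots> = (\<bar>C\<bar> * \<bar>t\<bar> + norm (S (\<sigma> t) - S z)) * \<bar>t\<bar>"
      by (simp add: power2_eq_square algebra_simps)
    finally show "norm (\<sigma> t - \<sigma> 0 - t *\<^sub>R E z) \<le> (\<bar>C\<bar> * \<bar>t\<bar> + norm (S (\<sigma> t) - S z)) * \<bar>t\<bar>" .
  next
    have "((\<lambda>t. norm (S (\<sigma> t) - S z)) \<longlongrightarrow> 0) (at 0)"
      using S_lim by (intro tendsto_norm_zero LIM_zero)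
    moreover have "((\<lambda>t. \<bar>C\<bar> * \<bar>t\<bar>) \<longlongrightarrow> 0) (at (0::real))"
      by (auto intro!: tendsto_eq_intros)
    ultimately show "((\<lambda>t. \<bar>C\<bar> * \<bar>t\<bar> + norm (S (\<sigma> t) - S z)) \<longlongrightarrow> 0) (at 0)"
      using tendsto_add by fastforce
  qed
  have "(\<phi> has_field_derivative deriv \<phi> z) (at (\<sigma> 0))"
    unfolding \<sigma>0 by (rule holomorphic_derivI[OF ci(1) open_ball z])
  from field_vector_diff_chain_at[OF \<sigma>_deriv this]
  have "((\<lambda>t. \<phi> (\<sigma> t)) has_vector_derivative deriv \<phi> z * E z) (at 0)"
    by (simp add: o_def mult.commute)
  then have phi_deriv: "((\<lambda>t. phi_plus (g t) z) has_vector_derivative deriv \<phi> z * E z) (at 0)"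
    by (rule has_vector_derivative_transform_within_open[of _ _ _ "ball 0 \<tau>2"]) (use \<tau>2 \<sigma>(3) in auto)
  then show ?phi
    by (simp add: g_def \<phi>_def)
  have nu0: "deriv (N 0) 0 = 1"
    using core(4)[of 0] core(1) by simp
  have "((\<lambda>t. deriv (N t) 0) has_vector_derivative Rs 0) (at 0)"
  proof (rule has_vector_derivative_at_0I[OF core(1)])
    fix t :: real assume "\<bar>t\<bar> < \<tau>1"
    from core(4)[OF this] show "norm (deriv (N t) 0 - deriv (N 0) 0 - t *\<^sub>R Rs 0) \<le> (C * \<bar>t\<bar>) * \<bar>t\<bar>"
      by (simp add: nu0 scaleR_conv_of_real diff_diff_eq power2_eq_square mult.assoc)
  next
    show "((\<lambda>t. C * \<bar>t\<bar>) \<longlongrightarrow> 0) (at (0::real))"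
      by (auto intro!: tendsto_eq_intros)
  qed
  \<comment> \<open>As 1 / rho0 of the deformed loop is \<open>deriv (N t) 0 / \<rho>\<close>,
    \<open>u_plus\<close> is a product of two functions already differentiated.\<close>
  from has_vector_derivative_mult_right[OF has_vector_derivative_mult[OF phi_deriv this], of "inverse (of_real \<rho>)"]
  have "((\<lambda>t. inverse (of_real \<rho>) * (phi_plus (g t) z * deriv (N t) 0)) has_vector_derivative
      (deriv \<phi> z * E z - \<phi> z * of_real (Re (a * deriv p 0))) / of_real \<rho>) (at 0)"
    by (simp add: nu0 g_def \<phi>_def Rs0 p1(3) divide_inverse algebra_simps)
  then have "((\<lambda>t. u_plus (g t) z) has_vector_derivative
      (deriv \<phi> z * E z - \<phi> z * of_real (Re (a * deriv p 0))) / of_real \<rho>) (at 0)"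
  proof (rule has_vector_derivative_transform_within_open[of _ _ _ "ball 0 \<tau>0"])
    fix t :: real assume "t \<in> ball 0 \<tau>0"
    then show "inverse (of_real \<rho>) * (phi_plus (g t) z * deriv (N t) 0) = u_plus (g t) z"
      using N_deriv[of t] \<phi>(4) by (simp add: u_plus_def field_simps)
  qed (use def(1) in auto)
  then show ?u
    by (simp add: g_def \<phi>_def \<rho>_def)
qed

section \<open>From the variation to the operators\<close>

text \<open>Writing \<phi> = s w with \<open>w\<close> free of zeros makes w^{n+1} / \<phi>'
  holomorphic for every integer n; only the factor s^{n+1} can be singular.\<close>

lemma phi_plus_quotient_decomposition:
  fixes n :: int
  assumes \<gamma>: "\<gamma> \<in> Loop1"
  obtains p b M where "p holomorphic_on ball 0 1" "p 0 = 0"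
    "\<And>s. s \<in> ball 0 1 \<Longrightarrow> s \<noteq> 0 \<Longrightarrow>
      phi_plus \<gamma> s powi (n + 1) / deriv (phi_plus \<gamma>) s = p s + (\<Sum>j<M::nat. b j * s powi (- int j))"
proof -
  note \<phi> = phi_plus_properties[OF \<gamma>]
  note ci = conformal_isoD[OF \<phi>(1)]
  obtain w where w: "w holomorphic_on ball 0 1" "\<And>s. norm s < 1 \<Longrightarrow> phi_plus \<gamma> s = s * w s" "deriv (phi_plus \<gamma>) 0 = w 0"
    using Schwarz3[OF ci(1) \<phi>(2)] by metis
  have d: "deriv (phi_plus \<gamma>) s \<noteq> 0" if "s \<in> ball 0 1" for s
    using holomorphic_injective_imp_regular[OF ci(1) _ ci(3) that] by simp
  have w_nz: "w s \<noteq> 0" if s: "s \<in> ball 0 1" for s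
  proof (cases "s = 0")
    case True
    then show ?thesis using d[of 0] w(3) by simp
  next
    case False
    then have "phi_plus \<gamma> s \<noteq> 0"
      using inj_onD[OF ci(3), of s 0] \<phi>(2) s by auto
    then show ?thesis using w(2)[of s] s by auto
  qed
  have h: "(\<lambda>s. w s powi (n + 1) / deriv (phi_plus \<gamma>) s) holomorphic_on ball 0 1"
    using w_nz d by (intro holomorphic_intros w(1) holomorphic_deriv[OF ci(1)]) auto
  obtain p b M where p: "p holomorphic_on ball 0 1" "p 0 = 0"
    "\<And>s. s \<in> ball 0 1 \<Longrightarrow> s \<noteq> 0 \<Longrightarrow>
      s powi (n + 1) * (w s powi (n + 1) / deriv (phi_plus \<gamma>) s) = p s + (\<Sum>j<M::nat. b j * s powi (- int j))"
    by (fact power_int_times_holomorphic_decomposition[OF h, of "n + 1"])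
  show thesis
  proof (rule that[OF p(1,2)])
    show "phi_plus \<gamma> s powi (n + 1) / deriv (phi_plus \<gamma>) s = p s + (\<Sum>j<M. b j * s powi (- int j))"
      if "s \<in> ball 0 1" "s \<noteq> 0" for s
      using p(3)[OF that] w(2)[of s] that by (simp add: power_int_mult_distrib)
  qed
qed

text \<open>Two signs cancel: the field carries a minus, and the action uses exp(-t v). What remains
  is the flow of a w^{n+1} at time t.\<close>

lemma flow_image_eq_power_flow:
  assumes \<gamma>: "\<gamma> \<in> Loop1" and a: "norm a = 1"
  obtains \<tau>0 where "\<tau>0 > 0"
    "\<And>t. \<bar>t\<bar> < \<tau>0 \<Longrightarrow> flow (\<lambda>w. - (a * w powi (n + 1))) (- t) ` \<gamma> = power_flow n (a * of_real t) ` \<gamma>"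
proof -
  have comp: "compact \<gamma>" and nz: "0 \<notin> \<gamma>"
    using \<gamma> by (auto simp: Loop1_def)
  obtain R where R: "\<And>w. w \<in> \<gamma> \<Longrightarrow> norm w \<le> R"
    using compact_imp_bounded[OF comp] by (auto simp: bounded_iff)
  obtain \<epsilon> where \<epsilon>: "\<epsilon> > 0" "\<And>w. w \<in> \<gamma> \<Longrightarrow> \<epsilon> \<le> norm w"
    using separate_point_closed[OF compact_imp_closed[OF comp] nz] by auto
  obtain \<tau>0 where \<tau>0: "\<tau>0 > 0"
    "\<And>\<tau> w::complex. norm \<tau> < \<tau>0 \<Longrightarrow> \<epsilon> \<le> norm w \<Longrightarrow> norm w \<le> R \<Longrightarrow> norm (of_int n * \<tau> * w powi n) < 1"
    using power_flow_near_identity[OF \<epsilon>(1) zero_less_one] by metis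
  show thesis
  proof (rule that[OF \<tau>0(1)])
    fix t :: real assume t: "\<bar>t\<bar> < \<tau>0"
    have eq: "flow (\<lambda>w. - a * w powi (n + 1)) (- t) w = power_flow n (- a * of_real (- t)) w" if w: "w \<in> \<gamma>" for w
    proof (rule flow_eq_power_flow)
      show "w \<noteq> 0" using w nz by auto
      have "norm (- a * of_real (- t)) < \<tau>0" using t a by (simp add: norm_mult)
      then show "norm (of_int n * (- a * of_real (- t)) * w powi n) < 1"
        by (rule \<tau>0(2)[OF _ \<epsilon>(2)[OF w] R[OF w]])
    qed
    show "flow (\<lambda>w. - (a * w powi (n + 1))) (- t) ` \<gamma> = power_flow n (a * of_real t) ` \<gamma>"
      using eq by (intro image_cong) simp_all
  qed
qed

lemma pi0_eqI:
  assumes \<gamma>: "\<gamma> \<in> Loop1" and a: "norm a = 1"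
    and D: "((\<lambda>t. G (power_flow n (a * of_real t) ` \<gamma>)) has_vector_derivative D) (at 0)"
  shows "pi0_exists (\<lambda>w. - (a * w powi (n + 1))) G \<gamma>" "pi0 (\<lambda>w. - (a * w powi (n + 1))) G \<gamma> = D"
proof -
  obtain \<tau>0 where \<tau>0: "\<tau>0 > 0"
    "\<And>t. \<bar>t\<bar> < \<tau>0 \<Longrightarrow> flow (\<lambda>w. - (a * w powi (n + 1))) (- t) ` \<gamma> = power_flow n (a * of_real t) ` \<gamma>"
    using flow_image_eq_power_flow[OF \<gamma> a] by metis
  have D': "((\<lambda>t. G (flow (\<lambda>w. - (a * w powi (n + 1))) (- t) ` \<gamma>)) has_vector_derivative D) (at 0)"
    by (rule has_vector_derivative_transform_within_open[OF D, of "ball 0 \<tau>0"]) (use \<tau>0 in auto)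
  then show "pi0_exists (\<lambda>w. - (a * w powi (n + 1))) G \<gamma>"
    unfolding pi0_exists_def by (rule differentiableI_vector)
  from D' show "pi0 (\<lambda>w. - (a * w powi (n + 1))) G \<gamma> = D"
    unfolding pi0_def by (rule vector_derivative_at)
qed

text \<open>The two real fields are the directions a = 1 and a = \<i> of one family, so a derivative
  known for every unit \<open>a\<close> suffices.\<close>

lemma pi_L_eqI:
  assumes \<gamma>: "\<gamma> \<in> Loop1"
    and D: "\<And>a. norm a = 1 \<Longrightarrow> ((\<lambda>t. G (power_flow n (a * of_real t) ` \<gamma>)) has_vector_derivative D a) (at 0)"
  shows "pi_L_exists n G \<gamma>" "pi_L n G \<gamma> = 1 / 2 * (D 1 - \<i> * D \<i>)"
proof -
  have v: "vecL n = (\<lambda>w. - (1 * w powi (n + 1)))" "veciL n = (\<lambda>w. - (\<i> * w powi (n + 1)))"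
    by (simp_all add: fun_eq_iff vecL_def veciL_def)
  show "pi_L_exists n G \<gamma>" "pi_L n G \<gamma> = 1 / 2 * (D 1 - \<i> * D \<i>)"
    unfolding pi_L_exists_def pi_L_def v
    using pi0_eqI[OF \<gamma> _ D, of 1] pi0_eqI[OF \<gamma> _ D, of \<i>] by simp_all
qed

theorem theorem4p6:
  fixes n :: int and \<gamma> :: "complex set" and z :: complex
  assumes "\<gamma> \<in> Loop1" and "z \<in> ball 0 1"
  shows "(pi_L_exists n (\<lambda>\<eta>. phi_plus \<eta> z) \<gamma> \<and>
          pi_L n (\<lambda>\<eta>. phi_plus \<eta> z) \<gamma> =
            deriv (phi_plus \<gamma>) z *
              pos_part (\<lambda>s. phi_plus \<gamma> s powi (n + 1) / deriv (phi_plus \<gamma>) s) z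
            - 1 / 2 * z * deriv (phi_plus \<gamma>) z *
              residue (\<lambda>s. phi_plus \<gamma> s powi (n + 1) / (deriv (phi_plus \<gamma>) s * s ^ 2)) 0) \<and>
         (pi_L_exists n (\<lambda>\<eta>. u_plus \<eta> z) \<gamma> \<and>
          pi_L n (\<lambda>\<eta>. u_plus \<eta> z) \<gamma> =
            complex_of_real (rho0 \<gamma>) powi n *
              (deriv (u_plus \<gamma>) z *
                 pos_part (\<lambda>s. u_plus \<gamma> s powi (n + 1) / deriv (u_plus \<gamma>) s) z
               - 1 / 2 * (z * deriv (u_plus \<gamma>) z + u_plus \<gamma> z) *
                 residue (\<lambda>s. u_plus \<gamma> s powi (n + 1) / (deriv (u_plus \<gamma>) s * s ^ 2)) 0))"
proof -
  define \<phi> where "\<phi> = phi_plus \<gamma>"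
  define \<rho> where "\<rho> = complex_of_real (rho0 \<gamma>)"
  note \<phi> = phi_plus_properties[OF assms(1), folded \<phi>_def]
  note ci = conformal_isoD[OF \<phi>(1)]
  have \<rho>0: "\<rho> \<noteq> 0" using \<phi>(4) by (simp add: \<rho>_def)
  obtain p b M where p: "p holomorphic_on ball 0 1" "p 0 = 0"
    and f: "\<And>s. s \<in> ball 0 1 \<Longrightarrow> s \<noteq> 0 \<Longrightarrow>
      \<phi> s powi (n + 1) / deriv \<phi> s = p s + (\<Sum>j<M::nat. b j * s powi (- int j))"
    using phi_plus_quotient_decomposition[OF assms(1), of n, folded \<phi>_def] by blast
  define p' where "p' = deriv p 0"
  define E where "E a = a * p z - \<i> * of_real (Im (a * p')) * z + (\<Sum>j<M. cnj (a * b j) * z ^ (j + 2))" for a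
  \<comment> \<open>Conjugation turns \<i> into -\<i>; this sign makes the reflected terms drop out
    of E 1 - \<i> E \<i>.\<close>
  have sum_i: "(\<Sum>j<M. cnj (\<i> * b j) * z ^ (j + 2)) = - \<i> * (\<Sum>j<M. cnj (1 * b j) * z ^ (j + 2))"
    by (simp add: sum_distrib_left mult.assoc sum_negf)
  have p'_eq: "p' = of_real (Re p') + \<i> * of_real (Im p')"
    by (rule complex_eq)
  have ii: "\<i> * (\<i> * x) = - x" for x :: complex
    by (simp flip: mult.assoc)
  have E_comb: "1 / 2 * (E 1 - \<i> * E \<i>) = p z - 1 / 2 * z * p'"
  proof -
    define T where "T = (\<Sum>j<M. cnj (1 * b j) * z ^ (j + 2))"
    have e1: "E 1 = p z - \<i> * of_real (Im p') * z + T"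
      by (simp add: E_def T_def)
    have ei: "E \<i> = \<i> * p z - \<i> * of_real (Re p') * z - \<i> * T"
      unfolding E_def sum_i T_def by simp
    \<comment> \<open>The linear part doubles, and the terms with Im p' and Re p' recombine to the
      full -z p'; this is the origin of the residue term with factor 1/2.\<close>
    have "E 1 - \<i> * E \<i> = 2 * p z - z * (of_real (Re p') + \<i> * of_real (Im p'))"
      unfolding e1 ei by (simp add: algebra_simps ii)
    then show ?thesis
      using p'_eq by simp
  qed
  \<comment> \<open>The same recombination for the variation of \<open>rho0\<close>; it accounts for
    the summand u(z) beside z u'(z).\<close>
  have Re_comb: "of_real (Re (1 * p')) - \<i> * of_real (Re (\<i> * p')) = p'"
    using p'_eq by simp
  have var: "((\<lambda>t. phi_plus (power_flow n (a * of_real t) ` \<gamma>) z) has_vector_derivative deriv \<phi> z * E a) (at 0)"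
    "((\<lambda>t. u_plus (power_flow n (a * of_real t) ` \<gamma>) z) has_vector_derivative
      (deriv \<phi> z * E a - \<phi> z * of_real (Re (a * p'))) / \<rho>) (at 0)" if "norm a = 1" for a
    unfolding p'_def E_def \<phi>_def \<rho>_def
    by (rule phi_plus_variation[OF assms(1) that assms(2) p f[unfolded \<phi>_def]]; assumption)+
  have phi: "pi_L_exists n (\<lambda>\<eta>. phi_plus \<eta> z) \<gamma>"
    "pi_L n (\<lambda>\<eta>. phi_plus \<eta> z) \<gamma> = 1 / 2 * (deriv \<phi> z * E 1 - \<i> * (deriv \<phi> z * E \<i>))"
    by (rule pi_L_eqI[OF assms(1)], erule var(1))+
  have u: "pi_L_exists n (\<lambda>\<eta>. u_plus \<eta> z) \<gamma>"
    "pi_L n (\<lambda>\<eta>. u_plus \<eta> z) \<gamma> = 1 / 2 * ((deriv \<phi> z * E 1 - \<phi> z * of_real (Re (1 * p'))) / \<rho>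
        - \<i> * ((deriv \<phi> z * E \<i> - \<phi> z * of_real (Re (\<i> * p'))) / \<rho>))"
    by (rule pi_L_eqI[OF assms(1)], erule var(2))+
  have pos: "pos_part (\<lambda>s. \<phi> s powi (n + 1) / deriv \<phi> s) z = p z"
    by (rule pos_part_decomposition[OF p f assms(2)])
  have res: "residue (\<lambda>s. \<phi> s powi (n + 1) / (deriv \<phi> s * s\<^sup>2)) 0 = p'"
    using residue_decomposition[OF p f] by (simp add: p'_def)
  have u_eq: "u_plus \<gamma> = (\<lambda>s. \<phi> s / \<rho>)"
    by (simp add: fun_eq_iff u_plus_def \<phi>_def \<rho>_def)
  have u_deriv: "deriv (u_plus \<gamma>) s = deriv \<phi> s / \<rho>" if "s \<in> ball 0 1" for s
    unfolding u_eq
    by (rule DERIV_imp_deriv[OF DERIV_cdivide[OF holomorphic_derivI[OF ci(1) open_ball that]]])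
  \<comment> \<open>Replacing \<phi> by \<phi> / \<rho> multiplies the numerator by \<rho>^{-n-1}
    and the inverse of the derivative by \<rho>, which the factor \<rho>^n of the statement
    undoes.\<close>
  define c where "c = \<rho> powi (- n)"
  have fu: "u_plus \<gamma> s powi (n + 1) / deriv (u_plus \<gamma>) s = c * p s + (\<Sum>j<M. (c * b j) * s powi (- int j))"
    if "s \<in> ball 0 1" "s \<noteq> 0" for s
  proof -
    have "u_plus \<gamma> s powi (n + 1) / deriv (u_plus \<gamma>) s = c * (\<phi> s powi (n + 1) / deriv \<phi> s)"
      using \<rho>0 unfolding u_deriv[OF that(1)] unfolding u_eq
      by (simp add: c_def power_int_divide_distrib power_int_add power_int_minus field_simps)
    then show ?thesis
      unfolding f[OF that] by (simp add: sum_distrib_left algebra_simps)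
  qed
  have cp: "(\<lambda>s. c * p s) holomorphic_on ball 0 1" "c * p 0 = 0"
    using p by (auto intro!: holomorphic_intros)
  have cp': "deriv (\<lambda>s. c * p s) 0 = c * p'"
    unfolding p'_def
    by (rule DERIV_imp_deriv[OF DERIV_cmult[OF holomorphic_derivI[OF p(1) open_ball]]]) simp
  have u_pos: "pos_part (\<lambda>s. u_plus \<gamma> s powi (n + 1) / deriv (u_plus \<gamma>) s) z = c * p z"
    by (rule pos_part_decomposition[OF cp fu assms(2)])
  have u_res: "residue (\<lambda>s. u_plus \<gamma> s powi (n + 1) / (deriv (u_plus \<gamma>) s * s\<^sup>2)) 0 = c * p'"
    using residue_decomposition[OF cp fu] by (simp add: cp')
  have "1 / 2 * (deriv \<phi> z * E 1 - \<i> * (deriv \<phi> z * E \<i>)) = deriv \<phi> z * (1 / 2 * (E 1 - \<i> * E \<i>))"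
    by (simp add: algebra_simps)
  also have "\<dots> = deriv \<phi> z * p z - 1 / 2 * z * deriv \<phi> z * p'"
    unfolding E_comb by (simp add: algebra_simps)
  finally have 1: "pi_L n (\<lambda>\<eta>. phi_plus \<eta> z) \<gamma> = deriv \<phi> z * p z - 1 / 2 * z * deriv \<phi> z * p'"
    unfolding phi(2) .
  have "1 / 2 * ((deriv \<phi> z * E 1 - \<phi> z * of_real (Re (1 * p'))) / \<rho>
        - \<i> * ((deriv \<phi> z * E \<i> - \<phi> z * of_real (Re (\<i> * p'))) / \<rho>))
      = (deriv \<phi> z * (1 / 2 * (E 1 - \<i> * E \<i>))
        - 1 / 2 * \<phi> z * (of_real (Re (1 * p')) - \<i> * of_real (Re (\<i> * p')))) / \<rho>"
    by (simp add: diff_divide_distrib add_divide_distrib algebra_simps)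
  also have "\<dots> = deriv \<phi> z / \<rho> * p z - 1 / 2 * (z * (deriv \<phi> z / \<rho>) + \<phi> z / \<rho>) * p'"
    unfolding E_comb Re_comb using \<rho>0 by (simp add: field_simps)
  also have "\<dots> = \<rho> powi n * (deriv \<phi> z / \<rho> * (c * p z) - 1 / 2 * (z * (deriv \<phi> z / \<rho>) + \<phi> z / \<rho>) * (c * p'))"
  proof -
    have "\<rho> powi n * c = 1"
      using \<rho>0 by (simp add: c_def power_int_minus)
    then have "x = \<rho> powi n * (c * x)" for x
      by (simp flip: mult.assoc)
    from this[of "deriv \<phi> z / \<rho> * p z - 1 / 2 * (z * (deriv \<phi> z / \<rho>) + \<phi> z / \<rho>) * p'"] show ?thesis
      by (simp add: right_diff_distrib mult.left_commute mult.assoc)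
  qed
  finally have 2: "pi_L n (\<lambda>\<eta>. u_plus \<eta> z) \<gamma> = \<rho> powi n * (deriv \<phi> z / \<rho> * (c * p z)
      - 1 / 2 * (z * (deriv \<phi> z / \<rho>) + \<phi> z / \<rho>) * (c * p'))"
    unfolding u(2) .
  show ?thesis
    unfolding \<phi>_def[symmetric] \<rho>_def[symmetric] pos res u_pos u_res u_deriv[OF assms(2)]
    using phi(1) u(1) 1 2 by (simp add: u_eq)
qed

end
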